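(* Suppose $\Omega_\varepsilon=\Omega_\varepsilon(0,e_1)$, where $e_1=(1,0)$ (i.e. $y=0$ and $\tau=e_1$). Then the tensor $\mathbb M$ has the spectral decomposition $$\mathbb M=\sum_{n=1}^{m}E^n\otimes E^n+\frac1\kappa\,E^{m+1}\otimes E^{m+1}.$$
   Context: Setting. Fix an integer $m\ge 2$ and $0<\kappa<\tfrac12$. $\Omega\subset\mathbb R^2$ is open, connected, bounded with Lipschitz boundary; $K\subset\Omega$ is closed with positive 2-dimensional Hausdorff measure; $\delta_0>0$ and $L_0\subseteq\Omega\setminus K$ is an open domain with smooth boundary and $\mathrm{dist}(\overline{L_0},\partial\Omega\cup K)\ge\delta_0$. For $y\in L_0$, $\tau\in\mathbb S^1$ and $0<\varepsilon<1$ let $\Sigma_\varepsilon=\{y+\rho\tau:-\varepsilon\le\rho\le\varepsilon\}$ and $\Omega_\varepsilon=\Omega_\varepsilon(y,\tau)=\{x\in\mathbb R^2:\mathrm{dist}(x,\Sigma_\varepsilon)<\varepsilon^2\}$; $\varepsilon$ is always such that $\Omega_\varepsilon\subset L_0$. Here $y=0\in L_0$, $\tau=e_1$. $|\Omega_\varepsilon|$ is Lebesgue measure. Tensors. $\bm i=(i_1,\dots,i_m)$, $i_k\in\{1,2\}$; $A\cdot B=\sum_{\bm i}A_{\bm i}B_{\bm i}$, $|A|^2=A\cdot A$ for tensors of order $m$; $(A\otimes B)_{\bm i\bm j}=A_{\bm i}B_{\bm j}$; $(\nabla^m u)_{\bm i}=\partial^m u/\partial x_{i_1}\cdots\partial x_{i_m}$;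 $(\nabla\cdot)^m$ is the divergence applied $m$ times. $S^m(\mathbb R^2)$ is the space of symmetric tensors of order $m$ (dimension $m+1$), and $\mathbb M$ is regarded as a map $S^m(\mathbb R^2)\to S^m(\mathbb R^2)$. The tensor $\mathbb M$. Let $V^{\bm i}(x)=\frac1{m!}x_{i_1}\cdots x_{i_m}$, $\gamma_\varepsilon=\kappa$ in $\Omega_\varepsilon$ and $1$ elsewhere, and let $V^{\bm i}_\varepsilon\in H^m(\Omega)$ be the weak solution of $(\nabla\cdot)^m(\gamma_\varepsilon\nabla^m V^{\bm i}_\varepsilon)=0$ in $\Omega$ with $V^{\bm i}_\varepsilon-V^{\bm i}\in H^m_0(\Omega)$ (same trace and normal derivatives up to order $m-1$). $\mathbb M=(\mathbb M_{\bm i\bm j})$ is the tensor of order $2m$ defined, possibly up to extraction of a subsequence $\varepsilon\to0$, by $$\frac1{|\Omega_\varepsilon|}\int_{\Omega_\varepsilon}\frac{\partial^m V^{\bm i}_\varepsilon}{\partial x_{j_1}\cdots\partial x_{j_m}}\phi\,dx\to\mathbb M_{\bm i\bm j}\,\phi(y)\quad\text{for all }\phi\in C^0(\overline\Omega).$$ Basis. With $e_1=(1,0)$, $e_2=(0,1)$, the orthonormal basis $E^1,\dots,E^{m+1}$ of $S^m(\mathbb R^2)$ is: $E^h=\binom{m}{h-1}^{-1/2}\sum e_{k_1}\otimes\cdots\otimes e_{k_m}$, where the sum is over the $\binom m{h-1}$ distinct sequences $(k_1,\dots,k_m)\in\{1,2\}^m$ with exactly $m-h+1$ entries equal to $1$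 and $h-1$ entries equal to $2$. In particular $E^1=e_1\otimes\cdots\otimes e_1$ and $E^{m+1}=e_2\otimes\cdots\otimes e_2$. *)

theory Defs
  imports "HOL-Analysis.Analysis"
begin

section \<open>Geometry of the domain and of the inclusions\<close>

text \<open>Normalised so that it agrees with Lebesgue measure in integer dimension; meant for \<open>s > 0\<close>
  (for \<open>s = 0\<close> the convention \<open>0 powr 0 = 0\<close> is the wrong one).\<close>

definition hausdorff_measure :: "real \<Rightarrow> 'a::metric_space set \<Rightarrow> ennreal" where
  "hausdorff_measure s A =
     (SUP \<delta>\<in>{0<..}.
        INF C\<in>{C :: nat \<Rightarrow> 'a set. A \<subseteq> (\<Union>n. C n) \<and> (\<forall>n. bounded (C n) \<and> diameter (C n) \<le> \<delta>)}.
          (\<Sum>n. ennreal (unit_ball_vol s * (diameter (C n) / 2) powr s)))"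

text \<open>Near each boundary point, and up to an isometry, \<open>U\<close> is the region strictly above the graph
  of a function in the class \<open>P\<close>.\<close>

definition boundary_of_class :: "((real \<Rightarrow> real) \<Rightarrow> bool) \<Rightarrow> (real^2) set \<Rightarrow> bool" where
  "boundary_of_class P U \<longleftrightarrow>
     (\<forall>p\<in>frontier U. \<exists>(R :: real^2 \<Rightarrow> real^2) r g. orthogonal_transformation R \<and> r > 0 \<and> P g \<and>
        (\<forall>z\<in>ball 0 r. p + R z \<in> U \<longleftrightarrow> z $ 2 > g (z $ 1)))"

definition lipschitz_boundary :: "(real^2) set \<Rightarrow> bool" where
  "lipschitz_boundary = boundary_of_class (\<lambda>g. \<exists>L. L-lipschitz_on UNIV g)"

definition smooth_boundary :: "(real^2) set \<Rightarrow> bool" where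
  "smooth_boundary = boundary_of_class (\<lambda>g. \<forall>n t. (deriv ^^ n) g differentiable (at t))"

definition core_segment :: "real^2 \<Rightarrow> real^2 \<Rightarrow> real \<Rightarrow> (real^2) set" where
  "core_segment y \<tau> \<epsilon> = {y + \<rho> *\<^sub>R \<tau> | \<rho>. - \<epsilon> \<le> \<rho> \<and> \<rho> \<le> \<epsilon>}"

definition inclusion :: "real^2 \<Rightarrow> real^2 \<Rightarrow> real \<Rightarrow> (real^2) set" where
  "inclusion y \<tau> \<epsilon> = {x. infdist x (core_segment y \<tau> \<epsilon>) < \<epsilon>\<^sup>2}"

definition coefficient :: "real \<Rightarrow> (real^2) set \<Rightarrow> real^2 \<Rightarrow> real" where
  "coefficient \<kappa> D x = (if x \<in> D then \<kappa> else 1)"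


section \<open>Tensors\<close>

text \<open>A multi-index is a list over the two-element type \<open>2\<close>, whose elements are \<open>1\<close> and \<open>2\<close>
  (where \<open>2 = 0\<close>).  A tensor of order \<open>m\<close> is a function on multi-indices of length \<open>m\<close>; its
  values elsewhere are irrelevant.  A tensor of order \<open>2m\<close> takes two multi-indices of length \<open>m\<close>.\<close>

definition multi_indices :: "nat \<Rightarrow> 2 list set" where
  "multi_indices m = {i. length i = m}"

definition tensor_inner :: "nat \<Rightarrow> (2 list \<Rightarrow> real) \<Rightarrow> (2 list \<Rightarrow> real) \<Rightarrow> real" where
  "tensor_inner m A B = (\<Sum>i\<in>multi_indices m. A i * B i)"

definition tensor_prod :: "(2 list \<Rightarrow> real) \<Rightarrow> (2 list \<Rightarrow> real) \<Rightarrow> 2 list \<Rightarrow> 2 list \<Rightarrow> real" where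
  "tensor_prod A B i j = A i * B j"

definition vectors_prod :: "(real^2) list \<Rightarrow> 2 list \<Rightarrow> real" where
  "vectors_prod vs i = (\<Prod>l<length vs. (vs ! l) $ (i ! l))"

definition sym_basis :: "nat \<Rightarrow> nat \<Rightarrow> 2 list \<Rightarrow> real" where
  "sym_basis m h i = 1 / sqrt (real (m choose (h - 1))) *
     (\<Sum>k\<in>{k\<in>multi_indices m. count_list k 1 = m + 1 - h \<and> count_list k 2 = h - 1}.
        vectors_prod (map (\<lambda>a. axis a 1) k) i)"


section \<open>Sobolev spaces\<close>

primrec iter_partial :: "2 list \<Rightarrow> (real^2 \<Rightarrow> real) \<Rightarrow> real^2 \<Rightarrow> real" where
  "iter_partial [] f = f"
| "iter_partial (a # i) f = (\<lambda>x. frechet_derivative (iter_partial i f) (at x) (axis a 1))"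

text \<open>\<open>C\<^sup>\<infinity>\<close> functions with compact support in \<open>U\<close>.\<close>

definition test_functions :: "(real^2) set \<Rightarrow> (real^2 \<Rightarrow> real) set" where
  "test_functions U = {\<phi>. (\<forall>i x. iter_partial i \<phi> differentiable (at x)) \<and>
     compact (closure {x. \<phi> x \<noteq> 0}) \<and> closure {x. \<phi> x \<noteq> 0} \<subseteq> U}"

definition locally_integrable :: "(real^2) set \<Rightarrow> (real^2 \<Rightarrow> real) \<Rightarrow> bool" where
  "locally_integrable U f \<longleftrightarrow> (\<forall>C. compact C \<and> C \<subseteq> U \<longrightarrow> integrable (lebesgue_on C) f)"

definition has_weak_partial ::
    "(real^2) set \<Rightarrow> 2 list \<Rightarrow> (real^2 \<Rightarrow> real) \<Rightarrow> (real^2 \<Rightarrow> real) \<Rightarrow> bool" where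
  "has_weak_partial U i u v \<longleftrightarrow> locally_integrable U u \<and> locally_integrable U v \<and>
     (\<forall>\<phi>\<in>test_functions U.
        integral\<^sup>L (lebesgue_on U) (\<lambda>x. u x * iter_partial i \<phi> x) =
        (-1) ^ length i * integral\<^sup>L (lebesgue_on U) (\<lambda>x. v x * \<phi> x))"

text \<open>Determined up to a null subset of \<open>U\<close>, and only ever used under an integral over a subset
  of \<open>U\<close>.\<close>

definition weak_partial :: "(real^2) set \<Rightarrow> 2 list \<Rightarrow> (real^2 \<Rightarrow> real) \<Rightarrow> real^2 \<Rightarrow> real" where
  "weak_partial U i u = (SOME v. has_weak_partial U i u v)"

definition L2_space :: "(real^2) set \<Rightarrow> (real^2 \<Rightarrow> real) set" where
  "L2_space U = {u \<in> borel_measurable (lebesgue_on U). integrable (lebesgue_on U) (\<lambda>x. (u x)\<^sup>2)}"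

definition sobolev :: "nat \<Rightarrow> (real^2) set \<Rightarrow> (real^2 \<Rightarrow> real) set" where
  "sobolev m U =
     {u \<in> L2_space U. \<forall>i. length i \<le> m \<longrightarrow> (\<exists>v\<in>L2_space U. has_weak_partial U i u v)}"

definition sobolev_norm :: "nat \<Rightarrow> (real^2) set \<Rightarrow> (real^2 \<Rightarrow> real) \<Rightarrow> real" where
  "sobolev_norm m U u =
     sqrt (\<Sum>i\<in>{i. length i \<le> m}. integral\<^sup>L (lebesgue_on U) (\<lambda>x. (weak_partial U i u x)\<^sup>2))"

definition sobolev0 :: "nat \<Rightarrow> (real^2) set \<Rightarrow> (real^2 \<Rightarrow> real) set" where
  "sobolev0 m U =
     {u \<in> sobolev m U. \<forall>e>0. \<exists>\<phi>\<in>test_functions U. sobolev_norm m U (\<lambda>x. u x - \<phi> x) < e}"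


section \<open>The boundary value problem\<close>

text \<open>Weak solution of \<open>(\<nabla>\<sqdot>)\<^sup>m (\<gamma> \<nabla>\<^sup>m u) = 0\<close> in \<open>U\<close> with the Dirichlet data of \<open>g\<close>.\<close>

definition weak_solution ::
    "nat \<Rightarrow> (real^2) set \<Rightarrow> (real^2 \<Rightarrow> real) \<Rightarrow> (real^2 \<Rightarrow> real) \<Rightarrow> (real^2 \<Rightarrow> real) \<Rightarrow> bool" where
  "weak_solution m U \<gamma> g u \<longleftrightarrow> u \<in> sobolev m U \<and> (\<lambda>x. u x - g x) \<in> sobolev0 m U \<and>
     (\<forall>w\<in>sobolev0 m U.
        integral\<^sup>L (lebesgue_on U)
          (\<lambda>x. \<gamma> x * tensor_inner m (\<lambda>i. weak_partial U i u x) (\<lambda>i. weak_partial U i w x)) = 0)"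

definition monomial :: "nat \<Rightarrow> 2 list \<Rightarrow> real^2 \<Rightarrow> real" where
  "monomial m i x = 1 / fact m * (\<Prod>l<m. x $ (i ! l))"

text \<open>\<open>M\<close> is the limit tensor along the sequence \<open>\<epsilon>\<close> of inclusion sizes.  The functions \<open>V k i\<close>
  are unique up to null sets, so the existential quantifier involves no choice.\<close>

definition is_limit_tensor ::
    "nat \<Rightarrow> real \<Rightarrow> (real^2) set \<Rightarrow> real^2 \<Rightarrow> real^2 \<Rightarrow> (nat \<Rightarrow> real) \<Rightarrow>
     (2 list \<Rightarrow> 2 list \<Rightarrow> real) \<Rightarrow> bool" where
  "is_limit_tensor m \<kappa> \<Omega> y \<tau> \<epsilon> M \<longleftrightarrow>
     (\<exists>V :: nat \<Rightarrow> 2 list \<Rightarrow> real^2 \<Rightarrow> real.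
        (\<forall>k. \<forall>i\<in>multi_indices m.
           weak_solution m \<Omega> (coefficient \<kappa> (inclusion y \<tau> (\<epsilon> k))) (monomial m i) (V k i)) \<and>
        (\<forall>i\<in>multi_indices m. \<forall>j\<in>multi_indices m. \<forall>\<phi>. continuous_on (closure \<Omega>) \<phi> \<longrightarrow>
           (\<lambda>k. 1 / measure lebesgue (inclusion y \<tau> (\<epsilon> k)) *
                integral\<^sup>L (lebesgue_on (inclusion y \<tau> (\<epsilon> k)))
                  (\<lambda>x. weak_partial \<Omega> j (V k i) x * \<phi> x))
             \<longlonglongrightarrow> M i j * \<phi> y))"

end

theory Submission
  imports Defs
begin

text \<open>
  The inclusion has length of order \<open>\<epsilon>\<close> in the direction \<open>e\<^sub>1\<close> and width of order \<open>\<epsilon>\<^sup>2\<close> in the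
  direction \<open>e\<^sub>2\<close>, so at its own scale it looks like an infinitely thin slab.  Across the slab the
  derivatives of order \<open>m\<close> that contain a tangential derivative do not see the inclusion, whereas
  the purely transversal derivative \<open>\<partial>\<^sub>2\<^sup>m\<close> has to jump so that its flux \<open>\<gamma> \<partial>\<^sub>2\<^sup>m\<close> is continuous:
  inside it is \<open>1 / \<kappa>\<close> times its value outside.  This is the asserted spectral decomposition.

  For the proof, let \<open>A = \<nabla>\<^sup>m V\<^sup>i\<close>, a constant tensor, and \<open>W = V\<^sub>\<epsilon>\<^sup>i - V\<^sup>i \<in> H\<^sub>0\<^sup>m\<close>.  As derivatives of
  order \<open>m\<close> of functions in \<open>H\<^sub>0\<^sup>m\<close> have mean value zero, \<open>W\<close> satisfies
  \<open>\<integral> \<gamma> \<nabla>\<^sup>m W \<sqdot> \<nabla>\<^sup>m w = (1 - \<kappa>) \<integral>\<^sub>D A \<sqdot> \<nabla>\<^sup>m w\<close> for all \<open>w \<in> H\<^sub>0\<^sup>m\<close>, where \<open>D\<close> is the inclusion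
  (\<open>perturbation_identity\<close>).  Taking \<open>w = W\<close> shows that the norm of \<open>\<nabla>\<^sup>m W\<close> in \<open>L\<^sup>2\<close> is at
  most a constant times the square root of \<open>|D|\<close> (\<open>energy_bound\<close>).

  The main tool is a family of test functions \<open>w(x) = f(x\<^sub>1) g(x\<^sub>2)\<close> whose \<open>m\<close>-th gradient is
  \<open>e\<^sub>2 \<otimes> \<dots> \<otimes> e\<^sub>2\<close> times the indicator of \<open>D\<close> up to an error whose square integral is small compared
  with \<open>|D|\<close> (\<open>concentrating_functions\<close>, \<open>test_functions_near_inclusion\<close>).  They exist because \<open>D\<close>
  is thin: \<open>g\<close> is an \<open>m\<close>-fold antiderivative of the indicator of an interval of length of order
  \<open>\<epsilon>\<^sup>2\<close>, and cutting off \<open>g\<close> and \<open>f\<close> at distance of order \<open>\<epsilon>\<close> adds to the derivatives of order \<open>m\<close>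
  only terms of order \<open>\<epsilon>\<close>, on an area of order \<open>\<epsilon>\<^sup>2\<close>, while \<open>|D|\<close> is of order \<open>\<epsilon>\<^sup>3\<close>.  Smoothing the
  indicator costs a further error of order \<open>d |D|\<close>, where the relative width \<open>d\<close> of the transition is
  arbitrary.  These functions are used twice.

  Inserting \<open>w\<close> into the identity for \<open>W\<close> gives
  \<open>\<kappa> \<integral>\<^sub>D \<partial>\<^sub>2\<^sup>m W \<approx> (1 - \<kappa>) A\<^sub>2\<^sub>\<dots>\<^sub>2 |D|\<close>, so the mean value of \<open>\<partial>\<^sub>2\<^sup>m W\<close> over \<open>D\<close> tends to
  \<open>(1 / \<kappa> - 1) A\<^sub>2\<^sub>\<dots>\<^sub>2\<close> (\<open>transversal_average\<close>).  For a derivative \<open>\<partial>\<^sub>1 \<partial>\<^sup>\<alpha>\<close> of order \<open>m\<close>, integration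
  by parts gives
  \<open>\<integral>\<^sub>D \<partial>\<^sub>1 \<partial>\<^sup>\<alpha> W \<approx> \<integral> \<partial>\<^sub>1 \<partial>\<^sup>\<alpha> W \<partial>\<^sub>2\<^sup>m w = \<integral> \<partial>\<^sub>2 \<partial>\<^sup>\<alpha> W \<partial>\<^sub>1 \<partial>\<^sub>2\<^sup>m\<^sup>-\<^sup>1 w \<approx> 0\<close>, so its mean value tends to \<open>0\<close>
  (\<open>longitudinal_average\<close>).  Adding the constant \<open>A\<close> yields the limit tensor.

  Weak derivatives are chosen by a description operator, so that all of this rests on their uniqueness
  almost everywhere, which is the fundamental lemma of the calculus of variations
  (\<open>fundamental_lemma\<close>).
\<close>

section \<open>Smooth functions of one variable and cutoff functions\<close>

definition smooth_real :: "(real \<Rightarrow> real) \<Rightarrow> bool" where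
  "smooth_real f \<longleftrightarrow> (\<forall>n x. (deriv ^^ n) f differentiable (at x))"

lemma smooth_real_has_derivative:
  assumes "smooth_real f"
  shows "((deriv ^^ n) f has_real_derivative (deriv ^^ Suc n) f x) (at x)"
  using assms by (simp add: smooth_real_def DERIV_deriv_iff_real_differentiable)

lemma smooth_real_continuous:
  assumes "smooth_real f"
  shows "continuous_on S ((deriv ^^ n) f)"
  by (rule DERIV_continuous_on, rule DERIV_subset, rule smooth_real_has_derivative[OF assms]) simp

text \<open>If every member of a set of functions has a derivative in the same set, then induction on the order
  shows that all members are smooth.\<close>

lemma smooth_real_coinduct:
  assumes "P f" and step: "\<And>f. P f \<Longrightarrow> \<exists>f'. P f' \<and> (\<forall>x. (f has_real_derivative f' x) (at x))"
  shows "smooth_real f"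
proof -
  have deriv: "P (deriv f) \<and> (\<forall>x. f differentiable (at x))" if f: "P f" for f
  proof -
    obtain f' where f': "P f'" "\<And>x. (f has_real_derivative f' x) (at x)"
      using step[OF f] by blast
    then have "deriv f = f'"
      by (auto intro!: DERIV_imp_deriv)
    with f' show ?thesis
      using real_differentiable_def by blast
  qed
  have "P ((deriv ^^ n) f)" for n :: nat
    by (induction n) (use \<open>P f\<close> deriv in auto)
  then show ?thesis
    using deriv by (simp add: smooth_real_def)
qed

lemma smooth_real_deriv:
  assumes "smooth_real f"
  shows "smooth_real ((deriv ^^ n) f)"
  unfolding smooth_real_def
proof (intro allI)
  fix k x
  show "(deriv ^^ k) ((deriv ^^ n) f) differentiable at x"
    using assms unfolding smooth_real_def
    by (metis (no_types) comp_apply funpow_add)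
qed

text \<open>The classical source of smooth functions with compact support is \<open>flat 0\<close>.  The powers of \<open>x\<close>
  make the family closed under differentiation, up to linear combinations.\<close>

definition flat :: "nat \<Rightarrow> real \<Rightarrow> real" where
  "flat n x = (if x > 0 then exp (- 1 / x) / x ^ n else 0)"

lemma flat_tendsto_0: "(flat n \<longlongrightarrow> 0) (at 0)"
proof (rule filterlim_split_at_real)
  show "(flat n \<longlongrightarrow> 0) (at_left 0)"
    by (rule tendsto_eventually, rule eventually_at_leftI[of "-1"]) (auto simp: flat_def)
  have "((\<lambda>x. (inverse x) ^ n / exp (inverse x)) \<longlongrightarrow> (0::real)) (at_right 0)"
    by (rule filterlim_compose[OF tendsto_power_div_exp_0 filterlim_inverse_at_top_right])
  moreover have "\<forall>\<^sub>F x in at_right 0. (inverse x) ^ n / exp (inverse x) = flat n x"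
    by (rule eventually_at_rightI[of 0 1]) (auto simp: flat_def field_simps exp_minus)
  ultimately show "(flat n \<longlongrightarrow> 0) (at_right 0)"
    using tendsto_cong by fast
qed

text \<open>At \<open>0\<close> the difference quotient of \<open>flat n\<close> is \<open>flat (n + 1)\<close>, which tends to \<open>0\<close> because the
  exponential beats every power.\<close>

lemma flat_has_derivative:
  "(flat n has_real_derivative flat (n + 2) x - real n * flat (n + 1) x) (at x)"
proof (cases x "0::real" rule: linorder_cases)
  case less
  show ?thesis
    by (rule has_field_derivative_transform_within_open[where S = "{..<0}" and f = "\<lambda>_. 0"])
       (use less in \<open>auto simp: flat_def\<close>)
next
  case equal
  have "(\<lambda>h. (flat n (0 + h) - flat n 0) / h) = flat (n + 1)"
    by (auto simp: flat_def fun_eq_iff)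
  then show ?thesis
    using equal flat_tendsto_0[of "n + 1"] by (simp add: DERIV_def flat_def)
next
  case greater
  define y where "y = inverse x"
  have "((\<lambda>x. exp (- inverse x) * inverse x ^ n) has_real_derivative
      exp (- y) * y\<^sup>2 * y ^ n + exp (- y) * (real n * y ^ (n - 1) * (- (y\<^sup>2)))) (at x)"
    using greater by (auto intro!: derivative_eq_intros simp: y_def power2_eq_square)
  also have "exp (- y) * y\<^sup>2 * y ^ n + exp (- y) * (real n * y ^ (n - 1) * (- (y\<^sup>2))) =
      exp (- y) * y ^ (n + 2) - real n * (exp (- y) * y ^ (n + 1))"
    by (cases n) (auto simp: power2_eq_square algebra_simps)
  also have "\<dots> = flat (n + 2) x - real n * flat (n + 1) x"
    using greater by (simp add: flat_def y_def divide_inverse power_inverse)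
  finally have "((\<lambda>x. exp (- inverse x) * inverse x ^ n) has_real_derivative
      flat (n + 2) x - real n * flat (n + 1) x) (at x)" .
  then show ?thesis
    by (rule has_field_derivative_transform_within_open[where S = "{0<..}"])
       (use greater in \<open>auto simp: flat_def divide_inverse power_inverse\<close>)
qed

text \<open>All closure properties of smooth functions are obtained at once: the smallest class that
  contains the smooth functions and is closed under the operations below is closed under
  differentiation, hence consists of smooth functions.\<close>

inductive smooth_closure :: "(real \<Rightarrow> real) \<Rightarrow> bool" where
  base: "smooth_real f \<Longrightarrow> smooth_closure f"
| flat: "smooth_closure (flat n)"
| const: "smooth_closure (\<lambda>x. c)"
| add: "smooth_closure f \<Longrightarrow> smooth_closure g \<Longrightarrow> smooth_closure (\<lambda>x. f x + g x)"
| mult: "smooth_closure f \<Longrightarrow> smooth_closure g \<Longrightarrow> smooth_closure (\<lambda>x. f x * g x)"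
| inverse: "smooth_closure f \<Longrightarrow> (\<And>x. f x \<noteq> 0) \<Longrightarrow> smooth_closure (\<lambda>x. inverse (f x))"
| affine: "smooth_closure f \<Longrightarrow> smooth_closure (\<lambda>x. f (a * x + b))"
| antiderivative: "smooth_closure f \<Longrightarrow> (\<And>x. (F has_real_derivative f x) (at x)) \<Longrightarrow> smooth_closure F"

lemma smooth_closure_deriv:
  "smooth_closure f \<Longrightarrow> \<exists>f'. smooth_closure f' \<and> (\<forall>x. (f has_real_derivative f' x) (at x))"
proof (induction rule: smooth_closure.induct)
  case (base f)
  then show ?case
    using smooth_real_has_derivative[of f 0] smooth_closure.base[OF smooth_real_deriv[of f 1]]
    by (intro exI[of _ "deriv f"]) simp
next
  case (flat n)
  have "smooth_closure (\<lambda>x. flat (n + 2) x + (- real n) * flat (n + 1) x)"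
    by (intro smooth_closure.add smooth_closure.mult smooth_closure.flat smooth_closure.const)
  then show ?case
    using flat_has_derivative by (intro exI[of _ "\<lambda>x. flat (n + 2) x + (- real n) * flat (n + 1) x"]) simp
next
  case (const c)
  show ?case
    by (rule exI[of _ "\<lambda>x. 0"]) (auto intro: smooth_closure.const)
next
  case (add f g)
  then obtain f' g' where "smooth_closure f'" "\<forall>x. (f has_real_derivative f' x) (at x)"
    "smooth_closure g'" "\<forall>x. (g has_real_derivative g' x) (at x)" by blast
  then show ?case
    by (intro exI[of _ "\<lambda>x. f' x + g' x"]) (auto intro!: smooth_closure.add derivative_eq_intros)
next
  case (mult f g)
  then obtain f' g' where fg: "smooth_closure f'" "\<forall>x. (f has_real_derivative f' x) (at x)"
    "smooth_closure g'" "\<forall>x. (g has_real_derivative g' x) (at x)" by blast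
  have "smooth_closure (\<lambda>x. f' x * g x + g' x * f x)"
    using mult.hyps fg by (intro smooth_closure.add smooth_closure.mult)
  with fg show ?case
    by (intro exI[of _ "\<lambda>x. f' x * g x + g' x * f x"]) (auto intro!: DERIV_mult)
next
  case (inverse f)
  then obtain f' where f': "smooth_closure f'" "\<forall>x. (f has_real_derivative f' x) (at x)" by blast
  have "smooth_closure (\<lambda>x. (-1) * (f' x * (inverse (f x) * inverse (f x))))"
    using inverse.hyps f' by (intro smooth_closure.mult smooth_closure.inverse smooth_closure.const)
  with f' inverse.hyps show ?case
    by (intro exI[of _ "\<lambda>x. (-1) * (f' x * (inverse (f x) * inverse (f x)))"])
       (auto intro!: DERIV_inverse_fun[THEN DERIV_cong])
next
  case (affine f a b)
  then obtain f' where f': "smooth_closure f'" "\<And>x. (f has_real_derivative f' x) (at x)" by blast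
  have "smooth_closure (\<lambda>x. a * f' (a * x + b))"
    by (rule smooth_closure.mult[OF smooth_closure.const smooth_closure.affine[OF f'(1)]])
  moreover have "((\<lambda>x. f (a * x + b)) has_real_derivative a * f' (a * x + b)) (at x)" for x
    by (rule DERIV_chain'[where g = f and f = "\<lambda>x. a * x + b" and D = a, THEN DERIV_cong])
       (auto intro!: derivative_eq_intros f')
  ultimately show ?case
    by blast
next
  case (antiderivative f F)
  then show ?case by blast
qed

lemma smooth_closure_smooth: "smooth_closure f \<Longrightarrow> smooth_real f"
  by (rule smooth_real_coinduct[where P = smooth_closure]) (auto intro: smooth_closure_deriv)

lemma smooth_real_const [simp]: "smooth_real (\<lambda>x. c)"
  and smooth_real_flat [simp]: "smooth_real (flat n)"
  by (auto intro: smooth_closure_smooth smooth_closure.const smooth_closure.flat)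

lemma smooth_real_antiderivative:
  "smooth_real f \<Longrightarrow> (\<And>x. (F has_real_derivative f x) (at x)) \<Longrightarrow> smooth_real F"
  by (rule smooth_closure_smooth, rule smooth_closure.antiderivative) (auto intro: smooth_closure.base)

lemma smooth_real_add: "smooth_real f \<Longrightarrow> smooth_real g \<Longrightarrow> smooth_real (\<lambda>x. f x + g x)"
  by (rule smooth_closure_smooth, rule smooth_closure.add) (auto intro: smooth_closure.base)

lemma smooth_real_mult: "smooth_real f \<Longrightarrow> smooth_real g \<Longrightarrow> smooth_real (\<lambda>x. f x * g x)"
  by (rule smooth_closure_smooth, rule smooth_closure.mult) (auto intro: smooth_closure.base)

lemma smooth_real_inverse:
  "smooth_real f \<Longrightarrow> (\<And>x. f x \<noteq> 0) \<Longrightarrow> smooth_real (\<lambda>x. inverse (f x))"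
  by (rule smooth_closure_smooth, rule smooth_closure.inverse) (auto intro: smooth_closure.base)

lemma smooth_real_affine: "smooth_real f \<Longrightarrow> smooth_real (\<lambda>x. f (a * x + b))"
  by (rule smooth_closure_smooth, rule smooth_closure.affine) (auto intro: smooth_closure.base)

lemma smooth_real_scale: "smooth_real f \<Longrightarrow> smooth_real (\<lambda>x. f (a * x))"
  using smooth_real_affine[of f a 0] by simp

lemma smooth_real_cmult: "smooth_real f \<Longrightarrow> smooth_real (\<lambda>x. c * f x)"
  by (intro smooth_real_mult) auto

lemma smooth_real_power: "smooth_real (\<lambda>x. x ^ n)"
proof -
  have "smooth_real (\<lambda>x. x)"
    by (rule smooth_real_antiderivative[of "\<lambda>x. 1"]) (auto intro!: derivative_eq_intros)
  then show ?thesis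
    by (induction n) (auto intro: smooth_real_mult)
qed

lemma higher_deriv_scale:
  assumes "smooth_real f"
  shows "(deriv ^^ n) (\<lambda>x. c * f (a * x)) = (\<lambda>x. c * a ^ n * (deriv ^^ n) f (a * x))"
proof (induction n)
  case (Suc n)
  have "((\<lambda>x. c * a ^ n * (deriv ^^ n) f (a * x)) has_real_derivative
      c * a ^ Suc n * (deriv ^^ Suc n) f (a * x)) (at x)" for x
  proof -
    have "((\<lambda>x. (deriv ^^ n) f (a * x)) has_real_derivative (deriv ^^ Suc n) f (a * x) * a) (at x)"
      by (rule DERIV_chain'[where g = "(deriv ^^ n) f", THEN DERIV_cong])
         (use smooth_real_has_derivative[OF assms] in \<open>auto intro!: derivative_eq_intros\<close>)
    from DERIV_cmult[OF this, of "c * a ^ n"] show ?thesis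
      by (simp add: mult_ac)
  qed
  then show ?case
    unfolding funpow.simps comp_def Suc.IH
    by (auto intro!: DERIV_imp_deriv)
qed simp

lemma higher_deriv_mult_real:
  assumes f: "smooth_real f" and g: "smooth_real g"
  shows "(deriv ^^ n) (\<lambda>x. f x * g x) =
    (\<lambda>x. \<Sum>k\<le>n. real (n choose k) * (deriv ^^ k) f x * (deriv ^^ (n - k)) g x)"
proof (induction n)
  case (Suc n)
  define F where "F k = (deriv ^^ k) f" for k
  define G where "G k = (deriv ^^ k) g" for k
  have F: "(F k has_real_derivative F (Suc k) x) (at x)" for k x
    using smooth_real_has_derivative[OF f] by (simp add: F_def)
  have G: "(G k has_real_derivative G (Suc k) x) (at x)" for k x
    using smooth_real_has_derivative[OF g] by (simp add: G_def)
  have "((\<lambda>x. \<Sum>k\<le>n. real (n choose k) * F k x * G (n - k) x) has_real_derivative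
      (\<Sum>k\<le>Suc n. real (Suc n choose k) * F k x * G (Suc n - k) x)) (at x)" for x
  proof -
    have "((\<lambda>x. \<Sum>k\<le>n. real (n choose k) * F k x * G (n - k) x) has_real_derivative
      (\<Sum>k\<le>n. real (n choose k) * F (Suc k) x * G (n - k) x + real (n choose k) * F k x * G (Suc n - k) x)) (at x)"
      by (rule DERIV_sum) (auto intro!: derivative_eq_intros F G simp: Suc_diff_le algebra_simps)
    also have "(\<Sum>k\<le>n. real (n choose k) * F (Suc k) x * G (n - k) x + real (n choose k) * F k x * G (Suc n - k) x)
       = (\<Sum>k\<le>Suc n. real (Suc n choose k) * F k x * G (Suc n - k) x)"
    proof -
      have "(\<Sum>k\<le>n. real (n choose k) * F k x * G (Suc n - k) x) =
          (\<Sum>k\<le>Suc n. real (n choose k) * F k x * G (Suc n - k) x)"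
        by simp
      also have "\<dots> = F 0 x * G (Suc n) x + (\<Sum>k\<le>n. real (n choose Suc k) * F (Suc k) x * G (n - k) x)"
        by (subst sum.atMost_Suc_shift) simp
      finally have "(\<Sum>k\<le>n. real (n choose k) * F k x * G (Suc n - k) x) = \<dots>" .
      moreover have "(\<Sum>k\<le>Suc n. real (Suc n choose k) * F k x * G (Suc n - k) x) =
         F 0 x * G (Suc n) x + (\<Sum>k\<le>n. real (Suc n choose Suc k) * F (Suc k) x * G (n - k) x)"
        by (subst sum.atMost_Suc_shift) simp
      ultimately show ?thesis
        by (simp add: sum.distrib algebra_simps)
    qed
    finally show ?thesis .
  qed
  then show ?case
    unfolding funpow.simps comp_def Suc.IH F_def G_def
    by (auto intro!: DERIV_imp_deriv)
qed simp

lemma higher_deriv_power: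
  "(deriv ^^ k) (\<lambda>x::real. c * x ^ n) =
     (\<lambda>x. if k \<le> n then c * (fact n / fact (n - k)) * x ^ (n - k) else 0)"
proof (induction k)
  case (Suc k)
  have "((\<lambda>x. if k \<le> n then c * (fact n / fact (n - k)) * x ^ (n - k) else 0) has_real_derivative
     (if Suc k \<le> n then c * (fact n / fact (n - Suc k)) * x ^ (n - Suc k) else 0)) (at x)" for x :: real
  proof (cases "Suc k \<le> n")
    case True
    then have [simp]: "n - k = Suc (n - Suc k)" by simp
    have "real (n - k) / fact (n - k) = 1 / fact (n - Suc k)"
      by (simp add: fact_Suc del: of_nat_Suc)
    then have "c * (fact n / fact (n - k)) * (real (n - k) * x ^ (n - k - 1)) =
        c * (fact n / fact (n - Suc k)) * x ^ (n - Suc k)"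
      by (simp add: divide_inverse mult_ac)
    moreover have "((\<lambda>x. c * (fact n / fact (n - k)) * x ^ (n - k)) has_real_derivative
        c * (fact n / fact (n - k)) * (real (n - k) * x ^ (n - k - 1))) (at x)"
      by (intro DERIV_cmult DERIV_pow[THEN DERIV_cong]) simp
    ultimately have "((\<lambda>x. c * (fact n / fact (n - k)) * x ^ (n - k)) has_real_derivative
        c * (fact n / fact (n - Suc k)) * x ^ (n - Suc k)) (at x)"
      by (rule DERIV_cong[rotated])
    with True show ?thesis
      by (simp only: if_True Suc_leD)
  qed (cases "k = n"; simp)
  then show ?case
    unfolding funpow.simps comp_def Suc.IH
    by (auto intro!: DERIV_imp_deriv)
qed simp

text \<open>A smooth transition from \<open>0\<close> on \<open>x \<le> 0\<close> to \<open>1\<close> on \<open>x \<ge> 1\<close>.\<close>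

definition smooth_step :: "real \<Rightarrow> real" where
  "smooth_step x = flat 0 x * inverse (flat 0 x + flat 0 (1 - x))"

lemma flat_nonneg: "flat n x \<ge> 0"
  by (simp add: flat_def)

lemma flat_pos: "flat 0 x + flat 0 (1 - x) > 0"
proof (cases "x > 0")
  case True
  then have "flat 0 x > 0" by (simp add: flat_def)
  then show ?thesis using flat_nonneg[of 0 "1 - x"] by linarith
next
  case False
  then have "flat 0 (1 - x) > 0" by (simp add: flat_def)
  then show ?thesis using flat_nonneg[of 0 x] by linarith
qed

lemma smooth_step_smooth: "smooth_real smooth_step"
proof -
  have "smooth_real (\<lambda>x. flat 0 (1 - x))"
    using smooth_real_affine[of "flat 0" "-1" 1] by simp
  then show ?thesis
    unfolding smooth_step_def using flat_pos
    by (intro smooth_real_mult smooth_real_inverse smooth_real_add) (auto simp: less_imp_neq[THEN not_sym])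
qed

lemma smooth_step_bounds: "0 \<le> smooth_step x" "smooth_step x \<le> 1"
  using flat_nonneg[of 0 x] flat_nonneg[of 0 "1 - x"] flat_pos[of x]
  by (auto simp: smooth_step_def field_simps)

lemma smooth_step_0: "x \<le> 0 \<Longrightarrow> smooth_step x = 0"
  by (simp add: smooth_step_def flat_def)

lemma smooth_step_1: "x \<ge> 1 \<Longrightarrow> smooth_step x = 1"
  by (simp add: smooth_step_def flat_def)

text \<open>Equal to \<open>1\<close> on \<open>[- 1, 1]\<close> and to \<open>0\<close> outside \<open>[- 1 - d, 1 + d]\<close>.\<close>

definition cutoff :: "real \<Rightarrow> real \<Rightarrow> real" where
  "cutoff d x = smooth_step ((1 + d - x) / d) * smooth_step ((1 + d + x) / d)"

lemma cutoff_smooth: "d > 0 \<Longrightarrow> smooth_real (cutoff d)"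
  using smooth_real_mult[OF smooth_real_affine[OF smooth_step_smooth, of "- 1 / d" "(1 + d) / d"]
      smooth_real_affine[OF smooth_step_smooth, of "1 / d" "(1 + d) / d"]]
  by (simp add: cutoff_def[abs_def] add_divide_distrib diff_divide_distrib algebra_simps)

lemma cutoff_bounds: "0 \<le> cutoff d x" "cutoff d x \<le> 1"
  unfolding cutoff_def using smooth_step_bounds by (auto intro: mult_le_one)

lemma cutoff_1: "d > 0 \<Longrightarrow> \<bar>x\<bar> \<le> 1 \<Longrightarrow> cutoff d x = 1"
  by (simp add: cutoff_def smooth_step_1 abs_le_iff field_simps)

lemma cutoff_0: "d > 0 \<Longrightarrow> \<bar>x\<bar> \<ge> 1 + d \<Longrightarrow> cutoff d x = 0"
  by (cases "x \<ge> 0") (auto simp: cutoff_def smooth_step_0 divide_nonpos_pos)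

lemma higher_deriv_zero_outside:
  fixes f :: "real \<Rightarrow> real"
  assumes "\<And>x. \<bar>x\<bar> > r \<Longrightarrow> f x = 0" and "\<bar>x\<bar> > r"
  shows "(deriv ^^ n) f x = 0"
  using assms(2)
proof (induction n arbitrary: x)
  case (Suc n)
  have "((deriv ^^ n) f has_real_derivative 0) (at x)"
  proof (rule has_field_derivative_transform_within_open[where f = "\<lambda>_. 0" and S = "{x. \<bar>x\<bar> > r}"])
    show "open {x::real. \<bar>x\<bar> > r}"
      by (intro open_Collect_less continuous_intros)
  qed (use Suc in auto)
  then show ?case
    by (auto intro: DERIV_imp_deriv)
qed (use assms in auto)

lemma smooth_real_antiderivative_exists:
  assumes f: "smooth_real f"
  obtains F where "smooth_real F" "\<And>x. (F has_real_derivative f x) (at x)" "F 0 = 0"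
proof -
  define F where "F x = (if x \<ge> 0 then integral {0..x} f else - integral {x..0} f)" for x
  have c: "continuous_on S f" for S
    using smooth_real_continuous[OF f, of S 0] by simp
  have "(F has_real_derivative f x) (at x)" for x
  proof -
    \<comment> \<open>Near \<open>x\<close>, the integral based at \<open>0\<close> differs by a constant from one based at a point \<open>a\<close> to
      the left of \<open>x\<close>, to which the fundamental theorem of calculus applies.\<close>
    define a where "a = - \<bar>x\<bar> - 1"
    define b where "b = \<bar>x\<bar> + 1"
    have int: "f integrable_on {s..t}" for s t
      by (intro integrable_continuous_real c)
    have eq: "F y = integral {a..y} f - integral {a..0} f" if "y \<in> {a<..<b}" for y
    proof (cases "y \<ge> 0")
      case True
      then have "integral {a..0} f + integral {0..y} f = integral {a..y} f"
        by (intro Henstock_Kurzweil_Integration.integral_combine int) (auto simp: a_def)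
      with True show ?thesis by (simp add: F_def)
    next
      case False
      then have "integral {a..y} f + integral {y..0} f = integral {a..0} f"
        using that by (intro Henstock_Kurzweil_Integration.integral_combine int) auto
      with False show ?thesis by (simp add: F_def)
    qed
    have "((\<lambda>y. integral {a..y} f) has_real_derivative f x) (at x within {a..b})"
      by (rule integral_has_real_derivative[OF c]) (auto simp: a_def b_def)
    then have "((\<lambda>y. integral {a..y} f) has_real_derivative f x) (at x)"
      by (subst (asm) at_within_interior) (auto simp: a_def b_def)
    then have "((\<lambda>y. integral {a..y} f - integral {a..0} f) has_real_derivative f x) (at x)"
      by (auto intro!: derivative_eq_intros)
    then show ?thesis
      by (rule has_field_derivative_transform_within_open[where S = "{a<..<b}"])
         (use eq in \<open>auto simp: a_def b_def\<close>)
  qed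
  moreover have "F 0 = 0" by (simp add: F_def)
  ultimately show thesis
    using that smooth_real_antiderivative[OF f] by blast
qed

section \<open>Iterated partial derivatives and integration by parts\<close>

definition smooth_plane :: "(real^2 \<Rightarrow> real) \<Rightarrow> bool" where
  "smooth_plane u \<longleftrightarrow> (\<forall>i x. iter_partial i u differentiable (at x))"

lemma iter_partial_append: "iter_partial (i @ j) u = iter_partial i (iter_partial j u)"
  by (induction i) auto

lemma smooth_plane_iter: "smooth_plane u \<Longrightarrow> smooth_plane (iter_partial j u)"
  unfolding smooth_plane_def iter_partial_append[symmetric] by blast

lemma smooth_plane_continuous: "smooth_plane u \<Longrightarrow> continuous_on S (iter_partial j u)"
  unfolding smooth_plane_def
  by (meson continuous_at_imp_continuous_on differentiable_imp_continuous_within)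

lemma smooth_plane_continuous': "smooth_plane u \<Longrightarrow> continuous_on S u"
  using smooth_plane_continuous[of u S "[]"] by simp

lemma test_functions_iff:
  "\<phi> \<in> test_functions U \<longleftrightarrow> smooth_plane \<phi> \<and>
     compact (closure {x. \<phi> x \<noteq> 0}) \<and> closure {x. \<phi> x \<noteq> 0} \<subseteq> U"
  by (auto simp: test_functions_def smooth_plane_def)

lemma iter_partial_zero_outside:
  assumes "closed C" "\<And>x. x \<notin> C \<Longrightarrow> u x = 0" "x \<notin> C"
  shows "iter_partial i u x = 0"
  using assms(3)
proof (induction i arbitrary: x)
  case (Cons a i)
  have "(iter_partial i u has_derivative (\<lambda>_. 0)) (at x)"
    by (rule has_derivative_transform_within_open[where f = "\<lambda>_. 0" and s = "- C"])
       (use Cons assms in auto)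
  then show ?case
    using frechet_derivative_at by (fastforce simp: fun_eq_iff)
qed (use assms in auto)

lemma test_functionsI:
  assumes "smooth_plane \<phi>" "compact C" "C \<subseteq> U" "\<And>x. x \<notin> C \<Longrightarrow> \<phi> x = 0"
  shows "\<phi> \<in> test_functions U"
proof -
  have sub: "closure {x. \<phi> x \<noteq> 0} \<subseteq> C"
    by (rule closure_minimal) (use assms compact_imp_closed in auto)
  then have "compact (closure {x. \<phi> x \<noteq> 0})"
    using \<open>compact C\<close> closed_closure bounded_subset[of C] by (simp add: compact_eq_bounded_closed)
  with assms sub show ?thesis
    by (auto simp: test_functions_iff)
qed

lemma test_functionsE:
  assumes "\<phi> \<in> test_functions U"
  obtains C where "smooth_plane \<phi>" "compact C" "C \<subseteq> U" "\<And>x. x \<notin> C \<Longrightarrow> \<phi> x = 0"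
proof (rule that[of "closure {x. \<phi> x \<noteq> 0}"])
  show "\<phi> x = 0" if "x \<notin> closure {x. \<phi> x \<noteq> 0}" for x
    using that closure_subset[of "{x. \<phi> x \<noteq> 0}"] by blast
qed (use assms in \<open>simp_all add: test_functions_iff\<close>)

lemma test_functions_iter_partial:
  assumes "\<phi> \<in> test_functions U"
  shows "iter_partial i \<phi> \<in> test_functions U"
proof -
  obtain C where C: "smooth_plane \<phi>" "compact C" "C \<subseteq> U" "\<And>x. x \<notin> C \<Longrightarrow> \<phi> x = 0"
    using assms by (rule test_functionsE) blast
  then show ?thesis
    by (intro test_functionsI[of _ C] smooth_plane_iter iter_partial_zero_outside compact_imp_closed) auto
qed

text \<open>Both the polynomial data of the boundary value problem and the test functions built below have
  separated variables.  Their derivatives are explicit and depend only on how often each variable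
  occurs in the multi-index.\<close>

definition separated :: "(real \<Rightarrow> real) \<Rightarrow> (real \<Rightarrow> real) \<Rightarrow> real^2 \<Rightarrow> real" where
  "separated f g x = f (x $ 1) * g (x $ 2)"

lemma separated_has_derivative:
  assumes "(f has_real_derivative f') (at (x $ 1))" "(g has_real_derivative g') (at (x $ 2))"
  shows "(separated f g has_derivative (\<lambda>h. f' * h $ 1 * g (x $ 2) + f (x $ 1) * (g' * h $ 2))) (at x)"
proof -
  have "((\<lambda>x. f (x $ 1)) has_derivative (\<lambda>h. f' * h $ 1)) (at x)"
    using has_derivative_compose[OF bounded_linear_imp_has_derivative[OF bounded_linear_vec_nth] assms(1)[unfolded has_field_derivative_def]] .
  moreover have "((\<lambda>x. g (x $ 2)) has_derivative (\<lambda>h. g' * h $ 2)) (at x)"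
    using has_derivative_compose[OF bounded_linear_imp_has_derivative[OF bounded_linear_vec_nth] assms(2)[unfolded has_field_derivative_def]] .
  ultimately have "((\<lambda>x. f (x $ 1) * g (x $ 2)) has_derivative
      (\<lambda>h. f (x $ 1) * (g' * h $ 2) + f' * h $ 1 * g (x $ 2))) (at x)"
    by (rule has_derivative_mult)
  then show ?thesis
    by (simp add: separated_def[abs_def] add.commute)
qed

lemma iter_partial_separated:
  assumes "smooth_real f" "smooth_real g"
  shows "iter_partial i (separated f g) =
     separated ((deriv ^^ count_list i 1) f) ((deriv ^^ count_list i 2) g)"
proof (induction i)
  case (Cons a i)
  have "frechet_derivative (separated ((deriv ^^ count_list i 1) f) ((deriv ^^ count_list i 2) g)) (at x) (axis a 1)
     = separated ((deriv ^^ count_list (a # i) 1) f) ((deriv ^^ count_list (a # i) 2) g) x" for x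
    by (subst frechet_derivative_at[OF separated_has_derivative, symmetric, OF
          smooth_real_has_derivative[OF assms(1)] smooth_real_has_derivative[OF assms(2)]])
       (use exhaust_2[of a] in \<open>auto simp: separated_def axis_def\<close>)
  then show ?case
    using Cons.IH by auto
qed simp

lemma smooth_plane_separated:
  assumes "smooth_real f" "smooth_real g"
  shows "smooth_plane (separated f g)"
  unfolding smooth_plane_def iter_partial_separated[OF assms] differentiable_def
  using separated_has_derivative[OF smooth_real_has_derivative[OF assms(1)] smooth_real_has_derivative[OF assms(2)]]
  by blast

lemma compact_rectangle: "compact {x :: real^2. x $ 1 \<in> {a..b} \<and> x $ 2 \<in> {c..d}}"
proof -
  have "{x :: real^2. x $ 1 \<in> {a..b} \<and> x $ 2 \<in> {c..d}} = cbox (vector [a, c]) (vector [b, d])"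
    by (auto simp: mem_box_cart forall_2)
  then show ?thesis
    by simp
qed

lemma separated_test_function:
  assumes "smooth_real f" "smooth_real g"
    and "\<And>t. t \<notin> {a..b} \<Longrightarrow> f t = 0" "\<And>t. t \<notin> {c..d} \<Longrightarrow> g t = 0"
    and "{x. x $ 1 \<in> {a..b} \<and> x $ 2 \<in> {c..d}} \<subseteq> U"
  shows "separated f g \<in> test_functions U"
  using assms
  by (intro test_functionsI[OF smooth_plane_separated compact_rectangle]) (auto simp: separated_def)

lemma integrable_continuous_compact_support:
  fixes f :: "'a::euclidean_space \<Rightarrow> real"
  assumes "continuous_on UNIV f" "compact C" "\<And>x. x \<notin> C \<Longrightarrow> f x = 0"
  shows "integrable lborel f"
proof -
  have "integrable lborel (\<lambda>x. indicator C x *\<^sub>R f x)"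
    by (rule borel_integrable_compact) (use assms(2) continuous_on_subset[OF assms(1)] in auto)
  moreover have "(\<lambda>x. indicator C x *\<^sub>R f x) = f"
    using assms by (auto simp: indicator_def fun_eq_iff)
  ultimately show ?thesis
    by simp
qed

text \<open>The difference quotients of a compactly supported function have integral \<open>0\<close> by translation
  invariance.  They converge to the derivative and, by the mean value theorem, are dominated by a
  multiple of the indicator of a ball.\<close>

lemma integral_partial_eq_0:
  fixes F :: "real^2 \<Rightarrow> real"
  assumes F: "\<And>x. F differentiable (at x)" and "compact C" "\<And>x. x \<notin> C \<Longrightarrow> F x = 0"
    and cont: "continuous_on UNIV (\<lambda>x. frechet_derivative F (at x) v)"
  shows "integral\<^sup>L lborel (\<lambda>x. frechet_derivative F (at x) v) = 0"
proof -
  define D where "D x = frechet_derivative F (at x) v" for x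
  define h where "h n = inverse (real (Suc n))" for n
  have h: "0 < h n" "h n \<le> 1" for n
    by (auto simp: h_def field_simps)
  have contF: "continuous_on UNIV F"
    by (meson F continuous_at_imp_continuous_on differentiable_imp_continuous_within)
  have intF: "integrable lborel F"
    by (rule integrable_continuous_compact_support[OF contF assms(2,3)])
  have ray: "((\<lambda>t. F (x + t *\<^sub>R v)) has_real_derivative D (x + t *\<^sub>R v)) (at t)" for x t
  proof -
    have lin: "((\<lambda>t. x + t *\<^sub>R v) has_derivative (\<lambda>s. s *\<^sub>R v)) (at t)"
      by (auto intro!: derivative_eq_intros)
    have "(F has_derivative frechet_derivative F (at (x + t *\<^sub>R v))) (at (x + t *\<^sub>R v))"
      using F frechet_derivative_works by blast
    from has_derivative_compose[OF lin this]
    have "((\<lambda>t. F (x + t *\<^sub>R v)) has_derivative (\<lambda>s. frechet_derivative F (at (x + t *\<^sub>R v)) (s *\<^sub>R v))) (at t)" .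
    moreover have "(\<lambda>s. frechet_derivative F (at (x + t *\<^sub>R v)) (s *\<^sub>R v)) = (\<lambda>s. D (x + t *\<^sub>R v) * s)"
      using linear_frechet_derivative[OF F] by (simp add: D_def linear_cmul mult.commute fun_eq_iff)
    ultimately show ?thesis
      by (simp add: has_field_derivative_def)
  qed
  obtain R where "\<forall>x\<in>C. norm x \<le> R" and R0: "R > 0"
    using compact_imp_bounded[OF \<open>compact C\<close>] by (auto simp: bounded_pos)
  then have R: "C \<subseteq> cball 0 R"
    by auto
  have D0: "D x = 0" if "x \<notin> C" for x
  proof -
    have "(F has_derivative (\<lambda>_. 0)) (at x)"
      by (rule has_derivative_transform_within_open[where f = "\<lambda>_. 0" and s = "- C"])
         (use that assms compact_imp_closed in auto)
    then show ?thesis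
      using frechet_derivative_at by (fastforce simp: fun_eq_iff D_def)
  qed
  have "bounded (D ` C)"
    by (rule compact_imp_bounded, rule compact_continuous_image)
       (use continuous_on_subset[OF cont] \<open>compact C\<close> in \<open>auto simp: D_def[abs_def]\<close>)
  then obtain B where B: "B > 0" "\<And>x. x \<in> C \<Longrightarrow> \<bar>D x\<bar> \<le> B"
    by (auto simp: bounded_pos)
  then have B': "\<bar>D x\<bar> \<le> B" for x
    using D0[of x] by (cases "x \<in> C") auto
  define Q where "Q n x = (F (x + h n *\<^sub>R v) - F x) / h n" for n x
  have Q_int: "integral\<^sup>L lborel (Q n) = 0" for n
  proof -
    have d: "lborel = distr lborel borel ((+) (h n *\<^sub>R v))"
      by (simp add: lborel_distr_plus)
    have "integral\<^sup>L lborel F = integral\<^sup>L lborel (\<lambda>x. F (h n *\<^sub>R v + x))"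
      by (subst d, subst integral_distr) (use intF in auto)
    moreover have "integrable lborel (\<lambda>x. F (h n *\<^sub>R v + x))"
      using intF by (subst (asm) d, subst (asm) integrable_distr_eq) auto
    ultimately show ?thesis
      using intF by (simp add: Q_def[abs_def] add.commute)
  qed
  have bound: "\<bar>Q n x\<bar> \<le> B * indicator (cball 0 (R + norm v)) x" for n x
  proof -
    have "\<exists>t>0. t < h n \<and> F (x + h n *\<^sub>R v) - F (x + 0 *\<^sub>R v) = (h n - 0) * D (x + t *\<^sub>R v)"
      using h(1) by (intro MVT2 ray) auto
    then obtain t where t: "0 < t" "t < h n" "Q n x = D (x + t *\<^sub>R v)"
      using h(1)[of n] by (auto simp: Q_def)
    show ?thesis
    proof (cases "x \<in> cball 0 (R + norm v)")
      case False
      have "norm (t *\<^sub>R v) \<le> norm v"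
        using t h(2)[of n] by (auto intro: mult_left_le_one_le)
      then have "norm (x + t *\<^sub>R v) > R"
        using False norm_triangle_ineq4[of "x + t *\<^sub>R v" "t *\<^sub>R v"] by simp
      then have "x + t *\<^sub>R v \<notin> C"
        using R by auto
      then show ?thesis
        using D0 t False by simp
    qed (use t B' in simp)
  qed
  have "(\<lambda>n. integral\<^sup>L lborel (Q n)) \<longlonglongrightarrow> integral\<^sup>L lborel D"
  proof (rule integral_dominated_convergence)
    show "D \<in> borel_measurable lborel"
      using cont by (simp add: D_def[abs_def] borel_measurable_continuous_onI)
    show "Q n \<in> borel_measurable lborel" for n
      unfolding Q_def using contF
      by (auto intro!: borel_measurable_continuous_onI continuous_intros continuous_on_compose2[OF contF]
           simp: h(1)[THEN less_imp_neq, THEN not_sym])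
    have "integrable lborel (indicat_real (cball (0::real^2) (R + norm v)))"
      using emeasure_bounded_finite[of "cball (0::real^2) (R + norm v)"] by (intro integrable_real_indicator) auto
    then show "integrable lborel (\<lambda>x::real^2. B * indicator (cball 0 (R + norm v)) x)"
      by simp
    have "(\<lambda>n. Q n x) \<longlonglongrightarrow> D x" for x
    proof -
      have "((\<lambda>t. (F (x + (0 + t) *\<^sub>R v) - F (x + 0 *\<^sub>R v)) / t) \<longlongrightarrow> D (x + 0 *\<^sub>R v)) (at 0)"
        using ray[of x 0] unfolding DERIV_def .
      moreover have "filterlim h (at 0) sequentially"
        using h(1) LIMSEQ_inverse_real_of_nat unfolding h_def filterlim_at
        by (auto simp: intro!: always_eventually)
      ultimately show ?thesis
        unfolding Q_def by (auto dest: filterlim_compose)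
    qed
    then show "AE x in lborel. (\<lambda>n. Q n x) \<longlonglongrightarrow> D x"
      by simp
    show "AE x in lborel. norm (Q n x) \<le> B * indicator (cball 0 (R + norm v)) x" for n
      using bound by simp
  qed
  then have "integral\<^sup>L lborel D = 0"
    by (simp add: Q_int LIMSEQ_const_iff)
  then show ?thesis
    by (simp add: D_def[abs_def])
qed

lemma integral_by_parts:
  assumes u: "smooth_plane u" and \<phi>: "\<phi> \<in> test_functions UNIV"
  shows "integral\<^sup>L lborel (\<lambda>x. u x * iter_partial [a] \<phi> x) = - integral\<^sup>L lborel (\<lambda>x. iter_partial [a] u x * \<phi> x)"
proof -
  obtain C where C: "smooth_plane \<phi>" "compact C" "\<And>x. x \<notin> C \<Longrightarrow> \<phi> x = 0"
    using \<phi> by (rule test_functionsE) blast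
  have C': "iter_partial [a] \<phi> x = 0" if "x \<notin> C" for x
    by (rule iter_partial_zero_outside[OF compact_imp_closed[OF C(2)] C(3) that])
  have du: "(u has_derivative frechet_derivative u (at x)) (at x)"
    and dp: "(\<phi> has_derivative frechet_derivative \<phi> (at x)) (at x)" for x
    using u[unfolded smooth_plane_def, THEN spec, of "[]"] C(1)[unfolded smooth_plane_def, THEN spec, of "[]"]
    by (simp_all add: frechet_derivative_works[symmetric])
  have der: "((\<lambda>x. u x * \<phi> x) has_derivative
       (\<lambda>h. u x * frechet_derivative \<phi> (at x) h + frechet_derivative u (at x) h * \<phi> x)) (at x)" for x
    by (rule has_derivative_mult[OF du dp])
  have eq: "frechet_derivative (\<lambda>x. u x * \<phi> x) (at x) (axis a 1) =
        u x * iter_partial [a] \<phi> x + iter_partial [a] u x * \<phi> x" for x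
    by (subst frechet_derivative_at[OF der, symmetric]) simp
  note cont = smooth_plane_continuous[OF u] smooth_plane_continuous[OF C(1)]
    smooth_plane_continuous'[OF u] smooth_plane_continuous'[OF C(1)]
  have "integral\<^sup>L lborel (\<lambda>x. frechet_derivative (\<lambda>x. u x * \<phi> x) (at x) (axis a 1)) = 0"
  proof (rule integral_partial_eq_0[OF _ C(2)])
    show "(\<lambda>x. u x * \<phi> x) differentiable (at x)" for x
      using der differentiable_def by blast
    show "continuous_on UNIV (\<lambda>x. frechet_derivative (\<lambda>x. u x * \<phi> x) (at x) (axis a 1))"
      unfolding eq by (intro continuous_intros cont)
  qed (use C in auto)
  moreover have "integrable lborel (\<lambda>x. u x * iter_partial [a] \<phi> x)"
    by (rule integrable_continuous_compact_support[OF _ C(2)]) (intro continuous_intros cont, use C' in simp)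
  moreover have "integrable lborel (\<lambda>x. iter_partial [a] u x * \<phi> x)"
    by (rule integrable_continuous_compact_support[OF _ C(2)]) (intro continuous_intros cont, use C in simp)
  ultimately show ?thesis
    unfolding eq by simp
qed

text \<open>Derivatives are moved from one factor to the other one at a time, the outermost first, which
  reverses their order.\<close>

lemma integral_by_parts_iter:
  assumes "smooth_plane u" and \<phi>: "\<phi> \<in> test_functions UNIV"
  shows "integral\<^sup>L lborel (\<lambda>x. u x * iter_partial i \<phi> x) =
     (-1) ^ length i * integral\<^sup>L lborel (\<lambda>x. iter_partial (rev i) u x * \<phi> x)"
  using assms(1)
proof (induction i arbitrary: u)
  case (Cons a i)
  have "integral\<^sup>L lborel (\<lambda>x. u x * iter_partial [a] (iter_partial i \<phi>) x) =
      - integral\<^sup>L lborel (\<lambda>x. iter_partial [a] u x * iter_partial i \<phi> x)"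
    by (rule integral_by_parts[OF Cons.prems test_functions_iter_partial[OF \<phi>]])
  also have "\<dots> = - ((-1) ^ length i * integral\<^sup>L lborel (\<lambda>x. iter_partial (rev i) (iter_partial [a] u) x * \<phi> x))"
    by (subst Cons.IH[OF smooth_plane_iter[OF Cons.prems]]) simp
  also have "\<dots> = (-1) ^ length (a # i) * integral\<^sup>L lborel (\<lambda>x. iter_partial (rev (a # i)) u x * \<phi> x)"
    by (simp only: rev.simps iter_partial_append length_Cons power_Suc)
  finally show ?case by simp
qed simp

lemma integral_lebesgue_on_support:
  fixes f :: "real^2 \<Rightarrow> real"
  assumes "U \<in> sets lebesgue" "\<And>x. x \<notin> U \<Longrightarrow> f x = 0" "f \<in> borel_measurable borel"
  shows "integral\<^sup>L (lebesgue_on U) f = integral\<^sup>L lborel f"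
proof -
  have "integral\<^sup>L (lebesgue_on U) f = integral\<^sup>L lebesgue (\<lambda>x. if x \<in> U then f x else 0)"
    by (rule Lebesgue_Measure.integral_restrict_UNIV[symmetric, OF assms(1)])
  also have "(\<lambda>x. if x \<in> U then f x else 0) = f"
    using assms(2) by auto
  finally show ?thesis
    using assms(3) by (simp add: integral_completion)
qed

lemma locally_integrable_continuous:
  assumes "continuous_on UNIV u"
  shows "locally_integrable U u"
  unfolding locally_integrable_def
proof (intro allI impI)
  fix C assume "compact C \<and> C \<subseteq> U"
  then have C: "compact C" by blast
  have "integrable lborel (\<lambda>x. indicator C x *\<^sub>R u x)"
    by (rule borel_integrable_compact) (use C continuous_on_subset[OF assms] in auto)
  then have "integrable lebesgue (\<lambda>x. indicator C x *\<^sub>R u x)"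
    by (subst integrable_completion) (auto dest: borel_measurable_integrable)
  then show "integrable (lebesgue_on C) u"
    using C by (subst integrable_restrict_space) (auto simp: compact_imp_closed borel_closed)
qed

lemma smooth_has_weak_partial:
  assumes "open U" "smooth_plane u"
  shows "has_weak_partial U i u (iter_partial (rev i) u)"
  unfolding has_weak_partial_def
proof (intro conjI ballI)
  note cont = smooth_plane_continuous[OF assms(2)] smooth_plane_continuous'[OF assms(2)]
  show "locally_integrable U u" "locally_integrable U (iter_partial (rev i) u)"
    using cont by (auto intro: locally_integrable_continuous)
  fix \<phi> assume \<phi>: "\<phi> \<in> test_functions U"
  from \<phi> obtain C where C: "smooth_plane \<phi>" "compact C" "C \<subseteq> U" "\<And>x. x \<notin> C \<Longrightarrow> \<phi> x = 0"
    using test_functionsE by blast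
  have C': "iter_partial i \<phi> x = 0" if "x \<notin> C" for x
    by (rule iter_partial_zero_outside[OF compact_imp_closed[OF C(2)] C(4) that])
  have \<phi>': "\<phi> \<in> test_functions UNIV"
    using \<phi> by (simp add: test_functions_iff)
  note contp = smooth_plane_continuous[OF C(1)] smooth_plane_continuous'[OF C(1)]
  have "integral\<^sup>L (lebesgue_on U) (\<lambda>x. u x * iter_partial i \<phi> x) = integral\<^sup>L lborel (\<lambda>x. u x * iter_partial i \<phi> x)"
    by (rule integral_lebesgue_on_support)
       (use assms C C' in \<open>auto intro!: borel_measurable_continuous_onI continuous_intros cont contp\<close>)
  moreover have "integral\<^sup>L (lebesgue_on U) (\<lambda>x. iter_partial (rev i) u x * \<phi> x) = integral\<^sup>L lborel (\<lambda>x. iter_partial (rev i) u x * \<phi> x)"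
    by (rule integral_lebesgue_on_support)
       (use assms C in \<open>auto intro!: borel_measurable_continuous_onI continuous_intros cont contp\<close>)
  ultimately show "integral\<^sup>L (lebesgue_on U) (\<lambda>x. u x * iter_partial i \<phi> x) =
      (-1) ^ length i * integral\<^sup>L (lebesgue_on U) (\<lambda>x. iter_partial (rev i) u x * \<phi> x)"
    using integral_by_parts_iter[OF assms(2) \<phi>'] by simp
qed

section \<open>Uniqueness of weak derivatives\<close>

lemma lebesgue_integrable_indicator:
  fixes f :: "'a::euclidean_space \<Rightarrow> real"
  assumes "S \<in> sets lebesgue"
  shows "integrable lebesgue (\<lambda>x. indicator S x * f x) \<longleftrightarrow> integrable (lebesgue_on S) f"
    and "integral\<^sup>L lebesgue (\<lambda>x. indicator S x * f x) = integral\<^sup>L (lebesgue_on S) f"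
  using assms by (simp_all add: integrable_restrict_space integral_restrict_space)

text \<open>Smooth steps on the scale \<open>1 / n\<close> exhaust an interval from inside.\<close>

definition interval_bump :: "real \<Rightarrow> real \<Rightarrow> nat \<Rightarrow> real \<Rightarrow> real" where
  "interval_bump a b n t = smooth_step (real n * t + - real n * a) * smooth_step (- real n * t + real n * b)"

lemma interval_bump_smooth: "smooth_real (interval_bump a b n)"
  unfolding interval_bump_def
  by (intro smooth_real_mult smooth_real_affine smooth_step_smooth)

lemma interval_bump_bounds: "0 \<le> interval_bump a b n t" "interval_bump a b n t \<le> 1"
  unfolding interval_bump_def using smooth_step_bounds by (auto intro: mult_le_one)

lemma interval_bump_0:
  assumes "t \<notin> {a<..<b}"
  shows "interval_bump a b n t = 0"
proof -
  have "real n * t + - real n * a = real n * (t - a)" "- real n * t + real n * b = real n * (b - t)"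
    by (simp_all add: algebra_simps)
  moreover have "real n * (t - a) \<le> 0 \<or> real n * (b - t) \<le> 0"
    using assms by (auto simp: mult_le_0_iff)
  ultimately show ?thesis
    unfolding interval_bump_def using smooth_step_0 by (metis mult_zero_left mult_zero_right)
qed

lemma smooth_step_tendsto_1:
  assumes "s > 0"
  shows "(\<lambda>n. smooth_step (real n * s)) \<longlonglongrightarrow> 1"
proof (rule tendsto_eventually)
  obtain N :: nat where N: "real N > 1 / s"
    using reals_Archimedean2 by blast
  show "\<forall>\<^sub>F n in sequentially. smooth_step (real n * s) = 1"
    using eventually_ge_at_top[of N]
  proof eventually_elim
    case (elim n)
    then have "real n > 1 / s" using N by linarith
    then show ?case using assms by (intro smooth_step_1) (simp add: field_simps)
  qed
qed

lemma interval_bump_tendsto: "(\<lambda>n. interval_bump a b n t) \<longlonglongrightarrow> indicator {a<..<b} t"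
proof (cases "t \<in> {a<..<b}")
  case True
  have "(\<lambda>n. smooth_step (real n * (t - a)) * smooth_step (real n * (b - t))) \<longlonglongrightarrow> 1 * 1"
    using True by (intro tendsto_mult smooth_step_tendsto_1) auto
  then show ?thesis
    using True by (simp add: interval_bump_def algebra_simps)
next
  case False
  then show ?thesis
    using interval_bump_0[OF False] by simp
qed

text \<open>Products of \<open>interval_bump\<close> in the two variables are test functions that converge boundedly to the
  indicator of the box.\<close>

lemma integral_box_eq_0:
  fixes a b :: "real^2"
  assumes "open U" "locally_integrable U v"
    and zero: "\<And>\<phi>. \<phi> \<in> test_functions U \<Longrightarrow> integral\<^sup>L (lebesgue_on U) (\<lambda>x. v x * \<phi> x) = 0"
    and sub: "cbox a b \<subseteq> U"
  shows "integral\<^sup>L lebesgue (\<lambda>x. indicator (box a b) x * v x) = 0"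
proof -
  define \<phi> where "\<phi> n = separated (interval_bump (a $ 1) (b $ 1) n) (interval_bump (a $ 2) (b $ 2) n)" for n
  have rect: "cbox a b = {x. x $ 1 \<in> {a $ 1..b $ 1} \<and> x $ 2 \<in> {a $ 2..b $ 2}}"
    by (auto simp: mem_box_cart forall_2)
  have test: "\<phi> n \<in> test_functions U" for n
    unfolding \<phi>_def
    by (rule separated_test_function[OF interval_bump_smooth interval_bump_smooth, of "a $ 1" "b $ 1" _ _ _ "a $ 2" "b $ 2"])
       (use sub rect in \<open>auto intro: interval_bump_0\<close>)
  have out: "\<phi> n x = 0" if "x \<notin> cbox a b" for n x
    using that interval_bump_0[of "x $ 1"] interval_bump_0[of "x $ 2"] by (auto simp: rect \<phi>_def separated_def)
  have meas: "\<phi> n \<in> borel_measurable lebesgue" for n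
    using test[of n] smooth_plane_continuous'[of "\<phi> n" UNIV]
    by (intro measurable_completion) (simp add: test_functions_iff borel_measurable_continuous_onI)
  have int: "integrable lebesgue (\<lambda>x. indicator (cbox a b) x * v x)"
    using assms(2) sub unfolding locally_integrable_def
    by (subst lebesgue_integrable_indicator) auto
  have "integral\<^sup>L lebesgue (\<lambda>x. indicator (cbox a b) x * v x * \<phi> n x) = 0" for n
  proof -
    have "integral\<^sup>L lebesgue (\<lambda>x. indicator U x * (v x * \<phi> n x)) = 0"
      using zero[OF test] assms(1) by (subst lebesgue_integrable_indicator) auto
    also have "(\<lambda>x. indicator U x * (v x * \<phi> n x)) = (\<lambda>x. indicator (cbox a b) x * v x * \<phi> n x)"
      using out sub by (auto simp: indicator_def fun_eq_iff)
    finally show ?thesis .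
  qed
  moreover have "(\<lambda>n. integral\<^sup>L lebesgue (\<lambda>x. indicator (cbox a b) x * v x * \<phi> n x))
       \<longlonglongrightarrow> integral\<^sup>L lebesgue (\<lambda>x. indicator (box a b) x * v x)"
  proof (rule integral_dominated_convergence)
    have eq: "(\<lambda>x. indicator (box a b) x * v x) = (\<lambda>x. indicator (box a b) x * (indicator (cbox a b) x * v x))"
      using box_subset_cbox[of a b] by (auto simp: indicator_def fun_eq_iff)
    show "(\<lambda>x. indicator (box a b) x * v x) \<in> borel_measurable lebesgue"
      unfolding eq by (rule borel_measurable_times[OF borel_measurable_indicator borel_measurable_integrable[OF int]]) simp
    show "(\<lambda>x. indicator (cbox a b) x * v x * \<phi> n x) \<in> borel_measurable lebesgue" for n
      using borel_measurable_integrable[OF int] meas by (rule borel_measurable_times)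
    show "integrable lebesgue (\<lambda>x. \<bar>indicator (cbox a b) x * v x\<bar>)"
      using int by simp
    have "(\<lambda>n. indicator (cbox a b) x * v x * \<phi> n x) \<longlonglongrightarrow> indicator (box a b) x * v x" for x
    proof -
      have "(\<lambda>n. indicator (cbox a b) x * v x * \<phi> n x) \<longlonglongrightarrow>
          indicator (cbox a b) x * v x * (indicator {a $ 1<..<b $ 1} (x $ 1) * indicator {a $ 2<..<b $ 2} (x $ 2))"
        unfolding \<phi>_def separated_def by (intro tendsto_intros interval_bump_tendsto)
      also have "indicator (cbox a b) x * v x * (indicator {a $ 1<..<b $ 1} (x $ 1) * indicator {a $ 2<..<b $ 2} (x $ 2))
          = indicator (box a b) x * v x"
        by (auto simp: indicator_def mem_box_cart forall_2)
      finally show ?thesis .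
    qed
    then show "AE x in lebesgue. (\<lambda>n. indicator (cbox a b) x * v x * \<phi> n x) \<longlonglongrightarrow> indicator (box a b) x * v x"
      by simp
    have "\<bar>\<phi> n x\<bar> \<le> 1" for n x
      using interval_bump_bounds by (auto simp: \<phi>_def separated_def abs_mult intro!: mult_le_one)
    then show "AE x in lebesgue. norm (indicator (cbox a b) x * v x * \<phi> n x) \<le> \<bar>indicator (cbox a b) x * v x\<bar>" for n
      by (intro AE_I2) (auto simp: abs_mult intro!: mult_left_le)
  qed
  ultimately show ?thesis
    by (simp add: LIMSEQ_const_iff)
qed

text \<open>The sets over which the integral of \<open>h\<close> vanishes form a Dynkin system, and the open boxes
  are an intersection-stable generator of the Borel sets.\<close>

lemma AE_zero_if_box_integrals_zero:
  fixes h :: "'a::euclidean_space \<Rightarrow> real"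
  assumes int: "integrable lebesgue h"
    and box: "\<And>a b. integral\<^sup>L lebesgue (\<lambda>x. indicator (box a b) x * h x) = 0"
    and total: "integral\<^sup>L lebesgue h = 0"
  shows "AE x in lebesgue. h x = 0"
proof -
  obtain g where g: "g \<in> borel_measurable lborel" "AE x in lborel. h x = g x"
    using completion_ex_borel_measurable_real[OF borel_measurable_integrable[OF int]] by blast
  have gl: "g \<in> borel_measurable lebesgue"
    using g(1) by (rule measurable_completion)
  have ae: "AE x in lebesgue. h x = g x"
    using g(2) by (rule AE_completion)
  have gint: "integrable lborel g"
    using integrable_cong_AE[OF borel_measurable_integrable[OF int] gl ae] int g(1)
    by (simp add: integrable_completion)
  have eq: "integral\<^sup>L lborel (\<lambda>x. indicator A x * g x) = integral\<^sup>L lebesgue (\<lambda>x. indicator A x * h x)"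
    if "A \<in> sets borel" for A
  proof -
    have "integral\<^sup>L lborel (\<lambda>x. indicator A x * g x) = integral\<^sup>L lebesgue (\<lambda>x. indicator A x * g x)"
      using that g(1) by (intro integral_completion[symmetric]) simp
    also have "\<dots> = integral\<^sup>L lebesgue (\<lambda>x. indicator A x * h x)"
      using that gl borel_measurable_integrable[OF int] ae
      by (intro integral_cong_AE borel_measurable_times borel_measurable_indicator) auto
    finally show ?thesis .
  qed
  have gA: "integrable lborel (\<lambda>x. indicator A x * g x)" if "A \<in> sets borel" for A
    using integrable_mult_indicator[OF _ gint, of A] that by simp
  have all: "integral\<^sup>L lborel (\<lambda>x. indicator A x * g x) = 0" if A: "A \<in> sets borel" for A
  proof -
    have "Int_stable (range (\<lambda>(a, b). box a b :: 'a set))"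
      by (auto simp: Int_stable_def box_Int_box)
    moreover have "range (\<lambda>(a, b). box a b :: 'a set) \<subseteq> Pow UNIV"
      by auto
    moreover have "A \<in> sigma_sets UNIV (range (\<lambda>(a, b). box a b))"
      using A unfolding borel_eq_box by simp
    ultimately show ?thesis
    proof (induction rule: sigma_sets_induct_disjoint)
      case (basic A)
      then show ?case
        using eq box by auto
    next
      case (compl A)
      then have A: "A \<in> sets borel"
        by (simp add: borel_eq_box)
      have "(\<lambda>x. indicator (UNIV - A) x * g x) = (\<lambda>x. g x - indicator A x * g x)"
        by (auto simp: indicator_def fun_eq_iff)
      moreover have "integral\<^sup>L lborel g = 0"
        using eq[of UNIV] total by simp
      ultimately show ?case
        using gint gA[OF A] compl by simp
    next
      case (union F)
      then have F: "F i \<in> sets borel" for i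
        by (simp add: borel_eq_box subset_eq)
      have "set_lebesgue_integral lborel (\<Union>i. F i) g = (\<Sum>i. set_lebesgue_integral lborel (F i) g)"
        using union.hyps F gA[of "\<Union>i. F i"]
        by (intro lebesgue_integral_countable_add) (auto simp: disjoint_family_on_def set_integrable_def)
      then show ?case
        using union by (simp add: set_lebesgue_integral_def)
    qed simp
  qed
  have "AE x in lborel. g x = 0"
    using all by (intro sigma_finite_measure.density_zero[OF sigma_finite_lborel] gint) (simp add: set_lebesgue_integral_def)
  then have "AE x in lebesgue. g x = 0"
    by (rule AE_completion)
  with ae show ?thesis
    by eventually_elim simp
qed

text \<open>The fundamental lemma of the calculus of variations (du Bois-Reymond).  It is what makes
  \<open>weak_partial\<close>, which is defined by choice, computable: any function that satisfies the defining
  identity agrees with it almost everywhere.\<close>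

lemma fundamental_lemma:
  assumes "open U" "locally_integrable U v"
    and zero: "\<And>\<phi>. \<phi> \<in> test_functions U \<Longrightarrow> integral\<^sup>L (lebesgue_on U) (\<lambda>x. v x * \<phi> x) = 0"
  shows "AE x in lebesgue_on U. v x = 0"
proof -
  obtain \<D> :: "(real^2) set set" where \<D>: "countable \<D>" "\<D> \<subseteq> Pow U" "\<And>X. X \<in> \<D> \<Longrightarrow> \<exists>a b. X = cbox a b" "\<Union>\<D> = U"
    using open_countable_Union_open_cbox[OF \<open>open U\<close>] by metis
  have "AE x in lebesgue. x \<in> X \<longrightarrow> v x = 0" if X: "X \<in> \<D>" for X
  proof -
    obtain p q where pq: "X = cbox p q" "cbox p q \<subseteq> U"
      using \<D> X by (metis PowD subsetD)
    define h where "h x = indicator (box p q) x * v x" for x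
    have hb: "(\<lambda>x. indicator (box a b) x * h x) = (\<lambda>x. indicator (box a b \<inter> box p q) x * v x)" for a b
      by (auto simp: h_def indicator_def fun_eq_iff)
    have i: "integrable lebesgue (\<lambda>x. indicator (cbox p q) x * v x)"
      using assms(2) pq unfolding locally_integrable_def
      by (subst lebesgue_integrable_indicator) auto
    have "h = (\<lambda>x. indicator (box p q) x *\<^sub>R (indicator (cbox p q) x * v x))"
      using box_subset_cbox by (auto simp: h_def indicator_def fun_eq_iff)
    then have "integrable lebesgue h"
      using integrable_mult_indicator[OF _ i, of "box p q"] by simp
    moreover have "integral\<^sup>L lebesgue (\<lambda>x. indicator (box a b) x * h x) = 0" for a b
    proof -
      obtain c d where cd: "box a b \<inter> box p q = box c d"
        unfolding box_Int_box by blast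
      show ?thesis
      proof (cases "box c d = {}")
        case False
        then have "cbox c d \<subseteq> cbox p q"
          unfolding closure_box[OF False, symmetric] using cd box_subset_cbox[of p q]
          by (intro closure_minimal closed_cbox) blast
        then show ?thesis
          unfolding hb cd using integral_box_eq_0[OF assms] pq by simp
      qed (unfold hb cd, simp)
    qed
    moreover have "integral\<^sup>L lebesgue h = 0"
      unfolding h_def using integral_box_eq_0[OF assms pq(2)] by simp
    ultimately have "AE x in lebesgue. h x = 0"
      by (rule AE_zero_if_box_integrals_zero)
    moreover have "AE x in lebesgue. x \<notin> cbox p q - box p q"
      using negligible_frontier_interval[of p q] by (intro AE_not_in) (simp add: negligible_iff_null_sets)
    ultimately show ?thesis
      by eventually_elim (auto simp: h_def pq)
  qed
  then have "AE x in lebesgue. \<forall>X\<in>\<D>. x \<in> X \<longrightarrow> v x = 0"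
    by (subst AE_ball_countable[OF \<D>(1)]) blast
  then have "AE x in lebesgue. x \<in> U \<longrightarrow> v x = 0"
    by eventually_elim (use \<D>(4) in blast)
  then show ?thesis
    using \<open>open U\<close> by (subst AE_restrict_space_iff) auto
qed

lemma test_function_bounded:
  assumes "\<phi> \<in> test_functions U"
  obtains B where "\<And>x. \<bar>\<phi> x\<bar> \<le> B" "B > 0"
proof -
  obtain C where C: "smooth_plane \<phi>" "compact C" "C \<subseteq> U" "\<And>x. x \<notin> C \<Longrightarrow> \<phi> x = 0"
    using test_functionsE[OF assms] by blast
  have "bounded (\<phi> ` C)"
    by (intro compact_imp_bounded compact_continuous_image smooth_plane_continuous' C)
  then obtain B where B: "B > 0" "\<And>x. x \<in> C \<Longrightarrow> \<bar>\<phi> x\<bar> \<le> B"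
    by (auto simp: bounded_pos)
  then have "\<bar>\<phi> x\<bar> \<le> B" for x
    using C(4)[of x] by (cases "x \<in> C") auto
  with B that show thesis by blast
qed

lemma smooth_plane_measurable: "smooth_plane u \<Longrightarrow> u \<in> borel_measurable borel"
  using smooth_plane_continuous' borel_measurable_continuous_onI by blast

lemma borel_measurable_lebesgue_on: "f \<in> borel_measurable borel \<Longrightarrow> f \<in> borel_measurable (lebesgue_on U)"
  for f :: "'a::euclidean_space \<Rightarrow> real"
  by (intro measurable_restrict_space1 measurable_completion) simp

lemma integrable_times_test_function:
  assumes "open U" "locally_integrable U v" "\<phi> \<in> test_functions U"
  shows "integrable (lebesgue_on U) (\<lambda>x. v x * \<phi> x)"
proof -
  obtain C where C: "smooth_plane \<phi>" "compact C" "C \<subseteq> U" "\<And>x. x \<notin> C \<Longrightarrow> \<phi> x = 0"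
    using test_functionsE[OF assms(3)] by blast
  obtain B where B: "\<And>x. \<bar>\<phi> x\<bar> \<le> B" "B > 0"
    using test_function_bounded[OF assms(3)] by blast
  have C': "C \<in> sets lebesgue"
    using C(2) by (simp add: compact_imp_closed borel_closed)
  have i: "integrable lebesgue (\<lambda>x. indicator C x * v x)"
    using assms(2) C C' unfolding locally_integrable_def
    by (subst lebesgue_integrable_indicator) auto
  have m: "\<phi> \<in> borel_measurable lebesgue"
    using smooth_plane_measurable[OF C(1)] by (simp add: measurable_completion)
  have "integrable lebesgue (\<lambda>x. indicator C x * v x * \<phi> x)"
  proof (rule Bochner_Integration.integrable_bound)
    show "integrable lebesgue (\<lambda>x. B * \<bar>indicator C x * v x\<bar>)"
      using i by simp
    show "(\<lambda>x. indicator C x * v x * \<phi> x) \<in> borel_measurable lebesgue"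
      using borel_measurable_integrable[OF i] m by (rule borel_measurable_times)
    show "AE x in lebesgue. norm (indicator C x * v x * \<phi> x) \<le> norm (B * \<bar>indicator C x * v x\<bar>)"
      using B by (intro AE_I2) (auto simp: abs_mult indicator_def mult.commute[of _ "\<bar>\<phi> _\<bar>"] intro!: mult_right_mono)
  qed
  also have "(\<lambda>x. indicator C x * v x * \<phi> x) = (\<lambda>x. indicator U x * (v x * \<phi> x))"
    using C by (auto simp: indicator_def fun_eq_iff)
  finally show ?thesis
    using assms(1) by (subst (asm) lebesgue_integrable_indicator) auto
qed

lemma has_weak_partial_linear:
  assumes "open U" "has_weak_partial U i u v" "has_weak_partial U i u' v'"
  shows "has_weak_partial U i (\<lambda>x. u x + c * u' x) (\<lambda>x. v x + c * v' x)"
  unfolding has_weak_partial_def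
proof (intro conjI ballI)
  note loc = assms(2,3)[unfolded has_weak_partial_def]
  show "locally_integrable U (\<lambda>x. u x + c * u' x)" "locally_integrable U (\<lambda>x. v x + c * v' x)"
    using loc by (auto simp: locally_integrable_def)
  fix \<phi> assume \<phi>: "\<phi> \<in> test_functions U"
  have "integrable (lebesgue_on U) (\<lambda>x. u x * iter_partial i \<phi> x)" "integrable (lebesgue_on U) (\<lambda>x. u' x * iter_partial i \<phi> x)"
    "integrable (lebesgue_on U) (\<lambda>x. v x * \<phi> x)" "integrable (lebesgue_on U) (\<lambda>x. v' x * \<phi> x)"
    using loc \<phi> assms(1) test_functions_iter_partial[OF \<phi>] by (auto intro: integrable_times_test_function)
  moreover have "integral\<^sup>L (lebesgue_on U) (\<lambda>x. u x * iter_partial i \<phi> x) = (-1) ^ length i * integral\<^sup>L (lebesgue_on U) (\<lambda>x. v x * \<phi> x)"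
    "integral\<^sup>L (lebesgue_on U) (\<lambda>x. u' x * iter_partial i \<phi> x) = (-1) ^ length i * integral\<^sup>L (lebesgue_on U) (\<lambda>x. v' x * \<phi> x)"
    using loc \<phi> by auto
  ultimately show "integral\<^sup>L (lebesgue_on U) (\<lambda>x. (u x + c * u' x) * iter_partial i \<phi> x) =
      (-1) ^ length i * integral\<^sup>L (lebesgue_on U) (\<lambda>x. (v x + c * v' x) * \<phi> x)"
    by (simp add: distrib_right mult.assoc distrib_left)
qed

lemma has_weak_partial_unique:
  assumes "open U" "has_weak_partial U i u v" "has_weak_partial U i u v'"
  shows "AE x in lebesgue_on U. v x = v' x"
proof -
  have "has_weak_partial U i (\<lambda>x. u x + (-1) * u x) (\<lambda>x. v x + (-1) * v' x)"
    by (rule has_weak_partial_linear[OF assms])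
  then have w: "locally_integrable U (\<lambda>x. v x - v' x)"
      "\<And>\<phi>. \<phi> \<in> test_functions U \<Longrightarrow> integral\<^sup>L (lebesgue_on U) (\<lambda>x. (v x - v' x) * \<phi> x) = 0"
    by (auto simp: has_weak_partial_def)
  have "AE x in lebesgue_on U. v x - v' x = 0"
    by (rule fundamental_lemma[OF assms(1) w])
  then show ?thesis
    by eventually_elim simp
qed

lemma weak_partial_works:
  assumes "has_weak_partial U i u v"
  shows "has_weak_partial U i u (weak_partial U i u)"
  unfolding weak_partial_def using someI[of "has_weak_partial U i u", OF assms] .

lemma weak_partial_AE:
  assumes "open U" "has_weak_partial U i u v"
  shows "AE x in lebesgue_on U. weak_partial U i u x = v x"
  using has_weak_partial_unique[OF assms(1) weak_partial_works[OF assms(2)] assms(2)] .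

section \<open>Square integrable functions\<close>

lemma integrable_mult_of_squares:
  fixes f g :: "'a \<Rightarrow> real"
  assumes "f \<in> borel_measurable M" "g \<in> borel_measurable M"
    "integrable M (\<lambda>x. (f x)\<^sup>2)" "integrable M (\<lambda>x. (g x)\<^sup>2)"
  shows "integrable M (\<lambda>x. f x * g x)"
proof (rule Bochner_Integration.integrable_bound)
  show "integrable M (\<lambda>x. (f x)\<^sup>2 + (g x)\<^sup>2)"
    using assms by simp
  have "\<bar>f x * g x\<bar> \<le> (f x)\<^sup>2 + (g x)\<^sup>2" for x
  proof -
    have "2 * (\<bar>f x\<bar> * \<bar>g x\<bar>) \<le> (f x)\<^sup>2 + (g x)\<^sup>2"
      using sum_squares_bound[of "\<bar>f x\<bar>" "\<bar>g x\<bar>"] by (simp add: mult.assoc)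
    moreover have "0 \<le> \<bar>f x\<bar> * \<bar>g x\<bar>"
      by simp
    ultimately show ?thesis
      unfolding abs_mult by linarith
  qed
  then show "AE x in M. norm (f x * g x) \<le> norm ((f x)\<^sup>2 + (g x)\<^sup>2)"
    by (auto intro: order_trans)
qed (use assms in auto)

lemma Cauchy_Schwarz_integral:
  fixes f g :: "'a \<Rightarrow> real"
  assumes "f \<in> borel_measurable M" "g \<in> borel_measurable M"
    "integrable M (\<lambda>x. (f x)\<^sup>2)" "integrable M (\<lambda>x. (g x)\<^sup>2)"
  shows "\<bar>integral\<^sup>L M (\<lambda>x. f x * g x)\<bar> \<le> sqrt (integral\<^sup>L M (\<lambda>x. (f x)\<^sup>2)) * sqrt (integral\<^sup>L M (\<lambda>x. (g x)\<^sup>2))"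
proof -
  define A B C where "A = integral\<^sup>L M (\<lambda>x. (f x)\<^sup>2)" and "B = integral\<^sup>L M (\<lambda>x. f x * g x)"
    and "C = integral\<^sup>L M (\<lambda>x. (g x)\<^sup>2)"
  have int: "integrable M (\<lambda>x. f x * g x)"
    by (rule integrable_mult_of_squares[OF assms])
  have quad: "0 \<le> A - 2 * t * B + t\<^sup>2 * C" for t
  proof -
    have "0 \<le> integral\<^sup>L M (\<lambda>x. (f x - t * g x)\<^sup>2)"
      by simp
    also have "(\<lambda>x. (f x - t * g x)\<^sup>2) = (\<lambda>x. (f x)\<^sup>2 - 2 * t * (f x * g x) + t\<^sup>2 * (g x)\<^sup>2)"
      by (auto simp: power2_eq_square algebra_simps)
    also have "integral\<^sup>L M \<dots> = A - 2 * t * B + t\<^sup>2 * C"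
      using assms int by (simp add: A_def B_def C_def)
    finally show ?thesis .
  qed
  have C: "C \<ge> 0" by (simp add: C_def)
  have A: "A \<ge> 0" by (simp add: A_def)
  have "B\<^sup>2 \<le> A * C"
  proof (cases "C = 0")
    case True
    \<comment> \<open>Otherwise the quadratic polynomial, now linear in \<open>t\<close>, is \<open>- 1\<close> at this \<open>t\<close>.\<close>
    then have "B = 0"
      using quad[of "(A + 1) / (2 * B)"] A by (cases "B = 0") auto
    then show ?thesis using True by simp
  next
    case False
    then show ?thesis
      using quad[of "B / C"] C by (simp add: field_simps power2_eq_square)
  qed
  then have "sqrt (B\<^sup>2) \<le> sqrt (A * C)"
    by (rule real_sqrt_le_mono)
  then show ?thesis
    by (simp add: A_def B_def C_def real_sqrt_mult)
qed

lemma L2_integrable_mult: "f \<in> L2_space U \<Longrightarrow> g \<in> L2_space U \<Longrightarrow> integrable (lebesgue_on U) (\<lambda>x. f x * g x)"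
  by (simp add: L2_space_def integrable_mult_of_squares)

lemma L2_Cauchy_Schwarz:
  "f \<in> L2_space U \<Longrightarrow> g \<in> L2_space U \<Longrightarrow> \<bar>integral\<^sup>L (lebesgue_on U) (\<lambda>x. f x * g x)\<bar> \<le>
     sqrt (integral\<^sup>L (lebesgue_on U) (\<lambda>x. (f x)\<^sup>2)) * sqrt (integral\<^sup>L (lebesgue_on U) (\<lambda>x. (g x)\<^sup>2))"
  by (simp add: L2_space_def Cauchy_Schwarz_integral)

lemma L2_add: "f \<in> L2_space U \<Longrightarrow> g \<in> L2_space U \<Longrightarrow> (\<lambda>x. f x + g x) \<in> L2_space U"
  using L2_integrable_mult[of f U g]
  by (auto simp: L2_space_def power2_sum mult.assoc)

lemma L2_cmult: "f \<in> L2_space U \<Longrightarrow> (\<lambda>x. c * f x) \<in> L2_space U"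
  by (auto simp: L2_space_def power_mult_distrib)

lemma L2_diff: "f \<in> L2_space U \<Longrightarrow> g \<in> L2_space U \<Longrightarrow> (\<lambda>x. f x - g x) \<in> L2_space U"
  using L2_add[OF _ L2_cmult, of f U g "-1"] by simp

lemma L2_bounded:
  assumes "open U" "bounded U" "f \<in> borel_measurable (lebesgue_on U)" "\<And>x. x \<in> U \<Longrightarrow> \<bar>f x\<bar> \<le> B"
  shows "f \<in> L2_space U"
proof -
  have "finite_measure (lebesgue_on U)"
    using assms by (intro finite_measure_lebesgue_on lmeasurable_open)
  then have "integrable (lebesgue_on U) (\<lambda>x. B\<^sup>2)"
    by (rule finite_measure.integrable_const)
  then have "integrable (lebesgue_on U) (\<lambda>x. (f x)\<^sup>2)"
    by (rule Bochner_Integration.integrable_bound)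
       (use assms in \<open>auto simp: space_restrict_space abs_le_square_iff[symmetric] intro!: AE_I2 order_trans[OF assms(4)]\<close>)
  with assms show ?thesis
    by (simp add: L2_space_def)
qed

text \<open>Measurability passes to \<open>g\<close> because Lebesgue measure is complete.\<close>

lemma L2_AE_cong:
  assumes U: "open U" and "f \<in> L2_space U" "AE x in lebesgue_on U. g x = f x"
  shows "g \<in> L2_space U" "integral\<^sup>L (lebesgue_on U) (\<lambda>x. (g x)\<^sup>2) = integral\<^sup>L (lebesgue_on U) (\<lambda>x. (f x)\<^sup>2)"
proof -
  have ae: "AE x in lebesgue. x \<in> U \<longrightarrow> g x = f x"
    using assms by (subst (asm) AE_restrict_space_iff) auto
  have "(\<lambda>x. if x \<in> U then f x else 0) \<in> borel_measurable lebesgue"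
    using assms by (subst borel_measurable_if) (auto simp: L2_space_def)
  then have "(\<lambda>x. if x \<in> U then g x else 0) \<in> borel_measurable lebesgue"
    by (rule borel_measurable_AE) (use ae in \<open>eventually_elim, auto\<close>)
  then have g: "g \<in> borel_measurable (lebesgue_on U)"
    using U by (subst (asm) borel_measurable_if) auto
  have ae2: "AE x in lebesgue_on U. (g x)\<^sup>2 = (f x)\<^sup>2"
    using assms(3) by eventually_elim simp
  have "integrable (lebesgue_on U) (\<lambda>x. (g x)\<^sup>2) \<longleftrightarrow> integrable (lebesgue_on U) (\<lambda>x. (f x)\<^sup>2)"
    by (rule integrable_cong_AE) (use g assms ae2 in \<open>auto simp: L2_space_def\<close>)
  with g assms show "g \<in> L2_space U"
    by (simp add: L2_space_def)
  show "integral\<^sup>L (lebesgue_on U) (\<lambda>x. (g x)\<^sup>2) = integral\<^sup>L (lebesgue_on U) (\<lambda>x. (f x)\<^sup>2)"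
    by (rule integral_cong_AE) (use g assms ae2 in \<open>auto simp: L2_space_def\<close>)
qed

section \<open>Sobolev functions\<close>

lemma sobolev_weak_partial:
  assumes "open U" "u \<in> sobolev m U" "length i \<le> m"
  shows "has_weak_partial U i u (weak_partial U i u)" "weak_partial U i u \<in> L2_space U"
proof -
  obtain v where v: "v \<in> L2_space U" "has_weak_partial U i u v"
    using assms by (auto simp: sobolev_def)
  show "has_weak_partial U i u (weak_partial U i u)"
    by (rule weak_partial_works[OF v(2)])
  show "weak_partial U i u \<in> L2_space U"
    by (rule L2_AE_cong[OF assms(1) v(1) weak_partial_AE[OF assms(1) v(2)]])
qed

lemma test_function_L2:
  assumes "open U" "bounded U" "\<phi> \<in> test_functions U"
  shows "\<phi> \<in> L2_space U"
proof -
  obtain B where "\<And>x. \<bar>\<phi> x\<bar> \<le> B"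
    using test_function_bounded[OF assms(3)] by blast
  moreover have "\<phi> \<in> borel_measurable (lebesgue_on U)"
    using assms(3) by (intro borel_measurable_lebesgue_on smooth_plane_measurable) (simp add: test_functions_iff)
  ultimately show ?thesis
    using assms by (intro L2_bounded)
qed

lemma test_function_weak_partial:
  assumes "open U" "\<phi> \<in> test_functions U"
  shows "has_weak_partial U i \<phi> (iter_partial (rev i) \<phi>)"
  using assms by (intro smooth_has_weak_partial) (simp_all add: test_functions_iff)

lemma finite_multi_indices: "finite {i :: 2 list. length i \<le> m}" "finite (multi_indices m)"
proof -
  show "finite {i :: 2 list. length i \<le> m}"
    using finite_lists_length_le[of "UNIV :: 2 set" m] by simp
  then show "finite (multi_indices m)"
    by (rule rev_finite_subset) (auto simp: multi_indices_def)
qed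

text \<open>A test function is at distance \<open>0\<close> from itself in the Sobolev norm, because the chosen weak
  derivatives of the zero function vanish almost everywhere.\<close>

lemma test_function_sobolev0:
  assumes "open U" "bounded U" "\<phi> \<in> test_functions U"
  shows "\<phi> \<in> sobolev0 m U"
proof -
  have L2: "iter_partial i \<phi> \<in> L2_space U" for i
    using assms test_functions_iter_partial test_function_L2 by blast
  have "\<phi> \<in> sobolev m U"
    using L2 test_function_L2[OF assms] test_function_weak_partial[OF assms(1,3)] unfolding sobolev_def by blast
  moreover have "sobolev_norm m U (\<lambda>x. \<phi> x - \<phi> x) = 0"
  proof -
    have "integral\<^sup>L (lebesgue_on U) (\<lambda>x. (weak_partial U i (\<lambda>x. \<phi> x - \<phi> x) x)\<^sup>2) = 0" for i
    proof (rule integral_eq_zero_AE)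
      have "has_weak_partial U i (\<lambda>x. \<phi> x - \<phi> x) (\<lambda>x. 0)"
        using has_weak_partial_linear[OF assms(1) test_function_weak_partial[OF assms(1,3)]
            test_function_weak_partial[OF assms(1,3)], of i "-1"] by simp
      from weak_partial_AE[OF assms(1) this]
      show "AE x in lebesgue_on U. (weak_partial U i (\<lambda>x. \<phi> x - \<phi> x) x)\<^sup>2 = 0"
        by eventually_elim simp
    qed
    then show ?thesis
      by (simp add: sobolev_norm_def)
  qed
  ultimately show ?thesis
    unfolding sobolev0_def using assms(3) by (intro CollectI conjI allI impI bexI[of _ \<phi>]) simp_all
qed

text \<open>The highest derivatives of \<open>W \<in> H\<^sub>0\<^sup>m\<close> have mean value zero, because this is true of test
  functions and passes to the limit in \<open>L\<^sup>2\<close>.\<close>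

lemma sobolev0_integral_weak_partial:
  assumes U: "open U" "bounded U" and W: "W \<in> sobolev0 m U" and i: "length i = m" "m > 0"
  shows "integral\<^sup>L (lebesgue_on U) (weak_partial U i W) = 0"
proof -
  define G where "G = weak_partial U i W"
  have Wm: "W \<in> sobolev m U"
    using W by (simp add: sobolev0_def)
  have G: "has_weak_partial U i W G" "G \<in> L2_space U"
    unfolding G_def using sobolev_weak_partial[OF U(1) Wm, of i] i by auto
  have one: "(\<lambda>x. 1) \<in> L2_space U"
    using U by (intro L2_bounded[of U _ 1]) auto
  define c where "c = sqrt (integral\<^sup>L (lebesgue_on U) (\<lambda>x. 1\<^sup>2))"
  have "\<bar>integral\<^sup>L (lebesgue_on U) G\<bar> \<le> c * e" if e: "e > 0" for e
  proof -
    obtain \<phi> where \<phi>: "\<phi> \<in> test_functions U" "sobolev_norm m U (\<lambda>x. W x - \<phi> x) < e"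
      using W e by (auto simp: sobolev0_def)
    define p where "p = iter_partial (rev i) \<phi>"
    have p: "has_weak_partial U i \<phi> p" "p \<in> L2_space U" "p \<in> test_functions U"
      unfolding p_def using U \<phi> test_function_weak_partial test_function_L2 test_functions_iter_partial by auto
    obtain b k where bk: "rev i = b # k"
      using i by (cases "rev i") auto
    have p0: "integral\<^sup>L (lebesgue_on U) p = 0"
    proof -
      obtain C where C: "smooth_plane \<phi>" "compact C" "C \<subseteq> U" "\<And>x. x \<notin> C \<Longrightarrow> \<phi> x = 0"
        using test_functionsE[OF \<phi>(1)] by blast
      have p_eq: "p x = frechet_derivative (iter_partial k \<phi>) (at x) (axis b 1)" for x
        by (simp add: p_def bk)
      have zero: "iter_partial j \<phi> x = 0" if "x \<notin> C" for x j
        by (rule iter_partial_zero_outside[OF compact_imp_closed[OF C(2)] C(4) that])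
      have cont: "continuous_on UNIV p"
        unfolding p_def by (rule smooth_plane_continuous[OF C(1)])
      have "integral\<^sup>L (lebesgue_on U) p = integral\<^sup>L lborel p"
        using U(1) zero[of _ "rev i"] C(3) cont
        by (intro integral_lebesgue_on_support) (auto simp: p_def borel_measurable_continuous_onI)
      also have "\<dots> = integral\<^sup>L lborel (\<lambda>x. frechet_derivative (iter_partial k \<phi>) (at x) (axis b 1))"
        unfolding p_eq[abs_def] ..
      also have "\<dots> = 0"
        by (rule integral_partial_eq_0[OF _ C(2)])
           (use C(1) zero cont in \<open>auto simp: smooth_plane_def p_eq[abs_def]\<close>)
      finally show ?thesis .
    qed
    define q where "q x = G x - p x" for x
    have q: "q \<in> L2_space U"
      unfolding q_def[abs_def] using G p by (intro L2_diff)
    have "has_weak_partial U i (\<lambda>x. W x - \<phi> x) q"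
      using has_weak_partial_linear[OF U(1) G(1) p(1), of "-1"] by (simp add: q_def[abs_def])
    from weak_partial_AE[OF U(1) this]
    have eq: "integral\<^sup>L (lebesgue_on U) (\<lambda>x. (weak_partial U i (\<lambda>x. W x - \<phi> x) x)\<^sup>2) = integral\<^sup>L (lebesgue_on U) (\<lambda>x. (q x)\<^sup>2)"
      by (rule L2_AE_cong(2)[OF U(1) q])
    have "integral\<^sup>L (lebesgue_on U) (\<lambda>x. (weak_partial U i (\<lambda>x. W x - \<phi> x) x)\<^sup>2) \<le>
       (\<Sum>i\<in>{i. length i \<le> m}. integral\<^sup>L (lebesgue_on U) (\<lambda>x. (weak_partial U i (\<lambda>x. W x - \<phi> x) x)\<^sup>2))"
      by (rule member_le_sum) (use i finite_multi_indices in auto)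
    then have "sqrt (integral\<^sup>L (lebesgue_on U) (\<lambda>x. (q x)\<^sup>2)) \<le> sobolev_norm m U (\<lambda>x. W x - \<phi> x)"
      unfolding sobolev_norm_def eq by (rule real_sqrt_le_mono)
    then have qe: "sqrt (integral\<^sup>L (lebesgue_on U) (\<lambda>x. (q x)\<^sup>2)) \<le> e"
      using \<phi>(2) by simp
    have intG: "integrable (lebesgue_on U) G" and intp: "integrable (lebesgue_on U) p"
      using L2_integrable_mult[OF one G(2)] L2_integrable_mult[OF one p(2)] by auto
    then have "integral\<^sup>L (lebesgue_on U) G = integral\<^sup>L (lebesgue_on U) q"
      using p0 by (simp add: q_def[abs_def])
    also have "\<bar>\<dots>\<bar> \<le> c * sqrt (integral\<^sup>L (lebesgue_on U) (\<lambda>x. (q x)\<^sup>2))"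
      using L2_Cauchy_Schwarz[OF one q] by (simp add: c_def)
    also have "\<dots> \<le> c * e"
      using qe by (intro mult_left_mono) (auto simp: c_def)
    finally show ?thesis .
  qed
  then have "\<bar>integral\<^sup>L (lebesgue_on U) G\<bar> \<le> e" if "e > 0" for e
  proof -
    have c0: "c \<ge> 0" by (simp add: c_def)
    have "\<bar>integral\<^sup>L (lebesgue_on U) G\<bar> \<le> c * (e / (c + 1))"
      using that c0 \<open>\<And>e. e > 0 \<Longrightarrow> \<bar>integral\<^sup>L (lebesgue_on U) G\<bar> \<le> c * e\<close>[of "e / (c + 1)"] by simp
    also have "\<dots> \<le> e"
      using that c0 by (simp add: field_simps)
    finally show ?thesis .
  qed
  then have "\<bar>integral\<^sup>L (lebesgue_on U) G\<bar> \<le> 0"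
    by (rule field_le_epsilon) simp
  then show ?thesis
    by (simp add: G_def)
qed

section \<open>The perturbation of a polynomial by an inclusion\<close>

text \<open>The function \<open>g\<close> stands for one of the polynomials that prescribe the Dirichlet data: its
  derivatives of order \<open>m\<close> are the constants \<open>A\<close>.  In the presence of the inclusion \<open>D\<close> it is
  perturbed to the solution \<open>u\<close>.\<close>

locale transmission =
  fixes m :: nat and \<kappa> :: real and U D :: "(real^2) set" and g u :: "real^2 \<Rightarrow> real"
    and A :: "2 list \<Rightarrow> real"
  assumes m: "m > 0" and \<kappa>: "0 < \<kappa>" "\<kappa> < 1" and U: "open U" "bounded U"
    and D: "open D" "D \<subseteq> U"
    and g: "smooth_plane g" "\<And>j x. j \<in> multi_indices m \<Longrightarrow> iter_partial (rev j) g x = A j"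
    and u: "weak_solution m U (coefficient \<kappa> D) g u"
begin

abbreviation integral_U :: "(real^2 \<Rightarrow> real) \<Rightarrow> real" where
  "integral_U f \<equiv> integral\<^sup>L (lebesgue_on U) f"

definition W :: "real^2 \<Rightarrow> real" where "W x = u x - g x"

definition G :: "2 list \<Rightarrow> real^2 \<Rightarrow> real" where "G j = weak_partial U j W"

definition vol :: real where "vol = measure lebesgue D"

definition energy :: real where "energy = (\<Sum>j\<in>multi_indices m. integral_U (\<lambda>x. (G j x)\<^sup>2))"

definition data_norm :: real where "data_norm = (\<Sum>j\<in>multi_indices m. \<bar>A j\<bar>)"

lemma W_sobolev0: "W \<in> sobolev0 m U"
  using u by (simp add: weak_solution_def W_def[abs_def])

lemma G_L2: "j \<in> multi_indices m \<Longrightarrow> G j \<in> L2_space U"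
  and G_weak: "j \<in> multi_indices m \<Longrightarrow> has_weak_partial U j W (G j)"
  unfolding G_def using sobolev_weak_partial[OF U(1), of W m j] W_sobolev0
  by (auto simp: sobolev0_def multi_indices_def)

lemma solution_AE:
  assumes "j \<in> multi_indices m"
  shows "AE x in lebesgue_on U. weak_partial U j u x = A j + G j x"
proof -
  have "has_weak_partial U j (\<lambda>x. W x + 1 * g x) (\<lambda>x. G j x + 1 * iter_partial (rev j) g x)"
    by (rule has_weak_partial_linear[OF U(1) G_weak[OF assms] smooth_has_weak_partial[OF U(1) g(1)]])
  then have "has_weak_partial U j u (\<lambda>x. A j + G j x)"
    using assms by (simp add: W_def g(2) add.commute)
  then show ?thesis
    by (rule weak_partial_AE[OF U(1)])
qed

lemma one_L2: "(\<lambda>x. c) \<in> L2_space U"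
  using U by (intro L2_bounded[of U _ "\<bar>c\<bar>"]) auto

lemma L2_integrable: "f \<in> L2_space U \<Longrightarrow> integrable (lebesgue_on U) f"
  using L2_integrable_mult[OF one_L2[of 1]] by simp

lemma coefficient_bounds: "0 \<le> coefficient \<kappa> D x" "coefficient \<kappa> D x \<le> 1" "\<kappa> \<le> coefficient \<kappa> D x"
  using \<kappa> by (auto simp: coefficient_def)

lemma coefficient_eq: "coefficient \<kappa> D x = 1 - (1 - \<kappa>) * indicator D x"
  by (simp add: coefficient_def)

lemma indicator_measurable: "indicat_real D \<in> borel_measurable (lebesgue_on U)"
  using D by (intro borel_measurable_lebesgue_on) auto

lemma coefficient_measurable: "coefficient \<kappa> D \<in> borel_measurable (lebesgue_on U)"
  unfolding coefficient_eq[abs_def] using indicator_measurable by simp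

lemma coefficient_L2: "f \<in> L2_space U \<Longrightarrow> (\<lambda>x. coefficient \<kappa> D x * f x) \<in> L2_space U"
  and coefficient_norm: "f \<in> L2_space U \<Longrightarrow> integral_U (\<lambda>x. (coefficient \<kappa> D x * f x)\<^sup>2) \<le> integral_U (\<lambda>x. (f x)\<^sup>2)"
proof -
  assume f: "f \<in> L2_space U"
  have le: "(coefficient \<kappa> D x * f x)\<^sup>2 \<le> (f x)\<^sup>2" for x
    using coefficient_bounds[of x]
    by (simp add: power_mult_distrib mult_left_le_one_le power_le_one)
  have "integrable (lebesgue_on U) (\<lambda>x. (coefficient \<kappa> D x * f x)\<^sup>2)"
    by (rule Bochner_Integration.integrable_bound[of _ "\<lambda>x. (f x)\<^sup>2"])
       (use f coefficient_measurable le in \<open>auto simp: L2_space_def\<close>)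
  with f show "(\<lambda>x. coefficient \<kappa> D x * f x) \<in> L2_space U"
    using coefficient_measurable by (auto simp: L2_space_def)
  show "integral_U (\<lambda>x. (coefficient \<kappa> D x * f x)\<^sup>2) \<le> integral_U (\<lambda>x. (f x)\<^sup>2)"
    by (rule integral_mono) (fact | use f le in \<open>simp add: L2_space_def\<close>)+
qed

lemma indicator_L2: "indicat_real D \<in> L2_space U"
  using U indicator_measurable by (intro L2_bounded[of U _ 1]) (auto simp: indicator_def)

lemma integral_inclusion: "integral\<^sup>L (lebesgue_on D) f = integral_U (\<lambda>x. indicator D x * f x)"
proof -
  have "integral_U (\<lambda>x. indicator D x * f x) = integral\<^sup>L lebesgue (\<lambda>x. indicator U x * (indicator D x * f x))"
    using U by (subst lebesgue_integrable_indicator) auto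
  also have "(\<lambda>x. indicator U x * (indicator D x * f x)) = (\<lambda>x. indicator D x * f x)"
    using D by (auto simp: indicator_def fun_eq_iff)
  also have "integral\<^sup>L lebesgue \<dots> = integral\<^sup>L (lebesgue_on D) f"
    using D by (subst lebesgue_integrable_indicator) auto
  finally show ?thesis ..
qed

lemma indicator_square: "integral_U (\<lambda>x. (indicator D x)\<^sup>2) = vol"
proof -
  have "(\<lambda>x. (indicator D x)\<^sup>2) = (\<lambda>x. indicator D x * (1::real))"
    by (auto simp: indicator_def fun_eq_iff)
  then have "integral_U (\<lambda>x. (indicator D x)\<^sup>2) = integral\<^sup>L (lebesgue_on D) (\<lambda>x. 1)"
    by (simp only: integral_inclusion)
  also have "\<dots> = vol"
    using D by (simp add: vol_def space_restrict_space measure_restrict_space)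
  finally show ?thesis .
qed

lemma integral_inclusion_le:
  "f \<in> L2_space U \<Longrightarrow> \<bar>integral\<^sup>L (lebesgue_on D) f\<bar> \<le> sqrt vol * sqrt (integral_U (\<lambda>x. (f x)\<^sup>2))"
  using L2_Cauchy_Schwarz[OF indicator_L2] by (simp add: integral_inclusion indicator_square)

lemma vol_nonneg: "vol \<ge> 0"
  by (simp add: vol_def)

lemma data_norm_nonneg: "data_norm \<ge> 0"
  by (simp add: data_norm_def sum_nonneg)

text \<open>In the equation for \<open>u\<close> insert \<open>\<nabla>\<^sup>m u = A + \<nabla>\<^sup>m W\<close>.  The derivatives of order \<open>m\<close> of \<open>w\<close> have mean
  value zero, so the constant tensor \<open>A\<close> contributes only where the coefficient differs from \<open>1\<close>.\<close>

lemma perturbation_identity: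
  assumes w: "w \<in> sobolev0 m U"
  shows "(\<Sum>j\<in>multi_indices m. integral_U (\<lambda>x. coefficient \<kappa> D x * G j x * weak_partial U j w x)) =
    (1 - \<kappa>) * (\<Sum>j\<in>multi_indices m. A j * integral\<^sup>L (lebesgue_on D) (weak_partial U j w))"
proof -
  define P where "P j = weak_partial U j w" for j
  define \<gamma> where "\<gamma> = coefficient \<kappa> D"
  have wm: "w \<in> sobolev m U"
    using w by (simp add: sobolev0_def)
  have P: "P j \<in> L2_space U" if "j \<in> multi_indices m" for j
    unfolding P_def using sobolev_weak_partial[OF U(1) wm, of j] that by (simp add: multi_indices_def)
  have P0: "integral_U (P j) = 0" if "j \<in> multi_indices m" for j
    unfolding P_def using sobolev0_integral_weak_partial[OF U w _ m, of j] that by (simp add: multi_indices_def)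
  have \<gamma>P: "integrable (lebesgue_on U) (\<lambda>x. \<gamma> x * P j x)" if "j \<in> multi_indices m" for j
    unfolding \<gamma>_def by (intro L2_integrable coefficient_L2 P that)
  have \<gamma>PG: "integrable (lebesgue_on U) (\<lambda>x. \<gamma> x * G j x * P j x)" if "j \<in> multi_indices m" for j
    unfolding \<gamma>_def by (intro L2_integrable_mult coefficient_L2 P G_L2 that)
  have \<gamma>P0: "integral_U (\<lambda>x. \<gamma> x * P j x) = - (1 - \<kappa>) * integral\<^sup>L (lebesgue_on D) (P j)" if "j \<in> multi_indices m" for j
  proof -
    have "(\<lambda>x. \<gamma> x * P j x) = (\<lambda>x. P j x - (1 - \<kappa>) * (indicator D x * P j x))"
      by (auto simp: \<gamma>_def coefficient_eq algebra_simps)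
    then show ?thesis
      using P0[OF that] L2_integrable[OF P[OF that]] L2_integrable_mult[OF indicator_L2 P[OF that]]
      by (simp add: integral_inclusion algebra_simps)
  qed
  have "0 = integral_U (\<lambda>x. \<gamma> x * tensor_inner m (\<lambda>i. weak_partial U i u x) (\<lambda>i. weak_partial U i w x))"
    using u w by (simp add: weak_solution_def \<gamma>_def)
  also have "\<dots> = integral_U (\<lambda>x. \<Sum>j\<in>multi_indices m. A j * (\<gamma> x * P j x) + \<gamma> x * G j x * P j x)"
  proof (rule integral_cong_AE)
    have meas: "(\<lambda>x. weak_partial U j u x) \<in> borel_measurable (lebesgue_on U)" if "j \<in> multi_indices m" for j
    proof -
      have "weak_partial U j u \<in> L2_space U"
        using sobolev_weak_partial[OF U(1), of u m j] u that by (auto simp: weak_solution_def multi_indices_def)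
      then show ?thesis by (simp add: L2_space_def)
    qed
    show "(\<lambda>x. \<gamma> x * tensor_inner m (\<lambda>i. weak_partial U i u x) (\<lambda>i. weak_partial U i w x)) \<in> borel_measurable (lebesgue_on U)"
      unfolding tensor_inner_def \<gamma>_def using P
      by (intro borel_measurable_times coefficient_measurable borel_measurable_sum meas)
         (auto simp: P_def L2_space_def)
    show "(\<lambda>x. \<Sum>j\<in>multi_indices m. A j * (\<gamma> x * P j x) + \<gamma> x * G j x * P j x) \<in> borel_measurable (lebesgue_on U)"
      using \<gamma>P \<gamma>PG by (intro borel_measurable_sum borel_measurable_add borel_measurable_times borel_measurable_integrable) auto
    have "AE x in lebesgue_on U. \<forall>j\<in>multi_indices m. weak_partial U j u x = A j + G j x"
      using solution_AE finite_multi_indices(2) by (intro AE_finite_allI)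
    then show "AE x in lebesgue_on U. \<gamma> x * tensor_inner m (\<lambda>i. weak_partial U i u x) (\<lambda>i. weak_partial U i w x) =
       (\<Sum>j\<in>multi_indices m. A j * (\<gamma> x * P j x) + \<gamma> x * G j x * P j x)"
      by eventually_elim (auto simp: tensor_inner_def sum_distrib_left P_def algebra_simps intro!: sum.cong)
  qed
  also have "\<dots> = (\<Sum>j\<in>multi_indices m. A j * integral_U (\<lambda>x. \<gamma> x * P j x) + integral_U (\<lambda>x. \<gamma> x * G j x * P j x))"
    using \<gamma>P \<gamma>PG by (subst Bochner_Integration.integral_sum) auto
  also have "\<dots> = (\<Sum>j\<in>multi_indices m. A j * (- (1 - \<kappa>) * integral\<^sup>L (lebesgue_on D) (P j))) + (\<Sum>j\<in>multi_indices m. integral_U (\<lambda>x. \<gamma> x * G j x * P j x))"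
    by (simp add: sum.distrib \<gamma>P0 cong: sum.cong)
  also have "(\<Sum>j\<in>multi_indices m. A j * (- (1 - \<kappa>) * integral\<^sup>L (lebesgue_on D) (P j))) =
      - ((1 - \<kappa>) * (\<Sum>j\<in>multi_indices m. A j * integral\<^sup>L (lebesgue_on D) (P j)))"
    by (simp add: sum_distrib_left sum_negf[symmetric] algebra_simps)
  finally show ?thesis
    by (simp add: \<gamma>_def P_def)
qed

lemma G_norm_energy:
  assumes "j \<in> multi_indices m"
  shows "sqrt (integral_U (\<lambda>x. (G j x)\<^sup>2)) \<le> sqrt energy"
  unfolding energy_def
  by (intro real_sqrt_le_mono member_le_sum[OF assms, of "\<lambda>j. integral_U (\<lambda>x. (G j x)\<^sup>2)"] finite_multi_indices) auto

text \<open>The perturbation identity is tested with \<open>W\<close> itself.  Its right-hand side is an integral over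
  \<open>D\<close>, so that the Cauchy-Schwarz inequality yields the factor \<open>sqrt vol\<close>.\<close>

lemma energy_bound: "sqrt energy \<le> data_norm / \<kappa> * sqrt vol"
proof -
  have E: "energy \<ge> 0"
    by (simp add: energy_def sum_nonneg)
  have "\<kappa> * energy = (\<Sum>j\<in>multi_indices m. integral_U (\<lambda>x. \<kappa> * (G j x)\<^sup>2))"
    by (simp add: energy_def sum_distrib_left)
  also have "\<dots> \<le> (\<Sum>j\<in>multi_indices m. integral_U (\<lambda>x. coefficient \<kappa> D x * G j x * G j x))"
  proof (intro sum_mono integral_mono)
    fix j assume j: "j \<in> multi_indices m"
    show "integrable (lebesgue_on U) (\<lambda>x. \<kappa> * (G j x)\<^sup>2)"
      using G_L2[OF j] by (simp add: L2_space_def)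
    show "integrable (lebesgue_on U) (\<lambda>x. coefficient \<kappa> D x * G j x * G j x)"
      by (intro L2_integrable_mult coefficient_L2 G_L2 j)
    show "\<kappa> * (G j x)\<^sup>2 \<le> coefficient \<kappa> D x * G j x * G j x" for x
      using coefficient_bounds(3)[of x] by (simp add: power2_eq_square mult.assoc mult_right_mono)
  qed
  also have "\<dots> = (1 - \<kappa>) * (\<Sum>j\<in>multi_indices m. A j * integral\<^sup>L (lebesgue_on D) (G j))"
    using perturbation_identity[OF W_sobolev0] by (simp add: G_def)
  finally have le: "\<kappa> * energy \<le> (1 - \<kappa>) * (\<Sum>j\<in>multi_indices m. A j * integral\<^sup>L (lebesgue_on D) (G j))" .
  also have "\<dots> \<le> 1 * (\<Sum>j\<in>multi_indices m. \<bar>A j\<bar> * (sqrt vol * sqrt energy))"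
  proof (rule mult_mono)
    show "(\<Sum>j\<in>multi_indices m. A j * integral\<^sup>L (lebesgue_on D) (G j)) \<le> (\<Sum>j\<in>multi_indices m. \<bar>A j\<bar> * (sqrt vol * sqrt energy))"
    proof (rule sum_mono)
      fix j assume j: "j \<in> multi_indices m"
      have "A j * integral\<^sup>L (lebesgue_on D) (G j) \<le> \<bar>A j\<bar> * \<bar>integral\<^sup>L (lebesgue_on D) (G j)\<bar>"
        by (metis abs_ge_self abs_mult)
      also have "\<dots> \<le> \<bar>A j\<bar> * (sqrt vol * sqrt energy)"
        using order_trans[OF integral_inclusion_le[OF G_L2[OF j]] mult_left_mono[OF G_norm_energy[OF j]]] vol_nonneg
        by (intro mult_left_mono) auto
      finally show "A j * integral\<^sup>L (lebesgue_on D) (G j) \<le> \<bar>A j\<bar> * (sqrt vol * sqrt energy)" .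
    qed
  next
    have "0 \<le> \<kappa> * energy" using E \<kappa> by simp
    with le have "0 \<le> (1 - \<kappa>) * (\<Sum>j\<in>multi_indices m. A j * integral\<^sup>L (lebesgue_on D) (G j))"
      by linarith
    then show "0 \<le> (\<Sum>j\<in>multi_indices m. A j * integral\<^sup>L (lebesgue_on D) (G j))"
      using \<kappa> by (simp add: zero_le_mult_iff)
  qed (use \<kappa> in auto)
  also have "\<dots> = data_norm * sqrt vol * sqrt energy"
    by (simp add: data_norm_def sum_distrib_right mult.assoc)
  finally have "\<kappa> * (sqrt energy * sqrt energy) \<le> data_norm * sqrt vol * sqrt energy"
    using E by simp
  then have "sqrt energy * (\<kappa> * sqrt energy) \<le> sqrt energy * (data_norm * sqrt vol)"
    by (simp add: mult_ac)
  then have "\<kappa> * sqrt energy \<le> data_norm * sqrt vol"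
    using E data_norm_nonneg vol_nonneg by (cases "energy = 0") (auto simp: mult_le_cancel_left)
  then show ?thesis
    using \<kappa> by (simp add: field_simps)
qed

lemma G_norm:
  assumes "j \<in> multi_indices m"
  shows "sqrt (integral_U (\<lambda>x. (G j x)\<^sup>2)) \<le> data_norm / \<kappa> * sqrt vol"
  using G_norm_energy[OF assms] energy_bound by linarith

end

lemma count_list_replicate: "count_list (replicate n a) b = (if a = b then n else 0)"
  by (induction n) auto

section \<open>Mean values over the inclusion\<close>

context transmission
begin

text \<open>The deviation of \<open>\<nabla>\<^sup>m w\<close> from the tensor field that is \<open>e\<^sub>2 \<otimes> \<dots> \<otimes> e\<^sub>2\<close> on the inclusion and
  \<open>0\<close> elsewhere.\<close>

definition test_error :: "(real^2 \<Rightarrow> real) \<Rightarrow> 2 list \<Rightarrow> real^2 \<Rightarrow> real" where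
  "test_error w j x = iter_partial j w x - (if j = replicate m 2 then indicator D x else 0)"

text \<open>Large enough for both mean value estimates below.  It depends on \<open>m\<close>, \<open>\<kappa>\<close> and \<open>A\<close>, but not on
  the inclusion.\<close>

definition stability_const :: real where
  "stability_const = (data_norm + real (card (multi_indices m)) * data_norm / \<kappa>) / \<kappa> + 2 * data_norm / \<kappa>"

text \<open>Suppose that \<open>w\<close> is a test function whose \<open>m\<close>-th gradient is close, relative to the size of the
  inclusion, to \<open>e\<^sub>2 \<otimes> \<dots> \<otimes> e\<^sub>2\<close> times the indicator of the inclusion.  The existence of such
  functions is where the geometry of a thin inclusion enters; the mean values of the solution follow
  from it.\<close>

context
  fixes p q :: "real \<Rightarrow> real" and w :: "real^2 \<Rightarrow> real" and r :: real
  assumes pq: "smooth_real p" "smooth_real q" and w: "w = separated p q" "w \<in> test_functions U"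
    and r: "r \<ge> 0"
    and err: "\<And>j. j \<in> multi_indices m \<Longrightarrow> integral_U (\<lambda>x. (test_error w j x)\<^sup>2) \<le> r * vol"
begin

lemma iter_partial_w: "iter_partial i w = separated ((deriv ^^ count_list i 1) p) ((deriv ^^ count_list i 2) q)"
  unfolding w(1) by (rule iter_partial_separated[OF pq])

lemma iter_partial_w_rev: "iter_partial (rev i) w = iter_partial i w"
  by (simp add: iter_partial_w)

lemma w_L2: "iter_partial i w \<in> L2_space U"
  using test_function_L2[OF U test_functions_iter_partial[OF w(2)]] .

lemma test_error_L2: "test_error w j \<in> L2_space U"
proof -
  have "(\<lambda>x. if j = replicate m 2 then indicat_real D x else 0) \<in> L2_space U"
    using indicator_L2 one_L2[of 0] by (cases "j = replicate m 2") simp_all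
  with w_L2[of j] show ?thesis
    unfolding test_error_def[abs_def] by (rule L2_diff)
qed

lemma test_error_norm:
  assumes "j \<in> multi_indices m"
  shows "sqrt (integral_U (\<lambda>x. (test_error w j x)\<^sup>2)) \<le> sqrt r * sqrt vol"
  using real_sqrt_le_mono[OF err[OF assms]] by (simp add: real_sqrt_mult)

lemma weak_partial_w: "AE x in lebesgue_on U. weak_partial U j w x = iter_partial j w x"
  using weak_partial_AE[OF U(1) test_function_weak_partial[OF U(1) w(2)]] by (simp add: iter_partial_w_rev)

lemma G_test_error:
  assumes "i \<in> multi_indices m" "j \<in> multi_indices m"
  shows "\<bar>integral_U (\<lambda>x. G i x * test_error w j x)\<bar> \<le> data_norm / \<kappa> * sqrt r * vol"
    and "\<bar>integral_U (\<lambda>x. coefficient \<kappa> D x * G i x * test_error w j x)\<bar> \<le> data_norm / \<kappa> * sqrt r * vol"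
proof -
  have "data_norm / \<kappa> * sqrt vol * (sqrt r * sqrt vol) = data_norm / \<kappa> * sqrt r * (sqrt vol * sqrt vol)"
    by (simp only: mult_ac)
  then have eq: "data_norm / \<kappa> * sqrt vol * (sqrt r * sqrt vol) = data_norm / \<kappa> * sqrt r * vol"
    using vol_nonneg by simp
  note bnd = G_norm[OF assms(1)] test_error_norm[OF assms(2)]
  have "\<bar>integral_U (\<lambda>x. G i x * test_error w j x)\<bar> \<le> sqrt (integral_U (\<lambda>x. (G i x)\<^sup>2)) * sqrt (integral_U (\<lambda>x. (test_error w j x)\<^sup>2))"
    by (rule L2_Cauchy_Schwarz[OF G_L2[OF assms(1)] test_error_L2])
  also have "\<dots> \<le> data_norm / \<kappa> * sqrt vol * (sqrt r * sqrt vol)"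
    using bnd data_norm_nonneg \<kappa> vol_nonneg by (intro mult_mono) auto
  finally show "\<bar>integral_U (\<lambda>x. G i x * test_error w j x)\<bar> \<le> data_norm / \<kappa> * sqrt r * vol"
    unfolding eq .
  have "\<bar>integral_U (\<lambda>x. coefficient \<kappa> D x * G i x * test_error w j x)\<bar> \<le>
      sqrt (integral_U (\<lambda>x. (coefficient \<kappa> D x * G i x)\<^sup>2)) * sqrt (integral_U (\<lambda>x. (test_error w j x)\<^sup>2))"
    by (rule L2_Cauchy_Schwarz[OF coefficient_L2[OF G_L2[OF assms(1)]] test_error_L2])
  also have "\<dots> \<le> data_norm / \<kappa> * sqrt vol * (sqrt r * sqrt vol)"
    using bnd data_norm_nonneg \<kappa> vol_nonneg
      order_trans[OF real_sqrt_le_mono[OF coefficient_norm[OF G_L2[OF assms(1)]]] bnd(1)]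
    by (intro mult_mono) auto
  finally show "\<bar>integral_U (\<lambda>x. coefficient \<kappa> D x * G i x * test_error w j x)\<bar> \<le> data_norm / \<kappa> * sqrt r * vol"
    unfolding eq .
qed

lemma replicate_in: "replicate m 2 \<in> multi_indices m"
  by (simp add: multi_indices_def)

text \<open>Test the perturbation identity with \<open>w\<close>.  If \<open>\<nabla>\<^sup>m w\<close> were exactly the indicator of \<open>D\<close> times
  \<open>e\<^sub>2 \<otimes> \<dots> \<otimes> e\<^sub>2\<close>, it would say that \<open>\<kappa> * I = (1 - \<kappa>) * A * vol\<close>, where \<open>A\<close> is the purely
  transversal component of the data and \<open>I\<close> is the integral of \<open>\<partial>\<^sub>2\<^sup>m W\<close> over \<open>D\<close>.  The errors in
  \<open>\<nabla>\<^sup>m w\<close> enter through \<open>S\<close>, where they meet \<open>\<nabla>\<^sup>m W\<close> and the energy bound applies, and through \<open>T\<close>,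
  where they are integrated over \<open>D\<close> alone.\<close>

lemma transversal_average:
  "\<bar>integral\<^sup>L (lebesgue_on D) (G (replicate m 2)) - (1 / \<kappa> - 1) * A (replicate m 2) * vol\<bar>
     \<le> stability_const * sqrt r * vol"
proof -
  let ?J = "replicate m (2 :: 2)"
  let ?M = "multi_indices m"
  let ?e = "test_error w"
  define \<gamma> where "\<gamma> = coefficient \<kappa> D"
  define S where "S = (\<Sum>j\<in>?M. integral_U (\<lambda>x. \<gamma> x * G j x * ?e j x))"
  define T where "T = (\<Sum>j\<in>?M. A j * integral_U (\<lambda>x. indicator D x * ?e j x))"
  define I where "I = integral_U (\<lambda>x. indicator D x * G ?J x)"
  have wp_L2: "weak_partial U j w \<in> L2_space U" for j
    by (rule L2_AE_cong(1)[OF U(1) w_L2 weak_partial_w])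
  have \<gamma>G: "(\<lambda>x. \<gamma> x * G j x) \<in> L2_space U" if "j \<in> ?M" for j
    unfolding \<gamma>_def by (intro coefficient_L2 G_L2 that)
  have lhs: "integral_U (\<lambda>x. \<gamma> x * G j x * weak_partial U j w x) =
      integral_U (\<lambda>x. \<gamma> x * G j x * ?e j x) + (if j = ?J then \<kappa> * I else 0)" if j: "j \<in> ?M" for j
  proof -
    have "integral_U (\<lambda>x. \<gamma> x * G j x * weak_partial U j w x) = integral_U (\<lambda>x. \<gamma> x * G j x * iter_partial j w x)"
    proof (rule integral_cong_AE)
      show "AE x in lebesgue_on U. \<gamma> x * G j x * weak_partial U j w x = \<gamma> x * G j x * iter_partial j w x"
        using weak_partial_w[of j] by eventually_elim simp
    qed (use L2_integrable_mult[OF \<gamma>G[OF j] wp_L2] L2_integrable_mult[OF \<gamma>G[OF j] w_L2] in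
         \<open>auto dest: borel_measurable_integrable\<close>)
    also have "\<dots> = integral_U (\<lambda>x. \<gamma> x * G j x * ?e j x + (if j = ?J then \<kappa> else 0) * (indicator D x * G j x))"
      by (intro Bochner_Integration.integral_cong refl)
         (auto simp: test_error_def \<gamma>_def coefficient_def algebra_simps indicator_def)
    also have "\<dots> = integral_U (\<lambda>x. \<gamma> x * G j x * ?e j x) + (if j = ?J then \<kappa> else 0) * integral_U (\<lambda>x. indicator D x * G j x)"
      using L2_integrable_mult[OF \<gamma>G[OF j] test_error_L2] L2_integrable_mult[OF indicator_L2 G_L2[OF j]] by simp
    finally show ?thesis
      by (simp add: I_def)
  qed
  have rhs: "integral\<^sup>L (lebesgue_on D) (weak_partial U j w) =
      integral_U (\<lambda>x. indicator D x * ?e j x) + (if j = ?J then vol else 0)" for j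
  proof -
    have "integral\<^sup>L (lebesgue_on D) (weak_partial U j w) = integral_U (\<lambda>x. indicator D x * weak_partial U j w x)"
      by (rule integral_inclusion)
    also have "\<dots> = integral_U (\<lambda>x. indicator D x * iter_partial j w x)"
    proof (rule integral_cong_AE)
      show "AE x in lebesgue_on U. indicator D x * weak_partial U j w x = indicator D x * iter_partial j w x"
        using weak_partial_w[of j] by eventually_elim simp
    qed (use L2_integrable_mult[OF indicator_L2 wp_L2] L2_integrable_mult[OF indicator_L2 w_L2] in
         \<open>auto dest: borel_measurable_integrable\<close>)
    also have "\<dots> = integral_U (\<lambda>x. indicator D x * ?e j x + (if j = ?J then 1 else 0) * (indicator D x)\<^sup>2)"
      by (intro Bochner_Integration.integral_cong refl)
         (auto simp: test_error_def algebra_simps indicator_def)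
    also have "\<dots> = integral_U (\<lambda>x. indicator D x * ?e j x) + (if j = ?J then 1 else 0) * integral_U (\<lambda>x. (indicator D x)\<^sup>2)"
      using L2_integrable_mult[OF indicator_L2 test_error_L2] indicator_L2
      by (subst Bochner_Integration.integral_add) (auto simp: L2_space_def)
    finally show ?thesis
      by (simp add: indicator_square)
  qed
  have "S + \<kappa> * I = (\<Sum>j\<in>?M. integral_U (\<lambda>x. \<gamma> x * G j x * weak_partial U j w x))"
    using replicate_in finite_multi_indices(2) by (simp add: lhs S_def sum.distrib cong: sum.cong)
  also have "\<dots> = (1 - \<kappa>) * (\<Sum>j\<in>?M. A j * integral\<^sup>L (lebesgue_on D) (weak_partial U j w))"
    unfolding \<gamma>_def by (rule perturbation_identity[OF test_function_sobolev0[OF U w(2)]])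
  also have "(\<Sum>j\<in>?M. A j * integral\<^sup>L (lebesgue_on D) (weak_partial U j w)) = T + A ?J * vol"
  proof -
    have "(\<Sum>j\<in>?M. A j * integral\<^sup>L (lebesgue_on D) (weak_partial U j w)) =
        (\<Sum>j\<in>?M. A j * integral_U (\<lambda>x. indicator D x * ?e j x) + (if j = ?J then A ?J * vol else 0))"
      by (intro sum.cong refl) (simp add: rhs algebra_simps)
    then show ?thesis
      using replicate_in finite_multi_indices(2) by (simp add: T_def sum.distrib)
  qed
  finally have main: "S + \<kappa> * I = (1 - \<kappa>) * (T + A ?J * vol)" .
  have "\<bar>S\<bar> \<le> (\<Sum>j\<in>?M. data_norm / \<kappa> * sqrt r * vol)"
    unfolding S_def \<gamma>_def by (rule order_trans[OF sum_abs sum_mono]) (rule G_test_error(2))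
  then have S: "\<bar>S\<bar> \<le> real (card ?M) * data_norm / \<kappa> * sqrt r * vol"
    by simp
  have "\<bar>T\<bar> \<le> (\<Sum>j\<in>?M. \<bar>A j\<bar> * (sqrt r * vol))"
    unfolding T_def
  proof (rule order_trans[OF sum_abs sum_mono])
    fix j assume j: "j \<in> ?M"
    have "\<bar>integral_U (\<lambda>x. indicator D x * ?e j x)\<bar> \<le> sqrt vol * sqrt (integral_U (\<lambda>x. (?e j x)\<^sup>2))"
      using integral_inclusion_le[OF test_error_L2] by (simp add: integral_inclusion)
    also have "\<dots> \<le> sqrt vol * (sqrt r * sqrt vol)"
      using test_error_norm[OF j] vol_nonneg by (intro mult_left_mono) auto
    also have "\<dots> = sqrt r * vol"
      using vol_nonneg by simp
    finally show "\<bar>A j * integral_U (\<lambda>x. indicator D x * ?e j x)\<bar> \<le> \<bar>A j\<bar> * (sqrt r * vol)"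
      by (simp add: abs_mult mult_left_mono)
  qed
  then have T: "\<bar>T\<bar> \<le> data_norm * sqrt r * vol"
    by (simp add: data_norm_def sum_distrib_right mult.assoc)
  have "\<kappa> * (I - (1 / \<kappa> - 1) * A ?J * vol) = \<kappa> * I - (1 - \<kappa>) * (A ?J * vol)"
    using \<kappa> by (simp add: field_simps)
  also have "\<dots> = (1 - \<kappa>) * T - S"
    using main unfolding distrib_left by linarith
  finally have "\<kappa> * (I - (1 / \<kappa> - 1) * A ?J * vol) = (1 - \<kappa>) * T - S" .
  then have "\<kappa> * \<bar>I - (1 / \<kappa> - 1) * A ?J * vol\<bar> = \<bar>(1 - \<kappa>) * T - S\<bar>"
    using \<kappa> by (metis abs_mult abs_of_pos)
  also have "\<dots> \<le> (1 - \<kappa>) * \<bar>T\<bar> + \<bar>S\<bar>"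
    using \<kappa> by (intro order_trans[OF abs_triangle_ineq4]) (simp add: abs_mult)
  also have "\<dots> \<le> 1 * \<bar>T\<bar> + \<bar>S\<bar>"
    using \<kappa> by (intro add_right_mono mult_right_mono) auto
  also have "\<dots> \<le> (data_norm + real (card ?M) * data_norm / \<kappa>) * sqrt r * vol"
    using S T by (simp add: algebra_simps)
  finally have "\<bar>I - (1 / \<kappa> - 1) * A ?J * vol\<bar> \<le> (data_norm + real (card ?M) * data_norm / \<kappa>) / \<kappa> * sqrt r * vol"
    using \<kappa> by (simp add: field_simps)
  also have "\<dots> \<le> stability_const * sqrt r * vol"
    using data_norm_nonneg \<kappa> r vol_nonneg by (intro mult_right_mono) (auto simp: stability_const_def)
  finally show ?thesis
    by (simp add: I_def integral_inclusion)
qed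

text \<open>Every other derivative contains a derivative in the direction of the segment, and this one can
  be exchanged with a transversal derivative of \<open>w\<close>: both
  \<open>\<partial>\<^sub>1 \<partial>\<^sup>\<alpha> W\<close> against \<open>\<partial>\<^sub>2\<^sup>m w\<close> and \<open>\<partial>\<^sub>2 \<partial>\<^sup>\<alpha> W\<close> against
  \<open>\<partial>\<^sub>1 \<partial>\<^sub>2\<^sup>m\<^sup>-\<^sup>1 w\<close> are \<open>W\<close> integrated against the same derivative of order \<open>2m\<close>.  The
  first factor \<open>\<partial>\<^sub>2\<^sup>m w\<close> is nearly the indicator of the inclusion, while
  \<open>\<partial>\<^sub>1 \<partial>\<^sub>2\<^sup>m\<^sup>-\<^sup>1 w\<close> is nearly zero.\<close>

lemma longitudinal_average:
  assumes j: "j \<in> multi_indices m" "j \<noteq> replicate m 2"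
  shows "\<bar>integral\<^sup>L (lebesgue_on D) (G j)\<bar> \<le> stability_const * sqrt r * vol"
proof -
  let ?J = "replicate m (2 :: 2)"
  have "1 \<in> set j"
  proof (rule ccontr)
    assume "1 \<notin> set j"
    then have "\<forall>a\<in>set j. a = 2"
      using exhaust_2 by metis
    then have "j = ?J"
      using j by (metis (mono_tags) multi_indices_def mem_Collect_eq replicate_length_same)
    with j show False by simp
  qed
  then obtain a b where ab: "j = a @ 1 # b"
    by (meson split_list)
  define j' where "j' = a @ 2 # b"
  define K where "K = 1 # replicate (m - 1) (2 :: 2)"
  have j': "j' \<in> multi_indices m"
    using j by (simp add: ab j'_def multi_indices_def)
  have K: "K \<in> multi_indices m" "K \<noteq> ?J"
    using m by (auto simp: K_def multi_indices_def; cases m; simp)+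
  have same: "iter_partial (j @ ?J) w = iter_partial (j' @ K) w"
    using m by (simp add: iter_partial_w ab j'_def K_def count_list_replicate Suc_diff_1)
  have weak: "integral_U (\<lambda>x. W x * iter_partial (i @ k) w x) = (-1) ^ m * integral_U (\<lambda>x. G i x * iter_partial k w x)"
    if "i \<in> multi_indices m" for i k
    using G_weak[OF that] test_functions_iter_partial[OF w(2), of k] that
    by (auto simp: has_weak_partial_def iter_partial_append multi_indices_def)
  have "(-1) ^ m * integral_U (\<lambda>x. G j x * iter_partial ?J w x) = (-1) ^ m * integral_U (\<lambda>x. G j' x * iter_partial K w x)"
    using weak[OF j(1), of ?J] weak[OF j', of K] same by simp
  then have swap: "integral_U (\<lambda>x. G j x * iter_partial ?J w x) = integral_U (\<lambda>x. G j' x * iter_partial K w x)"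
    by simp
  have "integral_U (\<lambda>x. G j x * iter_partial ?J w x) = integral_U (\<lambda>x. G j x * test_error w ?J x + indicator D x * G j x)"
    by (intro Bochner_Integration.integral_cong refl) (simp add: test_error_def algebra_simps)
  also have "\<dots> = integral_U (\<lambda>x. G j x * test_error w ?J x) + integral\<^sup>L (lebesgue_on D) (G j)"
    using L2_integrable_mult[OF G_L2[OF j(1)] test_error_L2] L2_integrable_mult[OF indicator_L2 G_L2[OF j(1)]]
    by (simp add: integral_inclusion)
  finally have "integral\<^sup>L (lebesgue_on D) (G j) =
      integral_U (\<lambda>x. G j' x * test_error w K x) - integral_U (\<lambda>x. G j x * test_error w ?J x)"
    using swap K by (simp add: test_error_def)
  then have "\<bar>integral\<^sup>L (lebesgue_on D) (G j)\<bar> \<le> 2 * (data_norm / \<kappa> * sqrt r * vol)"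
    using G_test_error(1)[OF j' K(1)] G_test_error(1)[OF j(1) replicate_in] by linarith
  also have "\<dots> = 2 * data_norm / \<kappa> * sqrt r * vol"
    by simp
  also have "\<dots> \<le> stability_const * sqrt r * vol"
    using data_norm_nonneg \<kappa> r vol_nonneg by (intro mult_right_mono) (auto simp: stability_const_def)
  finally show ?thesis .
qed

lemma solution_average:
  assumes "j \<in> multi_indices m" "vol > 0"
  shows "\<bar>1 / vol * integral\<^sup>L (lebesgue_on D) (weak_partial U j u) -
     (if j = replicate m 2 then 1 / \<kappa> else 1) * A j\<bar> \<le> stability_const * sqrt r"
proof -
  define c where "c = (if j = replicate m 2 then (1 / \<kappa> - 1) * A j else 0)"
  have a: "\<bar>integral\<^sup>L (lebesgue_on D) (G j) - c * vol\<bar> \<le> stability_const * sqrt r * vol"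
    using transversal_average longitudinal_average[OF assms(1)] by (simp add: c_def)
  have "integral\<^sup>L (lebesgue_on D) (weak_partial U j u) = integral_U (\<lambda>x. indicator D x * weak_partial U j u x)"
    by (rule integral_inclusion)
  also have "\<dots> = integral_U (\<lambda>x. A j * (indicator D x)\<^sup>2 + indicator D x * G j x)"
  proof (rule integral_cong_AE)
    have "weak_partial U j u \<in> L2_space U"
      using sobolev_weak_partial[OF U(1), of u m j] u assms(1) by (auto simp: weak_solution_def multi_indices_def)
    then show "(\<lambda>x. indicator D x * weak_partial U j u x) \<in> borel_measurable (lebesgue_on U)"
      using L2_integrable_mult[OF indicator_L2] by (auto dest: borel_measurable_integrable)
    show "(\<lambda>x. A j * (indicator D x)\<^sup>2 + indicator D x * G j x) \<in> borel_measurable (lebesgue_on U)"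
      using G_L2[OF assms(1)]
      by (intro borel_measurable_add borel_measurable_times borel_measurable_power borel_measurable_const
          indicator_measurable) (simp add: L2_space_def)
    show "AE x in lebesgue_on U. indicator D x * weak_partial U j u x = A j * (indicator D x)\<^sup>2 + indicator D x * G j x"
      using solution_AE[OF assms(1)] by eventually_elim (auto simp: indicator_def)
  qed
  also have "\<dots> = A j * vol + integral\<^sup>L (lebesgue_on D) (G j)"
    using indicator_L2 L2_integrable_mult[OF indicator_L2 G_L2[OF assms(1)]]
    by (subst Bochner_Integration.integral_add) (auto simp: L2_space_def integral_inclusion indicator_square)
  finally have eq: "integral\<^sup>L (lebesgue_on D) (weak_partial U j u) = A j * vol + integral\<^sup>L (lebesgue_on D) (G j)" .
  have "1 / vol * integral\<^sup>L (lebesgue_on D) (weak_partial U j u) - (if j = replicate m 2 then 1 / \<kappa> else 1) * A j =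
      (integral\<^sup>L (lebesgue_on D) (G j) - c * vol) / vol"
    unfolding eq c_def using assms(2) by (simp add: field_simps)
  also have "\<bar>\<dots>\<bar> \<le> stability_const * sqrt r"
    using a assms(2) by (simp add: abs_divide divide_le_eq)
  finally show ?thesis .
qed

end

end

section \<open>Test functions that concentrate on the inclusion\<close>

text \<open>Integrate \<open>n\<close> times from \<open>0\<close>; each integration over \<open>[- R, R]\<close> costs at most a factor \<open>R\<close>.\<close>

lemma iterated_antiderivative:
  assumes f: "smooth_real f" "\<And>t. \<bar>t\<bar> \<le> R \<Longrightarrow> \<bar>f t\<bar> \<le> B" and R: "R \<ge> 1"
  shows "\<exists>F. smooth_real F \<and> (deriv ^^ n) F = f \<and>
    (\<forall>l\<le>n. \<forall>t. \<bar>t\<bar> \<le> R \<longrightarrow> \<bar>(deriv ^^ l) F t\<bar> \<le> B * R ^ n)"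
proof (induction n)
  case 0
  show ?case
    using f by (intro exI[of _ f]) auto
next
  case (Suc n)
  then obtain F where F: "smooth_real F" "(deriv ^^ n) F = f"
    "\<And>l t. l \<le> n \<Longrightarrow> \<bar>t\<bar> \<le> R \<Longrightarrow> \<bar>(deriv ^^ l) F t\<bar> \<le> B * R ^ n"
    by blast
  have B: "B \<ge> 0"
    using f(2)[of 0] R by simp
  obtain H where H: "smooth_real H" "\<And>x. (H has_real_derivative F x) (at x)" "H 0 = 0"
    using smooth_real_antiderivative_exists[OF F(1)] by blast
  have dH: "deriv H = F"
    using H(2) by (auto intro: DERIV_imp_deriv)
  have shift: "(deriv ^^ Suc l) H = (deriv ^^ l) F" for l
    by (simp add: funpow_swap1 dH)
  have "\<bar>(deriv ^^ l) H t\<bar> \<le> B * R ^ Suc n" if "l \<le> Suc n" "\<bar>t\<bar> \<le> R" for l t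
  proof (cases l)
    case 0
    have "norm (H t - H 0) \<le> B * R ^ n * norm (t - 0)"
    proof (rule field_differentiable_bound[of "{-R..R}"])
      show "(H has_field_derivative F z) (at z within {-R..R})" for z
        using H(2) has_field_derivative_at_within by blast
      show "norm (F z) \<le> B * R ^ n" if "z \<in> {-R..R}" for z
        using F(3)[of 0 z] that by (simp add: abs_le_iff)
    qed (use that R in \<open>auto simp: abs_le_iff\<close>)
    also have "\<dots> \<le> B * R ^ n * R"
      using that B R by (intro mult_left_mono) auto
    finally show ?thesis
      using 0 H(3) by (simp add: mult_ac)
  next
    case (Suc k)
    have "\<bar>(deriv ^^ l) H t\<bar> \<le> B * R ^ n"
      unfolding Suc shift using that Suc by (intro F(3)) auto
    also have "\<dots> \<le> B * R ^ Suc n"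
      using B R by (intro mult_left_mono power_increasing) auto
    finally show ?thesis .
  qed
  with H(1) F(2) shift show ?case
    by (intro exI[of _ H]) auto
qed

text \<open>The antiderivative that vanishes at \<open>0\<close> is constant beyond the support of the cutoff.\<close>

lemma cutoff_antiderivative:
  assumes d: "d > 0"
  obtains Q where "smooth_real Q" "\<And>x. (Q has_real_derivative cutoff d x) (at x)" "\<And>x. \<bar>Q x\<bar> \<le> 1 + d"
proof -
  obtain Q where Q: "smooth_real Q" "\<And>x. (Q has_real_derivative cutoff d x) (at x)" "Q 0 = 0"
    using smooth_real_antiderivative_exists[OF cutoff_smooth[OF d]] by blast
  have in': "\<bar>Q x\<bar> \<le> 1 + d" if "\<bar>x\<bar> \<le> 1 + d" for x
  proof -
    have "norm (Q x - Q 0) \<le> 1 * norm (x - 0)"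
    proof (rule field_differentiable_bound[of UNIV])
      show "norm (cutoff d z) \<le> 1" for z
        using cutoff_bounds[of d z] by simp
    qed (use Q in auto)
    then show ?thesis
      using that Q(3) by simp
  qed
  have const: "Q y = Q x" if "x < y" "\<And>z. x < z \<Longrightarrow> z < y \<Longrightarrow> \<bar>z\<bar> \<ge> 1 + d" for x y
  proof (rule DERIV_isconst2[OF that(1)])
    show "continuous_on {x..y} Q"
      using smooth_real_continuous[OF Q(1), of _ 0] by simp
    show "(Q has_real_derivative 0) (at z)" if "x < z" "z < y" for z
      using Q(2)[of z] cutoff_0[OF d, of z] that \<open>\<And>z. x < z \<Longrightarrow> z < y \<Longrightarrow> \<bar>z\<bar> \<ge> 1 + d\<close>[of z] by simp
  qed (use that in auto)
  have "\<bar>Q x\<bar> \<le> 1 + d" for x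
  proof -
    consider "\<bar>x\<bar> \<le> 1 + d" | "x > 1 + d" | "x < - (1 + d)" by linarith
    then show ?thesis
    proof cases
      case 2
      have "Q x = Q (1 + d)"
        using 2 d by (intro const) auto
      then show ?thesis using in'[of "1 + d"] d by simp
    next
      case 3
      have "Q (- (1 + d)) = Q x"
        using 3 d by (intro const) auto
      then show ?thesis using in'[of "- (1 + d)"] d by simp
    qed (rule in')
  qed
  with Q that show thesis by blast
qed

text \<open>The first integration of the tall cutoff is done on the whole line, where the antiderivative is
  bounded independently of \<open>e\<close>; the remaining \<open>m - 1\<close> integrations take place on \<open>[- 2, 2]\<close>.\<close>

lemma transversal_profile:
  assumes d: "d > 0" and m: "m > 0" and e: "e > 0"
  obtains p where "smooth_real p" "(deriv ^^ m) p = (\<lambda>t. cutoff d (t / e) / e)"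
    "\<And>l t. l < m \<Longrightarrow> \<bar>t\<bar> \<le> 2 \<Longrightarrow> \<bar>(deriv ^^ l) p t\<bar> \<le> (1 + d) * 2 ^ (m - 1)"
proof -
  obtain Q where Q: "smooth_real Q" "\<And>x. (Q has_real_derivative cutoff d x) (at x)" "\<And>x. \<bar>Q x\<bar> \<le> 1 + d"
    using cutoff_antiderivative[OF d] by blast
  have "smooth_real (\<lambda>t. Q (1 / e * t))"
    by (rule smooth_real_scale[OF Q(1)])
  then obtain p where p: "smooth_real p" "(deriv ^^ (m - 1)) p = (\<lambda>t. Q (1 / e * t))"
    "\<forall>l\<le>m - 1. \<forall>t. \<bar>t\<bar> \<le> 2 \<longrightarrow> \<bar>(deriv ^^ l) p t\<bar> \<le> (1 + d) * 2 ^ (m - 1)"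
    using iterated_antiderivative[of "\<lambda>t. Q (1 / e * t)" 2 "1 + d" "m - 1"] Q(3) by auto
  have "deriv (\<lambda>t. Q (1 / e * t)) t = cutoff d (t / e) / e" for t
  proof (rule DERIV_imp_deriv)
    have "((\<lambda>t. Q (1 / e * t)) has_real_derivative cutoff d (1 / e * t) * (1 / e)) (at t)"
      by (rule DERIV_chain'[where g = Q]) (use Q(2) e in \<open>auto intro!: derivative_eq_intros\<close>)
    then show "((\<lambda>t. Q (1 / e * t)) has_real_derivative cutoff d (t / e) / e) (at t)"
      by simp
  qed
  moreover have "(deriv ^^ m) p = deriv ((deriv ^^ (m - 1)) p)"
    using m by (cases m) auto
  ultimately have "(deriv ^^ m) p = (\<lambda>t. cutoff d (t / e) / e)"
    using p(2) by auto
  then show thesis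
    using that[OF p(1)] p(3) m by force
qed

lemma cutoff_deriv_0:
  assumes "0 < d" "d \<le> 1" "\<bar>t\<bar> > 2"
  shows "(deriv ^^ n) (cutoff d) t = 0"
  using cutoff_0[OF assms(1)] assms by (intro higher_deriv_zero_outside[of 2]) auto

lemma cutoff_deriv_bounded:
  assumes d: "0 < d" "d \<le> 1"
  obtains K where "K \<ge> 1" "\<And>l t. l \<le> m \<Longrightarrow> \<bar>(deriv ^^ l) (cutoff d) t\<bar> \<le> K"
proof -
  have "\<exists>K. \<forall>t. \<bar>(deriv ^^ l) (cutoff d) t\<bar> \<le> K" for l
  proof -
    have "bounded ((deriv ^^ l) (cutoff d) ` {-2..2})"
      by (intro compact_imp_bounded compact_continuous_image smooth_real_continuous cutoff_smooth d) auto
    then obtain K where K: "K > 0" "\<And>t. t \<in> {-2..2} \<Longrightarrow> \<bar>(deriv ^^ l) (cutoff d) t\<bar> \<le> K"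
      by (auto simp: bounded_pos)
    have "\<bar>(deriv ^^ l) (cutoff d) t\<bar> \<le> K" for t
      using K cutoff_deriv_0[OF d, of t l] by (cases "t \<in> {-2..2}") auto
    then show ?thesis by blast
  qed
  then obtain K where K: "\<And>l t. \<bar>(deriv ^^ l) (cutoff d) t\<bar> \<le> K l"
    by metis
  have K0: "K l \<ge> 0" for l
    using K[of l 0] by linarith
  have "K l \<le> 1 + (\<Sum>l\<le>m. K l)" if "l \<le> m" for l
    using member_le_sum[of l "{..m}" K] that K0 by auto
  then show thesis
    using K K0 order_trans by (intro that[of "1 + (\<Sum>l\<le>m. K l)"]) (auto intro: sum_nonneg, blast)
qed

text \<open>At scale \<open>e\<close> the inclusion has length of order \<open>1\<close> and thickness of order \<open>e\<close>.  An \<open>m\<close>-fold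
  transversal antiderivative of a cutoff of width \<open>e\<close> and height \<open>1 / e\<close> has bounded derivatives of
  order less than \<open>m\<close>; so cutting it off at distance of order \<open>1\<close> costs only bounded terms.  After
  scaling back, these are of order \<open>e\<close>, while the derivative of order \<open>m\<close> of the profile itself is of
  order \<open>1\<close>.\<close>

lemma concentrating_functions:
  assumes d: "0 < d" "d \<le> 1" and m: "m > 0"
  obtains C where "C \<ge> 0" "\<And>e. e > 0 \<Longrightarrow> \<exists>f g. smooth_real f \<and> smooth_real g \<and>
     (\<forall>s. \<bar>s\<bar> > 2 * e \<longrightarrow> f s = 0) \<and> (\<forall>t. \<bar>t\<bar> > 2 * e \<longrightarrow> g t = 0) \<and>
     (\<forall>a b s t. a + b = m \<longrightarrow>
        \<bar>(deriv ^^ a) f s * (deriv ^^ b) g t -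
          (if a = 0 then cutoff d (s / e) * (cutoff d (t / e) * cutoff d (t / e\<^sup>2)) else 0)\<bar> \<le> C * e)"
proof -
  obtain K where K: "K \<ge> 1" "\<And>l t. l \<le> m \<Longrightarrow> \<bar>(deriv ^^ l) (cutoff d) t\<bar> \<le> K"
    using cutoff_deriv_bounded[OF d] by blast
  define L where "L = (1 + d) * 2 ^ (m - 1)"
  define C where "C = K * (2 ^ m * (L * K))"
  have L: "L \<ge> 0"
    using d by (simp add: L_def)
  have qs: "smooth_real (cutoff d)"
    using d by (intro cutoff_smooth)
  show thesis
  proof (rule that[of C])
    show "C \<ge> 0"
      using K L by (simp add: C_def)
    fix e :: real assume e: "e > 0"
    obtain p where p: "smooth_real p" "(deriv ^^ m) p = (\<lambda>t. cutoff d (t / e) / e)"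
      "\<And>l t. l < m \<Longrightarrow> \<bar>t\<bar> \<le> 2 \<Longrightarrow> \<bar>(deriv ^^ l) p t\<bar> \<le> L"
      using transversal_profile[OF d(1) m e] unfolding L_def by blast
    \<comment> \<open>By the Leibniz rule, the only derivative of \<open>p\<close> in \<open>h\<^sup>(\<^sup>b\<^sup>)\<close>, \<open>b \<le> m\<close>, that is not bounded
      uniformly in \<open>e\<close> is \<open>p\<^sup>(\<^sup>m\<^sup>)\<close>; it occurs only for \<open>b = m\<close>, without a derivative on the cutoff.\<close>
    define h where "h t = p t * cutoff d t" for t
    have hs: "smooth_real h"
      unfolding h_def[abs_def] by (rule smooth_real_mult[OF p(1) qs])
    have h0: "(deriv ^^ b) h t = 0" if "\<bar>t\<bar> > 2" for b t
      using that cutoff_0[OF d(1)] d(2) by (intro higher_deriv_zero_outside[of 2]) (auto simp: h_def)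
    have lower: "\<bar>\<Sum>k\<in>I. real (b choose k) * (deriv ^^ k) p t * (deriv ^^ (b - k)) (cutoff d) t\<bar> \<le> 2 ^ m * (L * K)"
      if I: "I \<subseteq> {..<m}" "I \<subseteq> {..b}" and b: "b \<le> m" and t: "\<bar>t\<bar> \<le> 2" for I b t
    proof -
      have "\<bar>\<Sum>k\<in>I. real (b choose k) * (deriv ^^ k) p t * (deriv ^^ (b - k)) (cutoff d) t\<bar>
          \<le> (\<Sum>k\<in>I. real (b choose k) * (L * K))"
      proof (rule order_trans[OF sum_abs sum_mono])
        fix k assume k: "k \<in> I"
        have "\<bar>(deriv ^^ k) p t\<bar> * \<bar>(deriv ^^ (b - k)) (cutoff d) t\<bar> \<le> L * K"
          using k I b t L by (intro mult_mono p(3) K(2)) auto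
        then show "\<bar>real (b choose k) * (deriv ^^ k) p t * (deriv ^^ (b - k)) (cutoff d) t\<bar> \<le> real (b choose k) * (L * K)"
          by (simp add: abs_mult mult.assoc mult_left_mono)
      qed
      also have "\<dots> \<le> (\<Sum>k\<le>b. real (b choose k) * (L * K))"
        using I L K by (intro sum_mono2) auto
      also have "\<dots> = 2 ^ b * (L * K)"
        using choose_row_sum[of b] by (simp add: sum_distrib_right[symmetric] flip: of_nat_sum)
      also have "\<dots> \<le> 2 ^ m * (L * K)"
        using b L K by (intro mult_right_mono power_increasing) auto
      finally show ?thesis .
    qed
    have h_small: "\<bar>(deriv ^^ b) h t\<bar> \<le> 2 ^ m * (L * K)" if "b < m" for b t
    proof (cases "\<bar>t\<bar> \<le> 2")
      case True
      then show ?thesis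
        unfolding h_def[abs_def] higher_deriv_mult_real[OF p(1) qs] using that by (intro lower) auto
    qed (use h0 L K in auto)
    have h_main: "\<bar>(deriv ^^ m) h t - cutoff d t * cutoff d (t / e) / e\<bar> \<le> 2 ^ m * (L * K)" for t
    proof (cases "\<bar>t\<bar> \<le> 2")
      case True
      have "(deriv ^^ m) h t = (\<Sum>k\<in>{..<m}. real (m choose k) * (deriv ^^ k) p t * (deriv ^^ (m - k)) (cutoff d) t)
          + cutoff d t * cutoff d (t / e) / e"
        unfolding h_def[abs_def] higher_deriv_mult_real[OF p(1) qs] p(2)[symmetric]
        by (simp add: lessThan_Suc_atMost[symmetric] p(2))
      then show ?thesis
        using lower[of "{..<m}" m t] True by (simp add: subset_iff)
    next
      case False
      then have "cutoff d t = 0"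
        using d by (intro cutoff_0) auto
      then show ?thesis
        using False h0[of t m] L K by simp
    qed
    \<comment> \<open>The rescaling costs \<open>1 / e\<close> per derivative, hence \<open>e\<^sup>-\<^sup>m\<close> in total; the factor
      \<open>e\<^sup>m\<^sup>+\<^sup>1\<close> leaves one power of \<open>e\<close>, which the height \<open>1 / e\<close> of \<open>p\<^sup>(\<^sup>m\<^sup>)\<close> compensates.\<close>
    define f where "f s = e ^ (m + 1) * cutoff d (1 / e * s)" for s
    define g where "g t = 1 * h (1 / e * t)" for t
    have fs: "smooth_real f"
      unfolding f_def[abs_def] by (intro smooth_real_cmult smooth_real_scale qs)
    have gs: "smooth_real g"
      unfolding g_def[abs_def] by (intro smooth_real_cmult smooth_real_scale hs)
    have scale: "(deriv ^^ a) f s * (deriv ^^ b) g t = e * ((deriv ^^ a) (cutoff d) (s / e) * (deriv ^^ b) h (t / e))"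
      if "a + b = m" for a b s t
    proof -
      have "e ^ (m + 1) * (1 / e) ^ a * (1 / e) ^ b = e"
        using e by (simp add: that[symmetric] power_add field_simps)
      then have "e ^ (m + 1) * (1 / e) ^ a * x * (1 * (1 / e) ^ b * y) = e * (x * y)" for x y
        by (metis (no_types, lifting) mult.assoc mult.commute mult_1)
      then show ?thesis
        unfolding f_def[abs_def] g_def[abs_def] higher_deriv_scale[OF qs] higher_deriv_scale[OF hs]
        by simp
    qed
    have f0: "f s = 0" if "\<bar>s\<bar> > 2 * e" for s
    proof -
      have "\<bar>s / e\<bar> > 2"
        using that e by (simp add: abs_divide field_simps)
      then show ?thesis
        using cutoff_0[OF d(1), of "s / e"] d by (simp add: f_def)
    qed
    have g0: "g t = 0" if "\<bar>t\<bar> > 2 * e" for t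
    proof -
      have "\<bar>t / e\<bar> > 2"
        using that e by (simp add: abs_divide field_simps)
      then show ?thesis
        using h0[of "t / e" 0] by (simp add: g_def)
    qed
    have "\<bar>(deriv ^^ a) f s * (deriv ^^ b) g t -
          (if a = 0 then cutoff d (s / e) * (cutoff d (t / e) * cutoff d (t / e\<^sup>2)) else 0)\<bar> \<le> C * e"
      if ab: "a + b = m" for a b s t
    proof (cases "a = 0")
      case True
      then have b: "b = m" using ab by simp
      have "(deriv ^^ a) f s * (deriv ^^ b) g t - cutoff d (s / e) * (cutoff d (t / e) * cutoff d (t / e\<^sup>2)) =
         e * (cutoff d (s / e) * ((deriv ^^ m) h (t / e) - cutoff d (t / e) * cutoff d (t / e / e) / e))"
        unfolding scale[OF ab] using True b e by (simp add: right_diff_distrib power2_eq_square)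
      also have "\<bar>\<dots>\<bar> = e * (\<bar>cutoff d (s / e)\<bar> * \<bar>(deriv ^^ m) h (t / e) - cutoff d (t / e) * cutoff d (t / e / e) / e\<bar>)"
        using e by (simp add: abs_mult)
      also have "\<dots> \<le> e * (K * (2 ^ m * (L * K)))"
        using e K(1) K(2)[of 0] h_main[of "t / e"] by (intro mult_left_mono mult_mono) auto
      finally show ?thesis
        using True by (simp add: C_def mult_ac)
    next
      case False
      have "\<bar>(deriv ^^ a) f s * (deriv ^^ b) g t\<bar> = e * (\<bar>(deriv ^^ a) (cutoff d) (s / e)\<bar> * \<bar>(deriv ^^ b) h (t / e)\<bar>)"
        unfolding scale[OF ab] using e by (simp add: abs_mult)
      also have "\<dots> \<le> e * (K * (2 ^ m * (L * K)))"
        using e K(1) K(2)[of a] h_small[of b] False ab by (intro mult_left_mono mult_mono) auto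
      finally show ?thesis
        using False by (simp add: C_def mult_ac)
    qed
    with fs gs f0 g0 show "\<exists>f g. smooth_real f \<and> smooth_real g \<and>
     (\<forall>s. \<bar>s\<bar> > 2 * e \<longrightarrow> f s = 0) \<and> (\<forall>t. \<bar>t\<bar> > 2 * e \<longrightarrow> g t = 0) \<and>
     (\<forall>a b s t. a + b = m \<longrightarrow>
        \<bar>(deriv ^^ a) f s * (deriv ^^ b) g t -
          (if a = 0 then cutoff d (s / e) * (cutoff d (t / e) * cutoff d (t / e\<^sup>2)) else 0)\<bar> \<le> C * e)"
      by blast
  qed
qed

section \<open>Approximation of the indicator of the thin inclusion\<close>

lemma norm_plane_le: "norm (x :: real^2) \<le> \<bar>x $ 1\<bar> + \<bar>x $ 2\<bar>"
  using norm_le_l1_cart[of x] by (simp add: sum_2)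

lemma core_segment_eq: "core_segment 0 (axis 1 1) e = {z. z $ 2 = 0 \<and> \<bar>z $ 1\<bar> \<le> e}"
proof (intro set_eqI iffI)
  fix z :: "real^2"
  assume "z \<in> {z. z $ 2 = 0 \<and> \<bar>z $ 1\<bar> \<le> e}"
  then have "z = 0 + z $ 1 *\<^sub>R axis 1 1" "- e \<le> z $ 1" "z $ 1 \<le> e"
    by (auto simp: vec_eq_iff forall_2 axis_def)
  then show "z \<in> core_segment 0 (axis 1 1) e"
    unfolding core_segment_def by blast
qed (auto simp: core_segment_def axis_def)

lemma inclusion_open: "open (inclusion y \<tau> e)"
  unfolding inclusion_def by (intro open_Collect_less continuous_intros)

lemma inclusion_superset:
  assumes "e > 0" "\<bar>x $ 1\<bar> \<le> e" "\<bar>x $ 2\<bar> < e\<^sup>2"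
  shows "x \<in> inclusion 0 (axis 1 1) e"
proof -
  define z :: "real^2" where "z = vector [x $ 1, 0]"
  have "z \<in> core_segment 0 (axis 1 1) e"
    using assms by (simp add: core_segment_eq z_def)
  then have "infdist x (core_segment 0 (axis 1 1) e) \<le> dist x z"
    by (rule infdist_le)
  also have "\<dots> \<le> \<bar>x $ 2\<bar>"
    using norm_plane_le[of "x - z"] by (simp add: dist_norm z_def)
  finally show ?thesis
    using assms by (simp add: inclusion_def)
qed

lemma inclusion_subset:
  assumes "e > 0" "x \<in> inclusion 0 (axis 1 1) e"
  shows "\<bar>x $ 1\<bar> < e + e\<^sup>2" "\<bar>x $ 2\<bar> < e\<^sup>2"
proof -
  have ne: "core_segment 0 (axis 1 1) e \<noteq> ({} :: (real^2) set)"
    using assms(1) by (auto simp: core_segment_eq intro!: exI[of _ 0])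
  have "infdist x (core_segment 0 (axis 1 1) e) < e\<^sup>2"
    using assms by (simp add: inclusion_def)
  then obtain z where z: "z \<in> core_segment 0 (axis 1 1) e" "dist x z < e\<^sup>2"
    unfolding infdist_notempty[OF ne] by (subst (asm) cINF_less_iff[OF ne]) (auto intro!: bdd_belowI2[of _ 0])
  have "\<bar>(x - z) $ 1\<bar> < e\<^sup>2" "\<bar>(x - z) $ 2\<bar> < e\<^sup>2"
    using z(2) component_le_norm_cart[of "x - z" 1] component_le_norm_cart[of "x - z" 2] by (auto simp: dist_norm)
  then show "\<bar>x $ 1\<bar> < e + e\<^sup>2" "\<bar>x $ 2\<bar> < e\<^sup>2"
    using z(1) by (auto simp: core_segment_eq)
qed

definition rect :: "real \<Rightarrow> real \<Rightarrow> (real^2) set" where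
  "rect a b = cbox (vector [- a, - b]) (vector [a, b])"

definition open_rect :: "real \<Rightarrow> real \<Rightarrow> (real^2) set" where
  "open_rect a b = box (vector [- a, - b]) (vector [a, b])"

lemma in_rect: "x \<in> rect a b \<longleftrightarrow> \<bar>x $ 1\<bar> \<le> a \<and> \<bar>x $ 2\<bar> \<le> b"
  by (auto simp: rect_def mem_box_cart forall_2)

lemma in_open_rect: "x \<in> open_rect a b \<longleftrightarrow> \<bar>x $ 1\<bar> < a \<and> \<bar>x $ 2\<bar> < b"
  by (auto simp: open_rect_def mem_box_cart forall_2)

lemma measure_rect:
  assumes "a \<ge> 0" "b \<ge> 0"
  shows "measure lebesgue (rect a b) = 4 * a * b" "measure lebesgue (open_rect a b) = 4 * a * b"
proof -
  have "rect a b \<noteq> {}"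
    using in_rect[of 0 a b] assms by auto
  then show 1: "measure lebesgue (rect a b) = 4 * a * b"
    unfolding rect_def by (simp add: content_cbox_cart UNIV_2)
  have "measure lebesgue (open_rect a b) = measure lebesgue (rect a b)"
    unfolding rect_def open_rect_def by (simp add: measure_lborel_box_eq measure_lborel_cbox_eq)
  with 1 show "measure lebesgue (open_rect a b) = 4 * a * b"
    by simp
qed

lemma rect_lmeasurable: "rect a b \<in> lmeasurable" "open_rect a b \<in> lmeasurable"
  by (simp_all add: rect_def open_rect_def)

lemma inclusion_measure:
  assumes "e > 0"
  shows "4 * e ^ 3 \<le> measure lebesgue (inclusion 0 (axis 1 1) e)"
proof -
  have sub: "open_rect e (e\<^sup>2) \<subseteq> inclusion 0 (axis 1 1) e"
    using inclusion_superset[OF assms] by (auto simp: in_open_rect)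
  have "bounded (inclusion 0 (axis 1 1) e)"
  proof (rule bounded_subset)
    show "bounded (rect (e + e\<^sup>2) (e\<^sup>2))"
      by (simp add: rect_def)
    show "inclusion 0 (axis 1 1) e \<subseteq> rect (e + e\<^sup>2) (e\<^sup>2)"
      using inclusion_subset[OF assms] by (auto simp: in_rect less_imp_le)
  qed
  then have "inclusion 0 (axis 1 1) e \<in> lmeasurable"
    using inclusion_open by (rule lmeasurable_open)
  then have "measure lebesgue (open_rect e (e\<^sup>2)) \<le> measure lebesgue (inclusion 0 (axis 1 1) e)"
    using sub rect_lmeasurable by (intro measure_mono_fmeasurable) auto
  then show ?thesis
    using assms measure_rect(2)[of e "e\<^sup>2"] by (simp add: power2_eq_square power3_eq_cube)
qed

lemma count_list_1_2: "count_list i (1::2) + count_list i 2 = length i"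
proof (induction i)
  case (Cons a i)
  then show ?case using exhaust_2[of a] by auto
qed simp

lemma count_list_1_eq_0: "count_list i (1::2) = 0 \<longleftrightarrow> i = replicate (length i) 2"
proof (induction i)
  case (Cons a i)
  then show ?case using exhaust_2[of a] by auto
qed simp

lemma square_add_le: "(a + b)\<^sup>2 \<le> 2 * a\<^sup>2 + 2 * (b::real)\<^sup>2"
  using zero_le_power2[of "a - b"] by (simp add: power2_eq_square algebra_simps)

text \<open>There are two sources of error.  The terms of order \<open>e\<close> live on a square of side \<open>4 * e\<close> and
  contribute at most a multiple of \<open>e\<^sup>4\<close>.  The smoothed indicator and the indicator of the inclusion
  differ by at most \<open>1\<close>, and only between two rectangles that differ by the factor \<open>1 + d\<close> in
  both directions; their areas differ by at most \<open>12 * d * e\<^sup>3\<close>.  Both are divided by the measure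
  of the inclusion, which is at least \<open>4 * e\<^sup>3\<close>.  Only for \<open>e \<le> d\<close> are the rounded ends of the
  inclusion contained in the larger rectangle.\<close>

lemma test_functions_near_inclusion:
  assumes d: "0 < d" "d \<le> 1" and m: "m > 0"
  obtains C where "C \<ge> 0" "\<And>e U. 0 < e \<Longrightarrow> e \<le> d \<Longrightarrow> open U \<Longrightarrow> rect (2 * e) (2 * e) \<subseteq> U \<Longrightarrow>
    \<exists>f g. smooth_real f \<and> smooth_real g \<and> separated f g \<in> test_functions U \<and>
      (\<forall>j\<in>multi_indices m. integral\<^sup>L (lebesgue_on U) (\<lambda>x. (iter_partial j (separated f g) x -
           (if j = replicate m 2 then indicator (inclusion 0 (axis 1 1) e) x else 0))\<^sup>2)
         \<le> (C * e + 6 * d) * measure lebesgue (inclusion 0 (axis 1 1) e))"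
proof -
  obtain C where C: "C \<ge> 0" "\<And>e. e > 0 \<Longrightarrow> \<exists>f g. smooth_real f \<and> smooth_real g \<and>
     (\<forall>s. \<bar>s\<bar> > 2 * e \<longrightarrow> f s = 0) \<and> (\<forall>t. \<bar>t\<bar> > 2 * e \<longrightarrow> g t = 0) \<and>
     (\<forall>a b s t. a + b = m \<longrightarrow>
        \<bar>(deriv ^^ a) f s * (deriv ^^ b) g t -
          (if a = 0 then cutoff d (s / e) * (cutoff d (t / e) * cutoff d (t / e\<^sup>2)) else 0)\<bar> \<le> C * e)"
    using concentrating_functions[OF d m] by blast
  show thesis
  proof (rule that[of "8 * C\<^sup>2"])
    fix e :: real and U :: "(real^2) set"
    assume e: "0 < e" "e \<le> d" and U: "open U" "rect (2 * e) (2 * e) \<subseteq> U"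
    let ?D = "inclusion 0 (axis 1 1) e"
    obtain f g where fg: "smooth_real f" "smooth_real g"
      "\<And>s. \<bar>s\<bar> > 2 * e \<Longrightarrow> f s = 0" "\<And>t. \<bar>t\<bar> > 2 * e \<Longrightarrow> g t = 0"
      "\<And>a b s t. a + b = m \<Longrightarrow>
        \<bar>(deriv ^^ a) f s * (deriv ^^ b) g t -
          (if a = 0 then cutoff d (s / e) * (cutoff d (t / e) * cutoff d (t / e\<^sup>2)) else 0)\<bar> \<le> C * e"
      using C(2)[OF e(1)] by blast
    define w where "w = separated f g"
    have test: "w \<in> test_functions U"
      unfolding w_def
    proof (rule separated_test_function[OF fg(1,2), of "- (2 * e)" "2 * e" "- (2 * e)" "2 * e"])
      show "{x. x $ 1 \<in> {- (2 * e)..2 * e} \<and> x $ 2 \<in> {- (2 * e)..2 * e}} \<subseteq> U"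
        using U(2) by (auto simp: in_rect subset_iff abs_le_iff)
    qed (use fg(3,4) in \<open>auto simp: abs_if\<close>)
    define B2 where "B2 = rect (2 * e) (2 * e)"
    define Bo where "Bo = rect ((1 + d) * e) ((1 + d) * e\<^sup>2)"
    define Bi where "Bi = open_rect e (e\<^sup>2)"
    have e2: "0 < e\<^sup>2" "e\<^sup>2 \<le> e" "e\<^sup>2 \<le> d * e"
      using e d by (auto simp: power2_eq_square)
    have big: "e + e\<^sup>2 \<le> (1 + d) * e" "e\<^sup>2 \<le> (1 + d) * e\<^sup>2"
      using e2 d by (simp_all add: distrib_right)
    have sub: "Bi \<subseteq> ?D" "?D \<subseteq> Bo"
    proof -
      show "Bi \<subseteq> ?D"
        using inclusion_superset[OF e(1)] by (auto simp: Bi_def in_open_rect)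
      show "?D \<subseteq> Bo"
      proof
        fix x assume "x \<in> ?D"
        then show "x \<in> Bo"
          unfolding Bo_def in_rect using inclusion_subset[OF e(1), of x] big by linarith
      qed
    qed
    then have BiBo: "Bi \<subseteq> Bo" by blast
    define F where "F x = 2 * (C * e)\<^sup>2 * indicat_real B2 x + 2 * (indicat_real Bo x - indicat_real Bi x)" for x
    have F_int: "integrable lebesgue F"
      unfolding F_def[abs_def] B2_def Bo_def Bi_def using rect_lmeasurable
      by (intro Bochner_Integration.integrable_add Bochner_Integration.integrable_diff integrable_mult_right)
         (simp_all add: lmeasurable_iff_integrable)
    have F_val: "integral\<^sup>L lebesgue F = 2 * (C * e)\<^sup>2 * (4 * (2 * e) * (2 * e)) +
        2 * (4 * ((1 + d) * e) * ((1 + d) * e\<^sup>2) - 4 * e * e\<^sup>2)"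
    proof -
      have i: "integrable lebesgue (indicat_real (rect a b))" "integrable lebesgue (indicat_real (open_rect a b))" for a b
        using rect_lmeasurable by (simp_all add: lmeasurable_iff_integrable)
      have "integral\<^sup>L lebesgue F = 2 * (C * e)\<^sup>2 * measure lebesgue B2 + 2 * (measure lebesgue Bo - measure lebesgue Bi)"
        unfolding F_def[abs_def] B2_def Bo_def Bi_def using i by simp
      then show ?thesis
        unfolding B2_def Bo_def Bi_def using e d measure_rect by simp
    qed
    also have "\<dots> \<le> (8 * C\<^sup>2 * e + 6 * d) * (4 * e ^ 3)"
    proof -
      have "2 * (4 * ((1 + d) * e) * ((1 + d) * e\<^sup>2) - 4 * e * e\<^sup>2) = 8 * (2 * d + d * d) * e ^ 3"
        by (simp add: power2_eq_square power3_eq_cube algebra_simps)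
      also have "\<dots> \<le> 8 * (2 * d + 1 * d) * e ^ 3"
        using d e by (intro mult_right_mono mult_left_mono add_left_mono) auto
      finally show ?thesis
        by (simp add: power2_eq_square power3_eq_cube algebra_simps)
    qed
    also have "\<dots> \<le> (8 * C\<^sup>2 * e + 6 * d) * measure lebesgue ?D"
      using inclusion_measure[OF e(1)] e d by (intro mult_left_mono) auto
    finally have F_le: "integral\<^sup>L lebesgue F \<le> (8 * C\<^sup>2 * e + 6 * d) * measure lebesgue ?D" .
    have "integral\<^sup>L (lebesgue_on U) (\<lambda>x. (iter_partial j w x -
           (if j = replicate m 2 then indicator ?D x else 0))\<^sup>2)
         \<le> (8 * C\<^sup>2 * e + 6 * d) * measure lebesgue ?D" if j: "j \<in> multi_indices m" for j
    proof -
      define err where "err x = iter_partial j w x - (if j = replicate m 2 then indicator ?D x else 0)" for x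
      define main where "main x = (if j = replicate m 2 then cutoff d (x $ 1 / e) * (cutoff d (x $ 2 / e) * cutoff d (x $ 2 / e\<^sup>2)) else 0)" for x :: "real^2"
      have ab: "count_list j 1 + count_list j 2 = m" and a0: "count_list j 1 = 0 \<longleftrightarrow> j = replicate m 2"
        using count_list_1_2[of j] count_list_1_eq_0[of j] j by (auto simp: multi_indices_def)
      have iter: "iter_partial j w x = (deriv ^^ count_list j 1) f (x $ 1) * (deriv ^^ count_list j 2) g (x $ 2)" for x
        unfolding w_def iter_partial_separated[OF fg(1,2)] by (simp add: separated_def)
      have e1: "(iter_partial j w x - main x)\<^sup>2 \<le> (C * e)\<^sup>2 * indicator B2 x" for x
      proof (cases "x \<in> B2")
        case True
        have "\<bar>iter_partial j w x - main x\<bar> \<le> C * e"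
          unfolding iter main_def a0[symmetric] using fg(5)[OF ab] .
        then show ?thesis
          using True power_mono[of "\<bar>iter_partial j w x - main x\<bar>" "C * e" 2] by simp
      next
        case False
        then have out: "\<bar>x $ 1\<bar> > 2 * e \<or> \<bar>x $ 2\<bar> > 2 * e"
          by (auto simp: B2_def in_rect)
        then have "iter_partial j w x = 0"
          unfolding iter using higher_deriv_zero_outside[OF fg(3)] higher_deriv_zero_outside[OF fg(4)] by fastforce
        moreover have "main x = 0"
        proof -
          have "\<bar>x $ 1 / e\<bar> \<ge> 1 + d \<or> \<bar>x $ 2 / e\<bar> \<ge> 1 + d"
            using out e d by (auto simp: abs_divide field_simps intro: order_trans[of _ "2 * e"])
          then show ?thesis
            using cutoff_0[OF d(1)] by (auto simp: main_def)
        qed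
        ultimately show ?thesis
          using False by simp
      qed
      have e2': "(main x - (if j = replicate m 2 then indicator ?D x else 0))\<^sup>2 \<le> indicat_real Bo x - indicat_real Bi x" for x
      proof (cases "j = replicate m 2")
        case J: True
        have main01: "0 \<le> main x" "main x \<le> 1"
          using cutoff_bounds by (auto simp: main_def intro!: mult_le_one)
        consider "x \<in> Bi" | "x \<notin> Bo" | "x \<in> Bo" "x \<notin> Bi" by blast
        then show ?thesis
        proof cases
          case 1
          then have x: "\<bar>x $ 1\<bar> \<le> e" "\<bar>x $ 2\<bar> \<le> e\<^sup>2"
            by (auto simp: Bi_def in_open_rect)
          then have "\<bar>x $ 1 / e\<bar> \<le> 1" "\<bar>x $ 2 / e\<bar> \<le> 1" "\<bar>x $ 2 / e\<^sup>2\<bar> \<le> 1"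
            using e e2 by (auto simp: abs_divide)
          then have "main x = 1"
            using cutoff_1[OF d(1)] J by (simp add: main_def)
          then show ?thesis
            using 1 sub BiBo J by (auto simp: indicator_def)
        next
          case 2
          then have "(1 + d) * e < \<bar>x $ 1\<bar> \<or> (1 + d) * e\<^sup>2 < \<bar>x $ 2\<bar>"
            by (auto simp: Bo_def in_rect)
          then have "\<bar>x $ 1 / e\<bar> \<ge> 1 + d \<or> \<bar>x $ 2 / e\<^sup>2\<bar> \<ge> 1 + d"
            using e(1) by (auto simp: abs_divide pos_le_divide_eq intro: less_imp_le)
          then have "main x = 0"
            using cutoff_0[OF d(1)] by (auto simp: main_def)
          then show ?thesis
            using 2 sub BiBo by (auto simp: indicator_def)
        next
          case 3
          have "\<bar>main x - indicator ?D x\<bar> \<le> 1"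
            using main01 by (auto simp: indicator_def)
          then have "(main x - indicator ?D x)\<^sup>2 \<le> 1"
            by (simp add: abs_square_le_1)
          then show ?thesis
            using 3 J by simp
        qed
      next
        case False
        then show ?thesis
          using BiBo by (auto simp: main_def indicator_def)
      qed
      have "(err x)\<^sup>2 \<le> F x" for x
      proof -
        have "(err x)\<^sup>2 = ((iter_partial j w x - main x) + (main x - (if j = replicate m 2 then indicator ?D x else 0)))\<^sup>2"
          by (simp add: err_def)
        also have "\<dots> \<le> 2 * (iter_partial j w x - main x)\<^sup>2 + 2 * (main x - (if j = replicate m 2 then indicator ?D x else 0))\<^sup>2"
          by (rule square_add_le)
        also have "\<dots> \<le> 2 * ((C * e)\<^sup>2 * indicator B2 x) + 2 * (indicat_real Bo x - indicat_real Bi x)"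
          using e1[of x] e2'[of x] by (intro add_mono mult_left_mono) auto
        finally show ?thesis
          by (simp add: F_def)
      qed
      moreover have "0 \<le> F x" for x
        using BiBo by (auto simp: F_def indicator_def)
      ultimately have "integral\<^sup>L lebesgue (\<lambda>x. indicator U x * (err x)\<^sup>2) \<le> integral\<^sup>L lebesgue F"
        by (intro integral_mono'[OF F_int]) (auto simp: indicator_def)
      then have "integral\<^sup>L (lebesgue_on U) (\<lambda>x. (err x)\<^sup>2) \<le> integral\<^sup>L lebesgue F"
        using U(1) by (subst (asm) lebesgue_integrable_indicator) auto
      with F_le show ?thesis
        by (simp add: err_def)
    qed
    with fg(1,2) test show "\<exists>f g. smooth_real f \<and> smooth_real g \<and> separated f g \<in> test_functions U \<and>
      (\<forall>j\<in>multi_indices m. integral\<^sup>L (lebesgue_on U) (\<lambda>x. (iter_partial j (separated f g) x -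
           (if j = replicate m 2 then indicator ?D x else 0))\<^sup>2)
         \<le> (8 * C\<^sup>2 * e + 6 * d) * measure lebesgue ?D)"
      unfolding w_def by blast
  qed simp
qed

section \<open>Polynomial data and the symmetric basis\<close>

lemma prod_nth_length: "(\<Prod>l<length i. h (i ! l)) = prod_list (map h i)" for h :: "'a \<Rightarrow> real"
  by (simp add: prod.list_conv_set_nth lessThan_atLeast0)

lemma monomial_separated:
  assumes "i \<in> multi_indices m"
  shows "monomial m i = separated (\<lambda>s. 1 * s ^ count_list i 1) (\<lambda>t. 1 / fact m * t ^ count_list i 2)"
proof
  fix x :: "real^2"
  have "prod_list (map (($) x) i) = x $ 1 ^ count_list i 1 * x $ 2 ^ count_list i 2" for i
  proof (induction i)
    case (Cons a i)
    then show ?case using exhaust_2[of a] by auto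
  qed simp
  then show "monomial m i x = separated (\<lambda>s. 1 * s ^ count_list i 1) (\<lambda>t. 1 / fact m * t ^ count_list i 2) x"
    using assms prod_nth_length[of "($) x" i] by (simp add: monomial_def separated_def multi_indices_def)
qed

text \<open>The components of the identity on symmetric tensors, that is, of the orthogonal projection of
  tensors of order \<open>m\<close> onto the symmetric ones: the transversal index occurs \<open>b\<close> times in
  \<open>m choose b\<close> multi-indices.\<close>

definition sym_identity :: "nat \<Rightarrow> 2 list \<Rightarrow> 2 list \<Rightarrow> real" where
  "sym_identity m i j = (if count_list i 2 = count_list j 2 then 1 / real (m choose count_list j 2) else 0)"

lemma count_list_1_eq: "i \<in> multi_indices m \<Longrightarrow> count_list i 1 = m - count_list i 2"
  and count_list_2_le: "i \<in> multi_indices m \<Longrightarrow> count_list i 2 \<le> m"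
  using count_list_1_2[of i] by (auto simp: multi_indices_def)

lemma smooth_plane_monomial: "i \<in> multi_indices m \<Longrightarrow> smooth_plane (monomial m i)"
  unfolding monomial_separated
  by (intro smooth_plane_separated smooth_real_cmult smooth_real_power)

lemma iter_partial_monomial:
  assumes i: "i \<in> multi_indices m" and j: "j \<in> multi_indices m"
  shows "iter_partial (rev j) (monomial m i) x = sym_identity m i j"
proof -
  note c = count_list_1_eq[OF i] count_list_1_eq[OF j] count_list_2_le[OF i] count_list_2_le[OF j]
  have "iter_partial (rev j) (monomial m i) =
      separated ((deriv ^^ count_list j 1) (\<lambda>s. 1 * s ^ count_list i 1)) ((deriv ^^ count_list j 2) (\<lambda>t. 1 / fact m * t ^ count_list i 2))"
    unfolding monomial_separated[OF i]
    by (subst iter_partial_separated) (simp_all only: smooth_real_cmult smooth_real_power count_list_rev)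
  then have eq: "iter_partial (rev j) (monomial m i) x =
     (if count_list j 1 \<le> count_list i 1 then fact (count_list i 1) / fact (count_list i 1 - count_list j 1) * (x $ 1) ^ (count_list i 1 - count_list j 1) else 0) *
     (if count_list j 2 \<le> count_list i 2 then 1 / fact m * (fact (count_list i 2) / fact (count_list i 2 - count_list j 2)) * (x $ 2) ^ (count_list i 2 - count_list j 2) else 0)"
    by (simp only: higher_deriv_power higher_deriv_power[where c = 1, unfolded mult_1] separated_def mult_1)
  show ?thesis
  proof (cases "count_list i 2 = count_list j 2")
    case True
    then show ?thesis
      unfolding eq using c by (simp add: sym_identity_def binomial_fact)
  next
    case False
    then have "\<not> count_list j 1 \<le> count_list i 1 \<or> \<not> count_list j 2 \<le> count_list i 2"
      using c by auto
    then show ?thesis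
      unfolding eq using False by (auto simp: sym_identity_def)
  qed
qed

lemma vectors_prod_axis:
  assumes "length k = length i"
  shows "vectors_prod (map (\<lambda>a. axis a 1) k) i = (if k = i then 1 else 0)"
proof -
  have "vectors_prod (map (\<lambda>a. axis a 1) k) i = (\<Prod>l<length i. if k ! l = i ! l then 1 else 0)"
    unfolding vectors_prod_def using assms by (auto simp: axis_def intro!: prod.cong)
  also have "\<dots> = (if k = i then 1 else 0)"
  proof (cases "k = i")
    case False
    then obtain l where "l < length i" "k ! l \<noteq> i ! l"
      using assms by (auto simp: list_eq_iff_nth_eq)
    with False show ?thesis
      by (auto intro!: prod_zero)
  qed simp
  finally show ?thesis .
qed

lemma sym_basis_eq:
  assumes i: "i \<in> multi_indices m" and h: "1 \<le> h" "h \<le> m + 1"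
  shows "sym_basis m h i = (if count_list i 2 = h - 1 then 1 / sqrt (real (m choose (h - 1))) else 0)"
proof -
  let ?K = "{k \<in> multi_indices m. count_list k 1 = m + 1 - h \<and> count_list k 2 = h - 1}"
  have "(\<Sum>k\<in>?K. vectors_prod (map (\<lambda>a. axis a 1) k) i) = (\<Sum>k\<in>?K. if k = i then 1 else 0)"
    using i by (intro sum.cong refl vectors_prod_axis) (auto simp: multi_indices_def)
  also have "\<dots> = (if i \<in> ?K then 1 else 0)"
    using finite_multi_indices(2)[of m] by simp
  also have "i \<in> ?K \<longleftrightarrow> count_list i 2 = h - 1"
    using i h count_list_1_eq[OF i] by auto
  finally show ?thesis
    by (simp add: sym_basis_def)
qed

text \<open>For fixed \<open>j\<close> only one summand is nonzero, the one whose basis tensor has as many transversal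
  indices as \<open>j\<close>; it is weighted with \<open>1 / \<kappa>\<close> precisely if all indices of \<open>j\<close> are transversal.\<close>

lemma spectral_sum:
  assumes i: "i \<in> multi_indices m" and j: "j \<in> multi_indices m"
  shows "(\<Sum>n=1..m. tensor_prod (sym_basis m n) (sym_basis m n) i j)
          + 1 / \<kappa> * tensor_prod (sym_basis m (m + 1)) (sym_basis m (m + 1)) i j =
     (if j = replicate m 2 then 1 / \<kappa> else 1) * sym_identity m i j"
proof -
  have J: "j = replicate m 2 \<longleftrightarrow> count_list j 2 = m"
    using count_list_1_eq_0[of j] count_list_1_eq[OF j] count_list_2_le[OF j] j by (auto simp: multi_indices_def)
  have tp: "tensor_prod (sym_basis m n) (sym_basis m n) i j =
      (if n = count_list j 2 + 1 then sym_identity m i j else 0)" if "1 \<le> n" "n \<le> m + 1" for n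
    unfolding tensor_prod_def sym_basis_eq[OF i that] sym_basis_eq[OF j that] sym_identity_def
    using that by auto
  have "(\<Sum>n=1..m. tensor_prod (sym_basis m n) (sym_basis m n) i j) =
      (\<Sum>n=1..m. if n = count_list j 2 + 1 then sym_identity m i j else 0)"
    by (intro sum.cong refl tp) auto
  also have "\<dots> = (if count_list j 2 < m then sym_identity m i j else 0)"
    by (auto simp: sum.delta)
  finally show ?thesis
    using tp[of "m + 1"] count_list_2_le[OF j] by (auto simp: J)
qed

section \<open>The limit tensor\<close>

lemma rect_subset_neighbourhood:
  assumes "open U" "(0 :: real^2) \<in> U"
  obtains \<rho> where "\<rho> > 0" "\<And>e. e < \<rho> \<Longrightarrow> rect (2 * e) (2 * e) \<subseteq> U"
proof -
  obtain \<rho> where \<rho>: "\<rho> > 0" "ball 0 \<rho> \<subseteq> U"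
    using assms openE by blast
  have "rect (2 * e) (2 * e) \<subseteq> U" if "e < \<rho> / 4" for e
  proof
    fix x assume "x \<in> rect (2 * e) (2 * e)"
    then have "norm x < \<rho>"
      using norm_plane_le[of x] that by (simp add: in_rect)
    with \<rho>(2) show "x \<in> U"
      by auto
  qed
  with \<rho>(1) that[of "\<rho> / 4"] show thesis by simp
qed

theorem theorem4p14:
  fixes m :: nat and \<kappa> \<delta>\<^sub>0 :: real and \<Omega> K L\<^sub>0 :: "(real^2) set"
    and \<epsilon> :: "nat \<Rightarrow> real" and M :: "2 list \<Rightarrow> 2 list \<Rightarrow> real"
  assumes "m \<ge> 2" and "0 < \<kappa>" and "\<kappa> < 1 / 2"
    and "open \<Omega>" and "connected \<Omega>" and "bounded \<Omega>" and "lipschitz_boundary \<Omega>"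
    and "K \<subseteq> \<Omega>" and "closed K" and "hausdorff_measure 2 K > 0"
    and "\<delta>\<^sub>0 > 0"
    and "L\<^sub>0 \<subseteq> \<Omega> - K" and "open L\<^sub>0" and "connected L\<^sub>0" and "smooth_boundary L\<^sub>0"
    and "setdist (closure L\<^sub>0) (frontier \<Omega> \<union> K) \<ge> \<delta>\<^sub>0"
    and "0 \<in> L\<^sub>0"
    and "\<And>k. 0 < \<epsilon> k" and "\<And>k. \<epsilon> k < 1"
    and "\<And>k. inclusion 0 (axis 1 1) (\<epsilon> k) \<subseteq> L\<^sub>0"
    and "\<epsilon> \<longlonglongrightarrow> 0"
    and "is_limit_tensor m \<kappa> \<Omega> 0 (axis 1 1) \<epsilon> M"
  shows "\<forall>i\<in>multi_indices m. \<forall>j\<in>multi_indices m.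
    M i j = (\<Sum>n=1..m. tensor_prod (sym_basis m n) (sym_basis m n) i j)
          + 1 / \<kappa> * tensor_prod (sym_basis m (m + 1)) (sym_basis m (m + 1)) i j"

proof (intro ballI)
  fix i j assume i: "i \<in> multi_indices m" and j: "j \<in> multi_indices m"
  let ?D = "\<lambda>k. inclusion 0 (axis 1 1) (\<epsilon> k)"
  define A where "A = sym_identity m i"
  define target where "target = (if j = replicate m 2 then 1 / \<kappa> else 1) * A j"
  define S where "S = transmission.stability_const m \<kappa> A"
  obtain V where V: "\<And>k. weak_solution m \<Omega> (coefficient \<kappa> (?D k)) (monomial m i) (V k i)"
    and lim: "\<And>\<phi>. continuous_on (closure \<Omega>) \<phi> \<Longrightarrow>
      (\<lambda>k. 1 / measure lebesgue (?D k) * integral\<^sup>L (lebesgue_on (?D k)) (\<lambda>x. weak_partial \<Omega> j (V k i) x * \<phi> x))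
        \<longlonglongrightarrow> M i j * \<phi> 0"
    using assms(22) i j unfolding is_limit_tensor_def by blast
  define avg where "avg k = 1 / measure lebesgue (?D k) * integral\<^sup>L (lebesgue_on (?D k)) (weak_partial \<Omega> j (V k i))" for k
  have avg_lim: "avg \<longlonglongrightarrow> M i j"
    using lim[of "\<lambda>_. 1"] by (simp add: avg_def[abs_def])
  have sub: "?D k \<subseteq> \<Omega>" for k
    using assms(12) assms(20)[of k] by blast
  have tr: "transmission m \<kappa> \<Omega> (?D k) (monomial m i) (V k i) A" for k
    by unfold_locales
       (use assms(1-6) sub V i in \<open>auto simp: inclusion_open A_def iter_partial_monomial smooth_plane_monomial\<close>)
  have "0 \<in> \<Omega>"
    using assms(12,17) by blast
  then obtain \<rho> where \<rho>: "\<rho> > 0" "\<And>e. e < \<rho> \<Longrightarrow> rect (2 * e) (2 * e) \<subseteq> \<Omega>"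
    using rect_subset_neighbourhood[OF assms(4)] by blast
  \<comment> \<open>The cutoff width \<open>d\<close> is fixed while the inclusions shrink, and tends to \<open>0\<close> only afterwards.\<close>
  have bound: "\<bar>M i j - target\<bar> \<le> S * sqrt (6 * d)" if d: "0 < d" "d \<le> 1" for d
  proof -
    have m: "m > 0" using assms(1) by simp
    obtain C where C: "C \<ge> 0" "\<And>e U. 0 < e \<Longrightarrow> e \<le> d \<Longrightarrow> open U \<Longrightarrow> rect (2 * e) (2 * e) \<subseteq> U \<Longrightarrow>
      \<exists>f g. smooth_real f \<and> smooth_real g \<and> separated f g \<in> test_functions U \<and>
      (\<forall>j\<in>multi_indices m. integral\<^sup>L (lebesgue_on U) (\<lambda>x. (iter_partial j (separated f g) x -
           (if j = replicate m 2 then indicator (inclusion 0 (axis 1 1) e) x else 0))\<^sup>2)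
         \<le> (C * e + 6 * d) * measure lebesgue (inclusion 0 (axis 1 1) e))"
      using test_functions_near_inclusion[OF d m] by blast
    have "\<bar>avg k - target\<bar> \<le> S * sqrt (C * \<epsilon> k + 6 * d)" if k: "\<epsilon> k < min d \<rho>" for k
    proof -
      interpret transmission m \<kappa> \<Omega> "?D k" "monomial m i" "V k i" A
        by (rule tr)
      have "rect (2 * \<epsilon> k) (2 * \<epsilon> k) \<subseteq> \<Omega>" "\<epsilon> k \<le> d"
        using k \<rho>(2) by auto
      from C(2)[OF assms(18)[of k] this(2) assms(4) this(1)]
      obtain f g where fg: "smooth_real f" "smooth_real g" "separated f g \<in> test_functions \<Omega>"
        and err: "\<And>j. j \<in> multi_indices m \<Longrightarrow> integral\<^sup>L (lebesgue_on \<Omega>) (\<lambda>x. (test_error (separated f g) j x)\<^sup>2)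
           \<le> (C * \<epsilon> k + 6 * d) * vol"
        unfolding test_error_def vol_def by blast
      have "0 < 4 * \<epsilon> k ^ 3"
        using assms(18)[of k] by simp
      then have "vol > 0"
        unfolding vol_def using inclusion_measure[OF assms(18)[of k]] by linarith
      moreover have "0 \<le> C * \<epsilon> k + 6 * d"
        using C(1) assms(18)[of k] d by simp
      ultimately show ?thesis
        using solution_average[OF fg(1,2) refl fg(3) _ err j] by (simp add: avg_def target_def S_def vol_def)
    qed
    moreover have "\<forall>\<^sub>F k in sequentially. \<epsilon> k < min d \<rho>"
      using assms(21) d \<rho>(1) by (intro order_tendstoD(2)) auto
    ultimately have "\<forall>\<^sub>F k in sequentially. \<bar>avg k - target\<bar> \<le> S * sqrt (C * \<epsilon> k + 6 * d)"
      by (auto elim: eventually_mono)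
    moreover have "(\<lambda>k. S * sqrt (C * \<epsilon> k + 6 * d)) \<longlonglongrightarrow> S * sqrt (C * 0 + 6 * d)"
      by (intro tendsto_intros assms(21))
    moreover have "(\<lambda>k. \<bar>avg k - target\<bar>) \<longlonglongrightarrow> \<bar>M i j - target\<bar>"
      by (intro tendsto_intros avg_lim)
    ultimately show ?thesis
      using tendsto_le[OF sequentially_bot] by fastforce
  qed
  have "((\<lambda>d. S * sqrt (6 * d)) \<longlongrightarrow> S * sqrt (6 * 0)) (at_right 0)"
    by (intro tendsto_intros)
  moreover have "\<forall>\<^sub>F d in at_right 0. \<bar>M i j - target\<bar> \<le> S * sqrt (6 * d)"
    by (rule eventually_at_rightI[of 0 1]) (auto intro: bound)
  ultimately have "\<bar>M i j - target\<bar> \<le> S * sqrt (6 * 0)"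
    by (intro tendsto_lowerbound) auto
  then have "M i j = target"
    by simp
  then show "M i j = (\<Sum>n=1..m. tensor_prod (sym_basis m n) (sym_basis m n) i j)
          + 1 / \<kappa> * tensor_prod (sym_basis m (m + 1)) (sym_basis m (m + 1)) i j"
    unfolding spectral_sum[OF i j] by (simp add: target_def A_def)
qed

end
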